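(* Let $\mathbf{f}\in L^2\big((0,T];[L^2(\Omega)]^2\big)$ and let $\mathbf{u}_h\in C^2\big((0,T];\mathbf{V}^h_k\big)$ be the solution of the semi-discrete virtual element problem $$m_h(\ddot{\mathbf{u}}_h(t),\mathbf{v}_h)+a_h(\mathbf{u}_h(t),\mathbf{v}_h)=F_h(\mathbf{v}_h)\qquad\forall\,\mathbf{v}_h\in\mathbf{V}^h_k,\ t\in(0,T],$$ with $\mathbf{u}_h(0)=(\mathbf{u}_0)_I$ and $\dot{\mathbf{u}}_h(0)=(\mathbf{u}_1)_I$. Then for every $t\in(0,T]$ $$|||\mathbf{u}_h(t)|||\ \le\ C\Big(|||(\mathbf{u}_0)_I|||+\int_0^t\|\mathbf{f}(\tau)\|_{0,\Omega}\,d\tau\Big),$$ where $|||(\mathbf{u}_0)_I|||$ denotes the energy norm of the discrete initial state, i.e. $|||(\mathbf{u}_0)_I|||^2=|||\mathbf{u}_h(0)|||^2=\|(\mathbf{u}_1)_I\|_0^2+|(\mathbf{u}_0)_I|_1^2$. The constant $C$ is independent of $h$, but may depend on the model parameters, the approximation constants and the polynomial degree $k$.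
   Context: Continuous problem. $\Omega\subset\mathbb{R}^2$ is an open bounded polygonal domain with boundary $\Gamma=\overline{\Gamma}_D\cup\overline{\Gamma}_N$, $\Gamma_D\cap\Gamma_N=\emptyset$, $|\Gamma_D|>0$; $T>0$. $\mathbf{V}=[H^1_{\Gamma_D}(\Omega)]^2$ is the space of vector-valued $H^1$ functions with zero trace on $\Gamma_D$. The mass density is $\rho=1$ and the Neumann datum is zero. $\varepsilon(\mathbf{v})=(\nabla\mathbf{v}+(\nabla\mathbf{v})^T)/2$, $\sigma(\mathbf{v})=\mathcal{D}\varepsilon(\mathbf{v})$ with $\mathcal{D}\tau=2\mu\tau+\lambda\,\mathrm{tr}(\tau)\mathsf{I}$; the Lamé coefficients $\lambda,\mu$ are nonnegative and in $L^\infty(\Omega)$. $m(\mathbf{w},\mathbf{v})=\int_\Omega\mathbf{w}\cdot\mathbf{v}\,dV$, $a(\mathbf{w},\mathbf{v})=\int_\Omega\sigma(\mathbf{w}):\varepsilon(\mathbf{v})\,dV$; $m^P,a^P$ are the same integrals over an element $P$. The form $a$ is coercive on $\mathbf{V}$: $a(\mathbf{v},\mathbf{v})\ge c_0|\mathbf{v}|_1^2$ for some $c_0>0$. $\|\cdot\|_0$ is the $L^2(\Omega)$ norm and $|\cdot|_1$ the $H^1(\Omega)$ seminorm. Meshes. $\Omega_h=\{P\}$ is a decomposition of $\Omega$ into nonoverlapping polygons $P$ with diameter $h_P$, $h=\max_P h_P$, belonging to a family satisfying: there is $\varrho>0$ independent of $h$ such that every $P$ is star-shaped with respect to a disk of radius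 $\ge\varrho h_P$ and every edge $e$ of $P$ has length $h_e\ge\varrho h_P$. Virtual element space of order $k\ge1$. $\mathbb{P}_\ell(P)$ denotes polynomials of degree $\le\ell$ on $P$, $\mathbb{P}_{-1}(P)=\{0\}$. $\Pi^\nabla_k v\in\mathbb{P}_k(P)$ is defined by $\int_P\nabla(\Pi^\nabla_k v-v)\cdot\nabla q\,dV=0$ for all $q\in\mathbb{P}_k(P)$, together with $\int_{\partial P}(\Pi^\nabla_1v-v)\,ds=0$ if $k=1$ and $\int_P(\Pi^\nabla_kv-v)\,dV=0$ if $k\ge2$. The scalar local space $V^h_k(P)$ consists of $v_h\in H^1(P)$ with $v_h|_{\partial P}$ continuous, $v_h|_e\in\mathbb{P}_k(e)$ for each edge $e$, $\Delta v_h\in\mathbb{P}_k(P)$, and $\int_P(v_h-\Pi^\nabla_kv_h)\,q\,dV=0$ for all scaled monomials $q$ (in $(\mathbf{x}-\mathbf{x}_P)/h_P$, $\mathbf{x}_P$ the barycenter) of degree $k-1$ and $k$. Its degrees of freedom are: vertex values; moments against polynomials of degree $\le k-2$ on each edge; moments against polynomials of degree $\le k-2$ on $P$. $\mathbf{V}^h_k=\{\mathbf{v}\in\mathbf{V}:\mathbf{v}|_P\in[V^h_k(P)]^2\ \forall P\in\Omega_h\}$. The virtual element interpolant $\mathbf{w}_I\in\mathbf{V}^h_k$ of a field $\mathbf{w}$ is the function with the same degrees of freedom as $\mathbf{w}$; whenever this notation is used, $\mathbf{w}$ is assumed regular enough for them to be defined. $\Pi^0_\ell$ is the (elementwise, componentwise)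 $L^2$-orthogonal projection onto polynomials of degree $\le\ell$. Discrete forms. $m_h=\sum_Pm_h^P$, $a_h=\sum_Pa_h^P$, with $m_h^P(\mathbf{v}_h,\mathbf{w}_h)=\int_P\Pi^0_k\mathbf{v}_h\cdot\Pi^0_k\mathbf{w}_h\,dV+S^P_m(\mathbf{v}_h,\mathbf{w}_h)$ and $a_h^P(\mathbf{v}_h,\mathbf{w}_h)=\int_P\mathcal{D}\,\Pi^0_{k-1}\varepsilon(\mathbf{v}_h):\Pi^0_{k-1}\varepsilon(\mathbf{w}_h)\,dV+S^P_a(\mathbf{v}_h,\mathbf{w}_h)$, where $S^P_m,S^P_a$ are symmetric bilinear forms (stabilizations) such that, for all $\mathbf{v}_h\in[V^h_k(P)]^2$ and $\mathbf{q}\in[\mathbb{P}_k(P)]^2$: ($k$-consistency) $m_h^P(\mathbf{v}_h,\mathbf{q})=m^P(\mathbf{v}_h,\mathbf{q})$, $a_h^P(\mathbf{v}_h,\mathbf{q})=a^P(\mathbf{v}_h,\mathbf{q})$; (stability) $\mu_*m^P(\mathbf{v}_h,\mathbf{v}_h)\le m_h^P(\mathbf{v}_h,\mathbf{v}_h)\le\mu^*m^P(\mathbf{v}_h,\mathbf{v}_h)$, $\alpha_*a^P(\mathbf{v}_h,\mathbf{v}_h)\le a_h^P(\mathbf{v}_h,\mathbf{v}_h)\le\alpha^*a^P(\mathbf{v}_h,\mathbf{v}_h)$, with positive constants $\mu_*,\mu^*,\alpha_*,\alpha^*$ independent of $h$ and $P$ (they may depend on the model coefficients and $k$). The discrete load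 is $F_h(\mathbf{v}_h)=\int_\Omega\mathbf{f}(t)\cdot\Pi^0_{k-2}\mathbf{v}_h\,dV$. Energy norm: $|||\mathbf{v}(t)|||^2=\|\dot{\mathbf{v}}(t)\|_0^2+|\mathbf{v}(t)|_1^2$ for time-dependent $\mathbf{v}$; the dot is the time derivative. "Approximation constants" are $\varrho,\mu_*,\mu^*,\alpha_*,\alpha^*$. *)

theory Defs
  imports "HOL-Analysis.Analysis"
begin

section \<open>Lebesgue and Sobolev spaces in the plane\<close>

text \<open>Elements of $L^2$ and $H^1$ are represented by functions on the whole space, of which only
  the almost-everywhere class on the set under consideration matters.\<close>

type_synonym pt = "real^2"

definition L2 :: "'a::euclidean_space set \<Rightarrow> ('a \<Rightarrow> 'b::euclidean_space) \<Rightarrow> bool" where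
  "L2 S v \<longleftrightarrow> v \<in> borel_measurable (lebesgue_on S) \<and>
     integrable (lebesgue_on S) (\<lambda>x. (norm (v x))\<^sup>2)"

definition L2_norm :: "'a::euclidean_space set \<Rightarrow> ('a \<Rightarrow> 'b::euclidean_space) \<Rightarrow> real" where
  "L2_norm S v = sqrt (\<integral>x. (norm (v x))\<^sup>2 \<partial>lebesgue_on S)"

definition pderiv_at :: "2 \<Rightarrow> (pt \<Rightarrow> real) \<Rightarrow> pt \<Rightarrow> real" where
  "pderiv_at i \<phi> x = frechet_derivative \<phi> (at x) (axis i 1)"

definition grad :: "(pt \<Rightarrow> real) \<Rightarrow> pt \<Rightarrow> pt" where
  "grad \<phi> x = (\<chi> i. pderiv_at i \<phi> x)"

primrec C_times :: "nat \<Rightarrow> (pt \<Rightarrow> real) \<Rightarrow> bool" where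
  "C_times 0 \<phi> \<longleftrightarrow> continuous_on UNIV \<phi>"
| "C_times (Suc n) \<phi> \<longleftrightarrow>
     (\<forall>x. \<phi> differentiable (at x)) \<and> (\<forall>i. C_times n (pderiv_at i \<phi>))"

definition C_infinity :: "(pt \<Rightarrow> real) set" where
  "C_infinity = {\<phi>. \<forall>n. C_times n \<phi>}"

definition test_functions :: "pt set \<Rightarrow> (pt \<Rightarrow> real) set" where
  "test_functions S = {\<phi> \<in> C_infinity. compact (closure {x. \<phi> x \<noteq> 0}) \<and> closure {x. \<phi> x \<noteq> 0} \<subseteq> S}"

definition has_weak_grad :: "pt set \<Rightarrow> (pt \<Rightarrow> real) \<Rightarrow> (pt \<Rightarrow> pt) \<Rightarrow> bool" where
  "has_weak_grad S v g \<longleftrightarrow> L2 S g \<and>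
     (\<forall>\<phi>\<in>test_functions S. \<forall>i.
        (\<integral>x. v x * pderiv_at i \<phi> x \<partial>lebesgue_on S) = - (\<integral>x. g x $ i * \<phi> x \<partial>lebesgue_on S))"

definition H1 :: "pt set \<Rightarrow> (pt \<Rightarrow> real) set" where
  "H1 S = {v. L2 S v \<and> (\<exists>g. has_weak_grad S v g)}"

text \<open>The weak gradient is unique only up to null sets; all uses below are insensitive to the
  choice.\<close>

definition wgrad :: "pt set \<Rightarrow> (pt \<Rightarrow> real) \<Rightarrow> pt \<Rightarrow> pt" where
  "wgrad S v = (SOME g. has_weak_grad S v g)"

definition has_weak_laplacian :: "pt set \<Rightarrow> (pt \<Rightarrow> real) \<Rightarrow> (pt \<Rightarrow> real) \<Rightarrow> bool" where
  "has_weak_laplacian S v p \<longleftrightarrow>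
     (\<forall>\<phi>\<in>test_functions S.
        (\<integral>x. wgrad S v x \<bullet> grad \<phi> x \<partial>lebesgue_on S) = - (\<integral>x. p x * \<phi> x \<partial>lebesgue_on S))"

text \<open>Vector fields. Row \<open>i\<close> of \<open>jac S v x\<close> is the weak gradient of the \<open>i\<close>-th component; the norm
  and the inner product of \<^typ>\<open>real^2^2\<close> are the Frobenius ones.\<close>

definition H1_vec :: "pt set \<Rightarrow> (pt \<Rightarrow> pt) set" where
  "H1_vec S = {v. \<forall>i. (\<lambda>x. v x $ i) \<in> H1 S}"

definition jac :: "pt set \<Rightarrow> (pt \<Rightarrow> pt) \<Rightarrow> pt \<Rightarrow> real^2^2" where
  "jac S v x = (\<chi> i. wgrad S (\<lambda>y. v y $ i) x)"

definition H1_seminorm :: "pt set \<Rightarrow> (pt \<Rightarrow> pt) \<Rightarrow> real" where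
  "H1_seminorm S v = L2_norm S (jac S v)"

definition H1_norm :: "pt set \<Rightarrow> (pt \<Rightarrow> pt) \<Rightarrow> real" where
  "H1_norm S v = sqrt ((L2_norm S v)\<^sup>2 + (H1_seminorm S v)\<^sup>2)"

definition Linfty :: "pt set \<Rightarrow> (pt \<Rightarrow> real) \<Rightarrow> bool" where
  "Linfty S c \<longleftrightarrow> c \<in> borel_measurable (lebesgue_on S) \<and>
     (\<exists>B. AE x in lebesgue_on S. \<bar>c x\<bar> \<le> B)"


section \<open>Polygons, boundary integrals and traces\<close>

text \<open>A polygon is given by the cyclic list of its vertices. Consecutive edges may be collinear
  (hanging nodes of a mesh are vertices).\<close>

fun polypath :: "pt list \<Rightarrow> real \<Rightarrow> pt" where
  "polypath [] = linepath 0 0"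
| "polypath [a] = linepath a a"
| "polypath [a, b] = linepath a b"
| "polypath (a # b # c # vs) = linepath a b +++ polypath (b # c # vs)"

definition polygon_boundary :: "pt list \<Rightarrow> pt set" where
  "polygon_boundary vs = path_image (polypath (vs @ [hd vs]))"

definition simple_polygon :: "pt list \<Rightarrow> bool" where
  "simple_polygon vs \<longleftrightarrow> vs \<noteq> [] \<and> simple_path (polypath (vs @ [hd vs]))"

definition region :: "pt list \<Rightarrow> pt set" where
  "region vs = inside (polygon_boundary vs)"

definition edges :: "pt list \<Rightarrow> (pt \<times> pt) set" where
  "edges vs = set (zip vs (rotate1 vs))"

definition line_integral :: "(pt \<times> pt) set \<Rightarrow> (pt \<Rightarrow> real) \<Rightarrow> real" where
  "line_integral E g = (\<Sum>(a, b)\<in>E. dist a b * (\<integral>s. g (linepath a b s) \<partial>lebesgue_on {0..1}))"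

text \<open>The trace operator is the continuous extension to $H^1(S)$ of the restriction of functions
  smooth up to the boundary: \<open>g\<close> is the trace of \<open>v\<close> on the boundary of \<open>S\<close> (the union of the
  edges in \<open>E\<close>) if smooth functions converge to \<open>v\<close> in $H^1(S)$ while their restrictions
  converge to \<open>g\<close> in $L^2$ of the boundary.\<close>

definition has_trace :: "(pt \<times> pt) set \<Rightarrow> pt set \<Rightarrow> (pt \<Rightarrow> real) \<Rightarrow> (pt \<Rightarrow> real) \<Rightarrow> bool" where
  "has_trace E S v g \<longleftrightarrow>
     (\<forall>(a, b)\<in>E. L2 {0..1} (\<lambda>s. g (linepath a b s))) \<and>
     (\<exists>\<phi>::nat \<Rightarrow> pt \<Rightarrow> real. (\<forall>n. \<phi> n \<in> C_infinity) \<and>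
        (\<lambda>n. L2_norm S (\<lambda>x. \<phi> n x - v x)) \<longlonglongrightarrow> 0 \<and>
        (\<lambda>n. L2_norm S (\<lambda>x. grad (\<phi> n) x - wgrad S v x)) \<longlonglongrightarrow> 0 \<and>
        (\<lambda>n. line_integral E (\<lambda>x. (\<phi> n x - g x)\<^sup>2)) \<longlonglongrightarrow> 0)"

text \<open>The boundary of a polygonal domain consists of finitely many pairwise disjoint simple closed
  polygons (several if the domain has holes). This makes the domain Lipschitz.\<close>

definition polygonal_domain :: "pt set \<Rightarrow> pt list set \<Rightarrow> bool" where
  "polygonal_domain \<Omega> B \<longleftrightarrow>
     open \<Omega> \<and> bounded \<Omega> \<and> connected \<Omega> \<and> \<Omega> \<noteq> {} \<and>
     finite B \<and> (\<forall>vs\<in>B. simple_polygon vs) \<and>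
     (\<forall>vs\<in>B. \<forall>ws\<in>B. vs \<noteq> ws \<longrightarrow> polygon_boundary vs \<inter> polygon_boundary ws = {}) \<and>
     frontier \<Omega> = (\<Union>vs\<in>B. polygon_boundary vs)"

definition domain_edges :: "pt list set \<Rightarrow> (pt \<times> pt) set" where
  "domain_edges B = (\<Union>vs\<in>B. edges vs)"

definition boundary_partition :: "pt set \<Rightarrow> pt list set \<Rightarrow> pt set \<Rightarrow> pt set \<Rightarrow> bool" where
  "boundary_partition \<Omega> B \<Gamma>D \<Gamma>N \<longleftrightarrow>
     \<Gamma>D \<in> sets borel \<and> \<Gamma>N \<in> sets borel \<and> \<Gamma>D \<subseteq> frontier \<Omega> \<and> \<Gamma>N \<subseteq> frontier \<Omega> \<and>
     frontier \<Omega> = closure \<Gamma>D \<union> closure \<Gamma>N \<and> \<Gamma>D \<inter> \<Gamma>N = {} \<and>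
     line_integral (domain_edges B) (indicator \<Gamma>D) > 0"

definition V_space :: "pt set \<Rightarrow> pt list set \<Rightarrow> pt set \<Rightarrow> (pt \<Rightarrow> pt) set" where
  "V_space \<Omega> B \<Gamma>D = {v \<in> H1_vec \<Omega>. \<forall>i. \<exists>g.
     has_trace (domain_edges B) \<Omega> (\<lambda>x. v x $ i) g \<and> (\<forall>x\<in>\<Gamma>D. g x = 0)}"


section \<open>Linear elasticity\<close>

definition strain :: "pt set \<Rightarrow> (pt \<Rightarrow> pt) \<Rightarrow> pt \<Rightarrow> real^2^2" where
  "strain S v x = (1/2) *\<^sub>R (jac S v x + transpose (jac S v x))"

definition hooke :: "(pt \<Rightarrow> real) \<Rightarrow> (pt \<Rightarrow> real) \<Rightarrow> pt \<Rightarrow> real^2^2 \<Rightarrow> real^2^2" where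
  "hooke lam mu x \<tau> = (2 * mu x) *\<^sub>R \<tau> + (lam x * trace \<tau>) *\<^sub>R mat 1"

definition m_form :: "pt set \<Rightarrow> (pt \<Rightarrow> pt) \<Rightarrow> (pt \<Rightarrow> pt) \<Rightarrow> real" where
  "m_form S w v = (\<integral>x. w x \<bullet> v x \<partial>lebesgue_on S)"

definition a_form ::
  "(pt \<Rightarrow> real) \<Rightarrow> (pt \<Rightarrow> real) \<Rightarrow> pt set \<Rightarrow> (pt \<Rightarrow> pt) \<Rightarrow> (pt \<Rightarrow> pt) \<Rightarrow> real" where
  "a_form lam mu S w v = (\<integral>x. hooke lam mu x (strain S w x) \<bullet> strain S v x \<partial>lebesgue_on S)"


section \<open>Polygonal meshes\<close>

definition is_mesh :: "pt set \<Rightarrow> pt list set \<Rightarrow> bool" where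
  "is_mesh \<Omega> M \<longleftrightarrow>
     finite M \<and> (\<forall>P\<in>M. simple_polygon P \<and> region P \<subseteq> \<Omega>) \<and>
     (\<forall>P\<in>M. \<forall>Q\<in>M. P \<noteq> Q \<longrightarrow> region P \<inter> region Q = {}) \<and>
     closure \<Omega> = (\<Union>P\<in>M. closure (region P))"

definition star_shaped_disk :: "pt set \<Rightarrow> real \<Rightarrow> bool" where
  "star_shaped_disk S r \<longleftrightarrow>
     (\<exists>c. ball c r \<subseteq> S \<and> (\<forall>y\<in>ball c r. \<forall>x\<in>S. closed_segment y x \<subseteq> S))"

definition mesh_regular :: "real \<Rightarrow> pt list set \<Rightarrow> bool" where
  "mesh_regular \<rho> M \<longleftrightarrow> (\<forall>P\<in>M.
     (\<exists>r \<ge> \<rho> * diameter (region P). star_shaped_disk (region P) r) \<and>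
     (\<forall>(a, b)\<in>edges P. dist a b \<ge> \<rho> * diameter (region P)))"


section \<open>Polynomials and projections\<close>

text \<open>The degree bound is an integer, so that \<open>polys (-1)\<close> contains only the zero polynomial.\<close>

definition polys :: "int \<Rightarrow> (pt \<Rightarrow> real) set" where
  "polys l = {p. \<exists>c::nat \<Rightarrow> nat \<Rightarrow> real. \<forall>x.
     p x = (\<Sum>(i, j)\<in>{(i, j). int i + int j \<le> l}. c i j * (x $ 1) ^ i * (x $ 2) ^ j)}"

definition polys_vec :: "int \<Rightarrow> (pt \<Rightarrow> pt) set" where
  "polys_vec l = {q. \<forall>i. (\<lambda>x. q x $ i) \<in> polys l}"

definition Pi0 :: "int \<Rightarrow> pt set \<Rightarrow> (pt \<Rightarrow> real) \<Rightarrow> pt \<Rightarrow> real" where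
  "Pi0 l S v = (SOME p. p \<in> polys l \<and>
     (\<forall>q\<in>polys l. (\<integral>x. (v x - p x) * q x \<partial>lebesgue_on S) = 0))"

definition Pi0_vec :: "int \<Rightarrow> pt set \<Rightarrow> (pt \<Rightarrow> pt) \<Rightarrow> pt \<Rightarrow> pt" where
  "Pi0_vec l S v x = (\<chi> i. Pi0 l S (\<lambda>y. v y $ i) x)"

definition Pi0_mat :: "int \<Rightarrow> pt set \<Rightarrow> (pt \<Rightarrow> real^2^2) \<Rightarrow> pt \<Rightarrow> real^2^2" where
  "Pi0_mat l S \<tau> x = (\<chi> i j. Pi0 l S (\<lambda>y. \<tau> y $ i $ j) x)"

definition Pi0_mesh :: "int \<Rightarrow> pt list set \<Rightarrow> (pt \<Rightarrow> pt) \<Rightarrow> pt \<Rightarrow> pt" where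
  "Pi0_mesh l M v x = (\<Sum>P\<in>M. indicator (region P) x *\<^sub>R Pi0_vec l (region P) v x)"

text \<open>The elliptic projection as a relation; the conditions determine \<open>p\<close> uniquely.\<close>

definition is_Pi_nabla :: "nat \<Rightarrow> pt list \<Rightarrow> (pt \<Rightarrow> real) \<Rightarrow> (pt \<Rightarrow> real) \<Rightarrow> bool" where
  "is_Pi_nabla k P v p \<longleftrightarrow> p \<in> polys (int k) \<and>
     (\<forall>q\<in>polys (int k).
        (\<integral>x. (grad p x - wgrad (region P) v x) \<bullet> grad q x \<partial>lebesgue_on (region P)) = 0) \<and>
     (if k = 1
      then \<exists>g. has_trace (edges P) (region P) v g \<and> line_integral (edges P) (\<lambda>x. p x - g x) = 0
      else (\<integral>x. p x - v x \<partial>lebesgue_on (region P)) = 0)"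


section \<open>Virtual element spaces\<close>

definition barycenter :: "pt set \<Rightarrow> pt" where
  "barycenter S = (1 / measure lebesgue S) *\<^sub>R (\<integral>x. x \<partial>lebesgue_on S)"

definition scaled_monomial :: "pt set \<Rightarrow> nat \<Rightarrow> nat \<Rightarrow> pt \<Rightarrow> real" where
  "scaled_monomial S i j x =
     ((x $ 1 - barycenter S $ 1) / diameter S) ^ i * ((x $ 2 - barycenter S $ 2) / diameter S) ^ j"

definition VEM_local :: "nat \<Rightarrow> pt list \<Rightarrow> (pt \<Rightarrow> real) set" where
  "VEM_local k P = {v \<in> H1 (region P).
     (\<exists>g. has_trace (edges P) (region P) v g \<and> continuous_on (polygon_boundary P) g \<and>
        (\<forall>(a, b)\<in>edges P. \<exists>q\<in>polys (int k). \<forall>x\<in>closed_segment a b. g x = q x)) \<and>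
     (\<exists>q\<in>polys (int k). has_weak_laplacian (region P) v q) \<and>
     (\<exists>p. is_Pi_nabla k P v p \<and>
        (\<forall>i j. i + j \<in> {k - 1, k} \<longrightarrow>
           (\<integral>x. (v x - p x) * scaled_monomial (region P) i j x \<partial>lebesgue_on (region P)) = 0))}"

definition VEM_local_vec :: "nat \<Rightarrow> pt list \<Rightarrow> (pt \<Rightarrow> pt) set" where
  "VEM_local_vec k P = {v. \<forall>i. (\<lambda>x. v x $ i) \<in> VEM_local k P}"

definition VEM ::
  "pt set \<Rightarrow> pt list set \<Rightarrow> pt set \<Rightarrow> nat \<Rightarrow> pt list set \<Rightarrow> (pt \<Rightarrow> pt) set" where
  "VEM \<Omega> B \<Gamma>D k M = {v \<in> V_space \<Omega> B \<Gamma>D. \<forall>P\<in>M. v \<in> VEM_local_vec k P}"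

text \<open>\<open>v\<close> is a virtual element function (its boundary values are those of its continuous trace),
  \<open>w\<close> is continuous up to the boundary.\<close>

definition same_dofs :: "nat \<Rightarrow> pt list \<Rightarrow> (pt \<Rightarrow> real) \<Rightarrow> (pt \<Rightarrow> real) \<Rightarrow> bool" where
  "same_dofs k P v w \<longleftrightarrow>
     (\<exists>g. has_trace (edges P) (region P) v g \<and> continuous_on (polygon_boundary P) g \<and>
        (\<forall>a\<in>set P. g a = w a) \<and>
        (\<forall>e\<in>edges P. \<forall>q\<in>polys (int k - 2).
           line_integral {e} (\<lambda>x. g x * q x) = line_integral {e} (\<lambda>x. w x * q x))) \<and>
     (\<forall>q\<in>polys (int k - 2).
        (\<integral>x. v x * q x \<partial>lebesgue_on (region P)) = (\<integral>x. w x * q x \<partial>lebesgue_on (region P)))"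

definition is_interpolant ::
  "pt set \<Rightarrow> pt list set \<Rightarrow> pt set \<Rightarrow> nat \<Rightarrow> pt list set \<Rightarrow> (pt \<Rightarrow> pt) \<Rightarrow> (pt \<Rightarrow> pt) \<Rightarrow> bool" where
  "is_interpolant \<Omega> B \<Gamma>D k M w wI \<longleftrightarrow>
     continuous_on (closure \<Omega>) w \<and> wI \<in> VEM \<Omega> B \<Gamma>D k M \<and>
     (\<forall>P\<in>M. \<forall>i. same_dofs k P (\<lambda>x. wI x $ i) (\<lambda>x. w x $ i))"


section \<open>Discrete forms\<close>

type_synonym stab = "pt list \<Rightarrow> (pt \<Rightarrow> pt) \<Rightarrow> (pt \<Rightarrow> pt) \<Rightarrow> real"

definition symmetric_bilinear_on ::
  "(pt \<Rightarrow> pt) set \<Rightarrow> ((pt \<Rightarrow> pt) \<Rightarrow> (pt \<Rightarrow> pt) \<Rightarrow> real) \<Rightarrow> bool" where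
  "symmetric_bilinear_on W S \<longleftrightarrow>
     (\<forall>v\<in>W. \<forall>w\<in>W. S v w = S w v) \<and>
     (\<forall>v\<in>W. \<forall>w\<in>W. \<forall>z\<in>W. S (\<lambda>x. v x + w x) z = S v z + S w z) \<and>
     (\<forall>c. \<forall>v\<in>W. \<forall>z\<in>W. S (\<lambda>x. c *\<^sub>R v x) z = c * S v z)"

definition mh_local :: "nat \<Rightarrow> stab \<Rightarrow> stab" where
  "mh_local k Sm P v w =
     (\<integral>x. Pi0_vec (int k) (region P) v x \<bullet> Pi0_vec (int k) (region P) w x \<partial>lebesgue_on (region P))
     + Sm P v w"

definition ah_local :: "(pt \<Rightarrow> real) \<Rightarrow> (pt \<Rightarrow> real) \<Rightarrow> nat \<Rightarrow> stab \<Rightarrow> stab" where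
  "ah_local lam mu k Sa P v w =
     (\<integral>x. hooke lam mu x (Pi0_mat (int k - 1) (region P) (strain (region P) v) x)
           \<bullet> Pi0_mat (int k - 1) (region P) (strain (region P) w) x \<partial>lebesgue_on (region P))
     + Sa P v w"

definition mh :: "nat \<Rightarrow> stab \<Rightarrow> pt list set \<Rightarrow> (pt \<Rightarrow> pt) \<Rightarrow> (pt \<Rightarrow> pt) \<Rightarrow> real" where
  "mh k Sm M v w = (\<Sum>P\<in>M. mh_local k Sm P v w)"

definition ah ::
  "(pt \<Rightarrow> real) \<Rightarrow> (pt \<Rightarrow> real) \<Rightarrow> nat \<Rightarrow> stab \<Rightarrow> pt list set \<Rightarrow> (pt \<Rightarrow> pt) \<Rightarrow> (pt \<Rightarrow> pt) \<Rightarrow> real" where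
  "ah lam mu k Sa M v w = (\<Sum>P\<in>M. ah_local lam mu k Sa P v w)"

definition consistent_on :: "nat \<Rightarrow> pt list \<Rightarrow> ((pt \<Rightarrow> pt) \<Rightarrow> (pt \<Rightarrow> pt) \<Rightarrow> real) \<Rightarrow>
  ((pt \<Rightarrow> pt) \<Rightarrow> (pt \<Rightarrow> pt) \<Rightarrow> real) \<Rightarrow> bool" where
  "consistent_on k P bh b \<longleftrightarrow>
     (\<forall>v\<in>VEM_local_vec k P. \<forall>q\<in>polys_vec (int k). bh v q = b v q)"

definition stable_on :: "nat \<Rightarrow> pt list \<Rightarrow> real \<Rightarrow> real \<Rightarrow> ((pt \<Rightarrow> pt) \<Rightarrow> (pt \<Rightarrow> pt) \<Rightarrow> real) \<Rightarrow>
  ((pt \<Rightarrow> pt) \<Rightarrow> (pt \<Rightarrow> pt) \<Rightarrow> real) \<Rightarrow> bool" where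
  "stable_on k P lo up bh b \<longleftrightarrow>
     (\<forall>v\<in>VEM_local_vec k P. lo * b v v \<le> bh v v \<and> bh v v \<le> up * b v v)"

definition admissible_Sm :: "nat \<Rightarrow> real \<Rightarrow> real \<Rightarrow> pt list set \<Rightarrow> stab \<Rightarrow> bool" where
  "admissible_Sm k lo up M Sm \<longleftrightarrow> (\<forall>P\<in>M.
     symmetric_bilinear_on (VEM_local_vec k P) (Sm P) \<and>
     consistent_on k P (mh_local k Sm P) (m_form (region P)) \<and>
     stable_on k P lo up (mh_local k Sm P) (m_form (region P)))"

definition admissible_Sa ::
  "(pt \<Rightarrow> real) \<Rightarrow> (pt \<Rightarrow> real) \<Rightarrow> nat \<Rightarrow> real \<Rightarrow> real \<Rightarrow> pt list set \<Rightarrow> stab \<Rightarrow> bool" where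
  "admissible_Sa lam mu k lo up M Sa \<longleftrightarrow> (\<forall>P\<in>M.
     symmetric_bilinear_on (VEM_local_vec k P) (Sa P) \<and>
     consistent_on k P (ah_local lam mu k Sa P) (a_form lam mu (region P)) \<and>
     stable_on k P lo up (ah_local lam mu k Sa P) (a_form lam mu (region P)))"

definition Fh :: "pt set \<Rightarrow> nat \<Rightarrow> pt list set \<Rightarrow> (pt \<Rightarrow> pt) \<Rightarrow> (pt \<Rightarrow> pt) \<Rightarrow> real" where
  "Fh \<Omega> k M ft v = (\<integral>x. ft x \<bullet> Pi0_mesh (int k - 2) M v x \<partial>lebesgue_on \<Omega>)"


section \<open>Time-dependent fields\<close>

text \<open>The load is required to be in $L^2$ in space at every time, not just almost every time,
  because it is evaluated at every time in the semi-discrete equation.\<close>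

definition simple_L2_valued :: "pt set \<Rightarrow> real \<Rightarrow> (real \<Rightarrow> pt \<Rightarrow> pt) \<Rightarrow> bool" where
  "simple_L2_valued \<Omega> T s \<longleftrightarrow> finite (s ` {0<..T}) \<and>
     (\<forall>t\<in>{0<..T}. L2 \<Omega> (s t) \<and> {\<tau>\<in>{0<..T}. s \<tau> = s t} \<in> sets lebesgue)"

definition bochner_L2 :: "pt set \<Rightarrow> real \<Rightarrow> (real \<Rightarrow> pt \<Rightarrow> pt) \<Rightarrow> bool" where
  "bochner_L2 \<Omega> T f \<longleftrightarrow>
     (\<forall>t\<in>{0<..T}. L2 \<Omega> (f t)) \<and>
     (\<exists>s::nat \<Rightarrow> real \<Rightarrow> pt \<Rightarrow> pt. (\<forall>n. simple_L2_valued \<Omega> T (s n)) \<and>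
        (AE t in lebesgue_on {0<..T}. (\<lambda>n. L2_norm \<Omega> (\<lambda>x. s n t x - f t x)) \<longlonglongrightarrow> 0)) \<and>
     integrable (lebesgue_on {0<..T}) (\<lambda>t. (L2_norm \<Omega> (f t))\<^sup>2)"

text \<open>Continuity and differentiability in time are understood in the $H^1(\Omega)$ norm; on the
  finite-dimensional virtual element space the choice of the norm is immaterial.\<close>

definition H1_continuous_on :: "pt set \<Rightarrow> real set \<Rightarrow> (real \<Rightarrow> pt \<Rightarrow> pt) \<Rightarrow> bool" where
  "H1_continuous_on \<Omega> I u \<longleftrightarrow>
     (\<forall>t\<in>I. ((\<lambda>s. H1_norm \<Omega> (\<lambda>x. u s x - u t x)) \<longlongrightarrow> 0) (at t within I))"

definition H1_deriv_on :: "pt set \<Rightarrow> real set \<Rightarrow> (real \<Rightarrow> pt \<Rightarrow> pt) \<Rightarrow> (real \<Rightarrow> pt \<Rightarrow> pt) \<Rightarrow> bool" where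
  "H1_deriv_on \<Omega> I u u' \<longleftrightarrow>
     (\<forall>t\<in>I. ((\<lambda>s. H1_norm \<Omega> (\<lambda>x. (1 / (s - t)) *\<^sub>R (u s x - u t x) - u' t x)) \<longlongrightarrow> 0)
              (at t within I))"

text \<open>\<open>u\<close> is twice continuously differentiable on $(0,T]$ with values in \<open>W\<close>, with derivatives
  \<open>u'\<close> and \<open>u''\<close>, and continuously differentiable up to \<open>t = 0\<close>, which gives a meaning to the
  initial conditions.\<close>

definition C2_curve :: "pt set \<Rightarrow> (pt \<Rightarrow> pt) set \<Rightarrow> real \<Rightarrow>
  (real \<Rightarrow> pt \<Rightarrow> pt) \<Rightarrow> (real \<Rightarrow> pt \<Rightarrow> pt) \<Rightarrow> (real \<Rightarrow> pt \<Rightarrow> pt) \<Rightarrow> bool" where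
  "C2_curve \<Omega> W T u u' u'' \<longleftrightarrow>
     (\<forall>t\<in>{0..T}. u t \<in> W \<and> u' t \<in> W) \<and> (\<forall>t\<in>{0<..T}. u'' t \<in> W) \<and>
     H1_deriv_on \<Omega> {0..T} u u' \<and> H1_continuous_on \<Omega> {0..T} u' \<and>
     H1_deriv_on \<Omega> {0<..T} u' u'' \<and> H1_continuous_on \<Omega> {0<..T} u''"

definition energy_norm :: "pt set \<Rightarrow> (pt \<Rightarrow> pt) \<Rightarrow> (pt \<Rightarrow> pt) \<Rightarrow> real" where
  "energy_norm \<Omega> v v_dot = sqrt ((L2_norm \<Omega> v_dot)\<^sup>2 + (H1_seminorm \<Omega> v)\<^sup>2)"

definition semidiscrete_solution :: "pt set \<Rightarrow> pt list set \<Rightarrow> pt set \<Rightarrow>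
  (pt \<Rightarrow> real) \<Rightarrow> (pt \<Rightarrow> real) \<Rightarrow> nat \<Rightarrow> pt list set \<Rightarrow> stab \<Rightarrow> stab \<Rightarrow> real \<Rightarrow>
  (real \<Rightarrow> pt \<Rightarrow> pt) \<Rightarrow> (pt \<Rightarrow> pt) \<Rightarrow> (pt \<Rightarrow> pt) \<Rightarrow>
  (real \<Rightarrow> pt \<Rightarrow> pt) \<Rightarrow> (real \<Rightarrow> pt \<Rightarrow> pt) \<Rightarrow> (real \<Rightarrow> pt \<Rightarrow> pt) \<Rightarrow> bool" where
  "semidiscrete_solution \<Omega> B \<Gamma>D lam mu k M Sm Sa T f u0I u1I u u' u'' \<longleftrightarrow>
     C2_curve \<Omega> (VEM \<Omega> B \<Gamma>D k M) T u u' u'' \<and>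
     (\<forall>t\<in>{0<..T}. \<forall>v\<in>VEM \<Omega> B \<Gamma>D k M.
        mh k Sm M (u'' t) v + ah lam mu k Sa M (u t) v = Fh \<Omega> k M (f t) v) \<and>
     (AE x in lebesgue_on \<Omega>. u 0 x = u0I x) \<and>
     (AE x in lebesgue_on \<Omega>. u' 0 x = u1I x)"

end

theory Submission
  imports Defs
begin

text \<open>The discrete energy $E(t) = m_h(\dot u_h, \dot u_h) + a_h(u_h, u_h)$ satisfies
  $E' = 2 F_h(\dot u_h)$ (test with $\dot u_h$). Stability of the discrete forms and coercivity of $a$
  make $E$ equivalent to the squared energy norm, uniformly in the mesh, and $\Pi^0_{k-2}$ is an
  $L^2$ contraction, so $(\sqrt E)' \le \|f\|_0 / \sqrt{\mu_*}$; integrate. No inverse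
  inequality or finite-dimensional argument is needed: stability and Cauchy--Schwarz for $m_h$ and
  $a_h$ give continuity of both forms in the $H^1$ norm, hence $E$ is differentiable.

  Since \<^const>\<open>wgrad\<close> is a choice, linearity of every space and form rests on uniqueness of weak
  gradients, that is, on the fundamental lemma of the calculus of variations.\<close>

text \<open>The discrete forms are sums over elements, whereas the energy norm and the coercivity of
  \<open>a\<close> live on \<open>\<Omega>\<close>. Comparing them needs two localisations: the mesh
  skeleton is a null set, and the gradient chosen on \<open>\<Omega>\<close> agrees almost
  everywhere on each element with the one chosen there. \<open>Pi0\<close> is a choice as well; a
  Gram-Schmidt step shows that there is something to choose. Linearity is then known only almost
  everywhere and is used under integrals. Differentiating \<open>E\<close> requires that difference
  quotients of the solution stay in the virtual element space, so every clause of its definition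
  (trace, Laplacian, elliptic projection) is shown to be linear. The equation holds on (0, T] only:
  the estimate is integrated from s > 0, and s tends to 0 by continuity of \<open>E\<close>. The
  constant has three sources: \<open>min \<mu>_lo (\<alpha>_lo * c0)\<close> bounds \<open>E\<close>
  from below, \<open>max \<mu>_up (\<alpha>_up * K)\<close> from above, with K an essential bound of
  the Hooke tensor, and 1 / sqrt \<open>\<mu>_lo\<close> comes from the load. All are fixed before
  mesh, stabilisations, T and data.\<close>

lemma discriminant_bound:
  fixes A B D :: real
  assumes "\<And>t. A + 2 * t * B + t\<^sup>2 * D \<ge> 0"
  shows "B\<^sup>2 \<le> A * D"
proof (cases "D = 0")
  \<comment> \<open>The forms to which this is applied are a priori only semidefinite, so a
    vanishing leading coefficient is a genuine case.\<close>
  case True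
  have "B = 0"
  proof (rule ccontr)
    assume "B \<noteq> 0"
    \<comment> \<open>At this point the affine function takes the value -1.\<close>
    then show False using assms[of "- (A + 1) / (2 * B)"] True by (simp add: field_simps)
  qed
  then show ?thesis using True by simp
next
  case False
  have "D > 0"
  proof (rule ccontr)
    assume "\<not> D > 0"
    then have "D < 0" using False by simp
    \<comment> \<open>The quotient makes \<open>t * D\<close> outweigh both \<open>2 * B\<close> and
      \<open>A\<close>; the extra 1 gives t \<ge> 1, so that multiplying a negative bracket by t can
      only lower it.\<close>
    define t where "t = (\<bar>A\<bar> + 2 * \<bar>B\<bar> + 1) / (- D) + 1"
    have t: "t \<ge> 1" using \<open>D < 0\<close> by (simp add: t_def zero_le_divide_iff field_simps)
    have tD: "t * D = - (\<bar>A\<bar> + 2 * \<bar>B\<bar> + 1) + D" using \<open>D < 0\<close> by (simp add: t_def field_simps)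
    have "A + 2 * t * B + t\<^sup>2 * D = A + t * (2 * B + t * D)" by (simp add: power2_eq_square algebra_simps)
    also have "\<dots> \<le> A + t * (- \<bar>A\<bar> - 1 + D)"
      using t tD by (intro add_left_mono mult_left_mono) auto
    also have "\<dots> \<le> A + 1 * (- \<bar>A\<bar> - 1 + D)"
      using t \<open>D < 0\<close> by (intro add_left_mono mult_right_mono_neg) auto
    also have "\<dots> < 0" using \<open>D < 0\<close> by auto
    finally show False using assms[of t] by simp
  qed
  \<comment> \<open>\<open>- B / D\<close> is the minimiser of the quadratic.\<close>
  have "A + 2 * (- B / D) * B + (- B / D)\<^sup>2 * D = (A * D - B\<^sup>2) / D"
    using False by (simp add: field_simps power2_eq_square)
  then have "(A * D - B\<^sup>2) / D \<ge> 0" using assms[of "- B / D"] by simp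
  then show ?thesis using \<open>D > 0\<close> by (simp add: zero_le_divide_iff)
qed

text \<open>Write c w as w + (c - 1) w. Sums, differences and multiples are all treated through the
  single operation v + c w, so that each space needs one closure proof only.\<close>

lemma lincomb_closed_scale:
  assumes "\<And>v w c. v \<in> W \<Longrightarrow> w \<in> W \<Longrightarrow> (\<lambda>x. v x + c *\<^sub>R w x) \<in> W" "w \<in> W"
  shows "(\<lambda>x. c *\<^sub>R (w x :: 'b::real_vector)) \<in> W"
  using assms(1)[OF assms(2) assms(2), of "c - 1"] by (simp add: algebra_simps)

section \<open>Square-integrable functions\<close>

lemma L2_measurable [measurable_dest]: "L2 S v \<Longrightarrow> v \<in> borel_measurable (lebesgue_on S)"
  by (simp add: L2_def)

lemma L2_inner_integrable:
  assumes "L2 S v" "L2 S w"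
  shows "integrable (lebesgue_on S) (\<lambda>x. v x \<bullet> w x)"
proof (rule Bochner_Integration.integrable_bound)
  show "integrable (lebesgue_on S) (\<lambda>x. (norm (v x))\<^sup>2 + (norm (w x))\<^sup>2)"
    using assms by (simp add: L2_def)
  show "(\<lambda>x. v x \<bullet> w x) \<in> borel_measurable (lebesgue_on S)"
    using assms by (auto dest!: L2_measurable)
  show "AE x in lebesgue_on S. norm (v x \<bullet> w x) \<le> norm ((norm (v x))\<^sup>2 + (norm (w x))\<^sup>2)"
  proof (rule AE_I2)
    fix x
    have "\<bar>v x \<bullet> w x\<bar> \<le> norm (v x) * norm (w x)" by (rule Cauchy_Schwarz_ineq2)
    moreover have "2 * (norm (v x) * norm (w x)) \<le> (norm (v x))\<^sup>2 + (norm (w x))\<^sup>2"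
      using sum_squares_bound[of "norm (v x)" "norm (w x)"] by simp
    ultimately show "norm (v x \<bullet> w x) \<le> norm ((norm (v x))\<^sup>2 + (norm (w x))\<^sup>2)"
      by (smt (verit) real_norm_def zero_le_power2 mult_nonneg_nonneg norm_ge_zero)
  qed
qed

lemma L2_mult_integrable:
  fixes v w :: "'a::euclidean_space \<Rightarrow> real"
  shows "L2 S v \<Longrightarrow> L2 S w \<Longrightarrow> integrable (lebesgue_on S) (\<lambda>x. v x * w x)"
  using L2_inner_integrable[of S v w] by simp

lemma norm_lincomb_sq:
  fixes a b :: "'b::real_inner"
  shows "(norm (a + c *\<^sub>R b))\<^sup>2 = (norm a)\<^sup>2 + 2 * c * (a \<bullet> b) + c\<^sup>2 * (norm b)\<^sup>2"
  unfolding power2_norm_eq_inner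
  by (simp add: inner_add_left inner_add_right inner_commute power2_eq_square algebra_simps)

lemma L2_lincomb:
  assumes "L2 S v" "L2 S w"
  shows "L2 S (\<lambda>x. v x + c *\<^sub>R w x)"
proof -
  have "(\<lambda>x. v x + c *\<^sub>R w x) \<in> borel_measurable (lebesgue_on S)"
    using assms by (auto dest!: L2_measurable)
  moreover have "integrable (lebesgue_on S) (\<lambda>x. (norm (v x + c *\<^sub>R w x))\<^sup>2)"
    unfolding norm_lincomb_sq using L2_inner_integrable[OF assms] assms
    by (auto simp: L2_def)
  ultimately show ?thesis by (simp add: L2_def)
qed

lemma L2_lincomb_real:
  fixes v w :: "'a::euclidean_space \<Rightarrow> real"
  shows "L2 S v \<Longrightarrow> L2 S w \<Longrightarrow> L2 S (\<lambda>x. v x + c * w x)"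
  using L2_lincomb[of S v w c] by simp

lemma L2_diff:
  assumes "L2 S v" "L2 S w"
  shows "L2 S (\<lambda>x. v x - w x)"
  using L2_lincomb[OF assms, of "-1"] by simp

lemma L2_zero: "L2 S (\<lambda>x. 0)"
  by (simp add: L2_def)

lemma L2_norm_nonneg [simp]: "L2_norm S v \<ge> 0"
  by (simp add: L2_norm_def)

lemma L2_norm_sq: "(L2_norm S v)\<^sup>2 = (\<integral>x. (norm (v x))\<^sup>2 \<partial>lebesgue_on S)"
  by (simp add: L2_norm_def)

lemma L2_norm_lincomb_sq:
  assumes "L2 S v" "L2 S w"
  shows "(L2_norm S (\<lambda>x. v x + c *\<^sub>R w x))\<^sup>2
    = (L2_norm S v)\<^sup>2 + 2 * c * (\<integral>x. v x \<bullet> w x \<partial>lebesgue_on S) + c\<^sup>2 * (L2_norm S w)\<^sup>2"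
  unfolding L2_norm_sq norm_lincomb_sq
  using L2_inner_integrable[OF assms] assms by (simp add: L2_def)

lemma L2_Cauchy_Schwarz:
  assumes "L2 S v" "L2 S w"
  shows "\<bar>\<integral>x. v x \<bullet> w x \<partial>lebesgue_on S\<bar> \<le> L2_norm S v * L2_norm S w"
proof -
  have "(\<integral>x. v x \<bullet> w x \<partial>lebesgue_on S)\<^sup>2 \<le> (L2_norm S v)\<^sup>2 * (L2_norm S w)\<^sup>2"
  proof (rule discriminant_bound)
    fix t
    show "(L2_norm S v)\<^sup>2 + 2 * t * (\<integral>x. v x \<bullet> w x \<partial>lebesgue_on S) + t\<^sup>2 * (L2_norm S w)\<^sup>2 \<ge> 0"
      unfolding L2_norm_lincomb_sq[OF assms, symmetric] by simp
  qed
  then show ?thesis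
    unfolding power_mult_distrib[symmetric] abs_le_square_iff[symmetric] by simp
qed

lemma L2_norm_lincomb:
  assumes "L2 S v" "L2 S w"
  shows "L2_norm S (\<lambda>x. v x + c *\<^sub>R w x) \<le> L2_norm S v + \<bar>c\<bar> * L2_norm S w"
proof (rule power2_le_imp_le)
  have "c * (\<integral>x. v x \<bullet> w x \<partial>lebesgue_on S) \<le> \<bar>c\<bar> * (L2_norm S v * L2_norm S w)"
    using mult_left_mono[OF L2_Cauchy_Schwarz[OF assms] abs_ge_zero, of c]
    by (simp add: abs_mult[symmetric])
  then show "(L2_norm S (\<lambda>x. v x + c *\<^sub>R w x))\<^sup>2 \<le> (L2_norm S v + \<bar>c\<bar> * L2_norm S w)\<^sup>2"
    unfolding L2_norm_lincomb_sq[OF assms]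
    by (simp add: power2_sum power_mult_distrib mult.left_commute[of "L2_norm S v"])
qed simp

lemma L2_norm_cong_AE:
  assumes "L2 S v" "L2 S w" "AE x in lebesgue_on S. v x = w x"
  shows "L2_norm S v = L2_norm S w"
proof -
  have "(\<integral>x. (norm (v x))\<^sup>2 \<partial>lebesgue_on S) = (\<integral>x. (norm (w x))\<^sup>2 \<partial>lebesgue_on S)"
    using assms by (intro integral_cong_AE) (auto dest!: L2_measurable)
  then show ?thesis by (simp add: L2_norm_def)
qed

lemma L2_inner_cong_AE:
  assumes "L2 S v" "L2 S v'" "L2 S w" "L2 S w'"
    and "AE x in lebesgue_on S. v x = v' x" "AE x in lebesgue_on S. w x = w' x"
  shows "(\<integral>x. v x \<bullet> w x \<partial>lebesgue_on S) = (\<integral>x. v' x \<bullet> w' x \<partial>lebesgue_on S)"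
  using assms by (intro integral_cong_AE) (auto dest!: L2_measurable)

lemma L2_subset:
  assumes "L2 S v" "T \<subseteq> S" "S \<in> sets lebesgue" "T \<in> sets lebesgue"
  shows "L2 T v"
proof -
  have "v \<in> borel_measurable (lebesgue_on T)"
    using assms by (auto simp: L2_def intro: measurable_restrict_mono)
  moreover have "integrable (lebesgue_on T) (\<lambda>x. (norm (v x))\<^sup>2)"
  proof -
    have "integrable lebesgue (\<lambda>x. indicator S x *\<^sub>R (norm (v x))\<^sup>2)"
      using assms by (simp add: L2_def integrable_restrict_space)
    then have "integrable lebesgue (\<lambda>x. indicator T x *\<^sub>R (indicator S x *\<^sub>R (norm (v x))\<^sup>2))"
      by (rule integrable_mult_indicator[OF assms(4)])
    also have "(\<lambda>x. indicator T x *\<^sub>R (indicator S x *\<^sub>R (norm (v x))\<^sup>2)) = (\<lambda>x. indicator T x *\<^sub>R (norm (v x))\<^sup>2)"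
      using assms(2) by (auto simp: indicator_def fun_eq_iff)
    finally show ?thesis using assms by (simp add: integrable_restrict_space)
  qed
  ultimately show ?thesis by (simp add: L2_def)
qed

lemma AE_lebesgue_on_subset:
  assumes "AE x in lebesgue_on S. Q x" "T \<subseteq> S" "S \<in> sets lebesgue" "T \<in> sets lebesgue"
  shows "AE x in lebesgue_on T. Q x"
proof -
  have "AE x in lebesgue. x \<in> S \<longrightarrow> Q x" using assms by (simp add: AE_restrict_space_iff)
  then have "AE x in lebesgue. x \<in> T \<longrightarrow> Q x" using assms(2) by (elim AE_mp) auto
  then show ?thesis using assms by (simp add: AE_restrict_space_iff)
qed

lemma continuous_integrable_bounded:
  fixes v :: "'a::euclidean_space \<Rightarrow> 'b::euclidean_space"
  assumes "continuous_on UNIV v" "bounded S" "S \<in> sets lebesgue"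
  shows "integrable (lebesgue_on S) v"
proof -
  have "compact (v ` closure S)"
    using assms by (intro compact_continuous_image continuous_on_subset[OF assms(1)]) (auto simp: compact_closure)
  then obtain K where K: "\<And>x. x \<in> closure S \<Longrightarrow> norm (v x) \<le> K"
    by (metis compact_imp_bounded bounded_iff imageI)
  have fin: "S \<in> lmeasurable" using assms by (simp add: bounded_set_imp_lmeasurable)
  interpret finite_measure "lebesgue_on S" using fin by (rule finite_measure_lebesgue_on)
  have "v \<in> borel_measurable (lebesgue_on S)"
    using assms by (intro continuous_imp_measurable_on_sets_lebesgue continuous_on_subset[OF assms(1)]) auto
  moreover have "AE x in lebesgue_on S. norm (v x) \<le> K"
    using K closure_subset[of S] by (intro AE_I2) auto
  ultimately show ?thesis by (intro integrable_const_bound[where B=K]) auto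
qed

lemma continuous_L2_bounded:
  fixes v :: "'a::euclidean_space \<Rightarrow> 'b::euclidean_space"
  assumes "continuous_on UNIV v" "bounded S" "S \<in> sets lebesgue"
  shows "L2 S v"
  unfolding L2_def
  by (intro conjI borel_measurable_integrable continuous_integrable_bounded assms continuous_intros)

lemma L2_vec_nth:
  assumes "L2 S (v :: 'a::euclidean_space \<Rightarrow> 'b::euclidean_space ^ 'n)"
  shows "L2 S (\<lambda>x. v x $ i)"
  unfolding L2_def
proof
  show m: "(\<lambda>x. v x $ i) \<in> borel_measurable (lebesgue_on S)"
    using assms by (intro borel_measurable_continuous_on[of "\<lambda>y. y $ i"] continuous_intros) (auto simp: L2_def)
  show "integrable (lebesgue_on S) (\<lambda>x. (norm (v x $ i))\<^sup>2)"
  proof (rule Bochner_Integration.integrable_bound)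
    show "integrable (lebesgue_on S) (\<lambda>x. (norm (v x))\<^sup>2)" using assms by (simp add: L2_def)
    show "AE x in lebesgue_on S. norm ((norm (v x $ i))\<^sup>2) \<le> norm ((norm (v x))\<^sup>2)"
      by (intro AE_I2) (simp add: power_mono component_le_norm_cart Finite_Cartesian_Product.norm_nth_le)
  qed (use m in measurable)
qed

lemma norm_vec_sq: "(norm (v :: 'b::real_normed_vector ^ 'n))\<^sup>2 = (\<Sum>i\<in>UNIV. (norm (v $ i))\<^sup>2)"
  by (simp add: norm_vec_def L2_set_def sum_nonneg)

lemma L2_vecI:
  assumes "\<And>i. L2 S (\<lambda>x. v x $ i)"
  shows "L2 S (v :: 'a::euclidean_space \<Rightarrow> 'b::euclidean_space ^ 'n)"
  unfolding L2_def
proof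
  show "v \<in> borel_measurable (lebesgue_on S)"
  proof (rule borel_measurable_euclidean_space[THEN iffD2], rule ballI)
    fix b :: "'b ^ 'n" assume "b \<in> Basis"
    have "(\<lambda>x. v x \<bullet> b) = (\<lambda>x. \<Sum>i\<in>UNIV. v x $ i \<bullet> b $ i)" by (simp add: inner_vec_def)
    then show "(\<lambda>x. v x \<bullet> b) \<in> borel_measurable (lebesgue_on S)"
      using assms by (auto dest!: L2_measurable intro!: borel_measurable_sum borel_measurable_inner)
  qed
  show "integrable (lebesgue_on S) (\<lambda>x. (norm (v x))\<^sup>2)"
    using assms by (simp add: norm_vec_sq L2_def)
qed

section \<open>Smooth functions and the fundamental lemma of the calculus of variations\<close>

text \<open>The flat function exp(-1/x) divided by powers of x. Indexing by the power makes the
  family closed under differentiation up to linear combinations, so smoothness needs no formula for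
  higher derivatives.\<close>

definition exp_recip :: "nat \<Rightarrow> real \<Rightarrow> real" where
  "exp_recip n x = (if x > 0 then exp (- 1 / x) / x ^ n else 0)"

text \<open>With y = 1/x this is the decay of y^n / exp y at infinity.\<close>

lemma exp_recip_at_right_0: "(exp_recip n \<longlongrightarrow> 0) (at_right 0)"
proof -
  have "((\<lambda>x::real. (inverse x) ^ n / exp (inverse x)) \<longlongrightarrow> 0) (at_right 0)"
    by (rule filterlim_compose[OF tendsto_power_div_exp_0 filterlim_inverse_at_top_right])
  moreover have "eventually (\<lambda>x. (inverse x) ^ n / exp (inverse x) = exp_recip n x) (at_right 0)"
    by (rule eventually_mono[OF eventually_at_right_less])
       (auto simp: exp_recip_def exp_minus field_simps)
  ultimately show ?thesis by (rule Lim_transform_eventually)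
qed

text \<open>Away from 0 this is the product rule. At 0 the right difference quotient of
  \<open>exp_recip n\<close> is \<open>exp_recip (Suc n)\<close>, whose limit is known, and the left
  one vanishes.\<close>

lemma exp_recip_has_derivative:
  "(exp_recip n has_field_derivative exp_recip (n + 2) x - real n * exp_recip (n + 1) x) (at x)"
proof -
  consider "x > 0" | "x < 0" | "x = 0" by linarith
  then show ?thesis
  proof cases
    case 1
    have "((\<lambda>x. exp (- 1 / x) * (inverse x) ^ n) has_field_derivative
        exp_recip (n + 2) x - real n * exp_recip (n + 1) x) (at x)"
    proof -
      have p: "((\<lambda>x. (inverse x) ^ n) has_field_derivative - (real n * inverse x ^ (n + 1))) (at x)"
        by (rule DERIV_cong[OF DERIV_power[OF DERIV_inverse]], use 1 in simp, cases n) (simp_all add: mult_ac)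
      have e: "((\<lambda>x. exp (- 1 / x)) has_field_derivative exp (- 1 / x) * inverse x ^ 2) (at x)"
        using 1 by (auto intro!: derivative_eq_intros simp: field_simps power2_eq_square)
      have "exp (- 1 / x) * - (real n * inverse x ^ (n + 1)) + exp (- 1 / x) * inverse x ^ 2 * inverse x ^ n
          = exp_recip (n + 2) x - real n * exp_recip (n + 1) x"
        using 1 by (simp add: exp_recip_def power_inverse divide_inverse power_add power2_eq_square algebra_simps)
      then show ?thesis using DERIV_mult'[OF e p] by simp
    qed
    then show ?thesis
      by (rule has_field_derivative_transform_within_open[where S="{0<..}"])
         (use 1 in \<open>auto simp: exp_recip_def field_simps power_inverse\<close>)
  next
    case 2
    have "((\<lambda>x. 0) has_field_derivative 0) (at x)" by simp
    then have "(exp_recip n has_field_derivative 0) (at x)"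
      by (rule has_field_derivative_transform_within_open[where S="{..<0}"])
         (use 2 in \<open>auto simp: exp_recip_def\<close>)
    then show ?thesis using 2 by (simp add: exp_recip_def)
  next
    case 3
    have "((\<lambda>h. (exp_recip n (0 + h) - exp_recip n 0) / h) \<longlongrightarrow> 0) (at 0)"
    proof (rule filterlim_split_at)
      show "((\<lambda>h. (exp_recip n (0 + h) - exp_recip n 0) / h) \<longlongrightarrow> 0) (at_right 0)"
        by (rule Lim_transform_eventually[OF exp_recip_at_right_0[of "Suc n"]],
            rule eventually_mono[OF eventually_at_right_less])
           (auto simp: exp_recip_def)
      show "((\<lambda>h. (exp_recip n (0 + h) - exp_recip n 0) / h) \<longlongrightarrow> 0) (at_left 0)"
        by (rule Lim_transform_eventually[OF tendsto_const],
            rule eventually_mono[OF eventually_at_left_real[of "-1"]])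
           (auto simp: exp_recip_def)
    qed
    then have "(exp_recip n has_field_derivative 0) (at 0)" by (simp add: DERIV_def)
    then show ?thesis using 3 by (simp add: exp_recip_def)
  qed
qed

section \<open>Smooth functions as an algebra\<close>

lemma pderiv_atI: "(\<phi> has_derivative D) (at x) \<Longrightarrow> pderiv_at i \<phi> x = D (axis i 1)"
  by (metis frechet_derivative_at pderiv_at_def)

lemma C_infinity_differentiable: "\<phi> \<in> C_infinity \<Longrightarrow> \<phi> differentiable (at x)"
  by (auto simp: C_infinity_def dest!: spec[of _ "Suc 0"])

lemma C_infinity_pderiv: "\<phi> \<in> C_infinity \<Longrightarrow> pderiv_at i \<phi> \<in> C_infinity"
  unfolding C_infinity_def mem_Collect_eq by (rule allI, drule_tac x="Suc n" in spec) simp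

lemma C_infinity_continuous: "\<phi> \<in> C_infinity \<Longrightarrow> continuous_on A \<phi>"
  by (metis C_infinity_differentiable continuous_at_imp_continuous_on differentiable_imp_continuous_within)

lemma continuous_grad: "\<phi> \<in> C_infinity \<Longrightarrow> continuous_on A (grad \<phi>)"
  unfolding grad_def
  by (intro continuous_on_vec_lambda C_infinity_continuous C_infinity_pderiv)

text \<open>\<open>C_times (Suc n)\<close> asks for \<open>C_times n\<close> of the partial
  derivatives, so the induction on n has to run over all members of A at once.\<close>

lemma C_infinity_coinduct:
  assumes "\<And>\<phi>. \<phi> \<in> A \<Longrightarrow> (\<forall>x. \<phi> differentiable (at x)) \<and> (\<forall>i. pderiv_at i \<phi> \<in> A)"
  shows "A \<subseteq> C_infinity"
proof -
  have "\<forall>\<phi>\<in>A. C_times n \<phi>" for n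
  proof (induction n)
    case 0
    show ?case using assms
      by (auto intro!: continuous_at_imp_continuous_on differentiable_imp_continuous_within)
  next
    case (Suc n)
    then show ?case using assms by auto
  qed
  then show ?thesis by (auto simp: C_infinity_def)
qed

text \<open>Closed under partial derivatives, hence made of smooth functions by coinduction; working with
  the whole algebra at once avoids iterated Leibniz and chain rules for \<^const>\<open>C_times\<close>.\<close>

inductive_set smooth_algebra :: "(pt \<Rightarrow> real) set" where
  base: "\<phi> \<in> C_infinity \<Longrightarrow> \<phi> \<in> smooth_algebra"
| const: "(\<lambda>x. c) \<in> smooth_algebra"
| coord: "(\<lambda>x. x $ i) \<in> smooth_algebra"
| recip: "(\<lambda>x. exp_recip n (c * (x $ i) + d)) \<in> smooth_algebra"
| add: "\<phi> \<in> smooth_algebra \<Longrightarrow> \<psi> \<in> smooth_algebra \<Longrightarrow> (\<lambda>x. \<phi> x + \<psi> x) \<in> smooth_algebra"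
| mult: "\<phi> \<in> smooth_algebra \<Longrightarrow> \<psi> \<in> smooth_algebra \<Longrightarrow> (\<lambda>x. \<phi> x * \<psi> x) \<in> smooth_algebra"

lemma pderiv_at_add:
  assumes "\<phi> differentiable (at x)" "\<psi> differentiable (at x)"
  shows "pderiv_at i (\<lambda>x. \<phi> x + \<psi> x) x = pderiv_at i \<phi> x + pderiv_at i \<psi> x"
  using pderiv_atI[OF has_derivative_add[OF assms[unfolded frechet_derivative_works]], of i]
  by (simp add: pderiv_at_def)

lemma pderiv_at_mult:
  assumes "\<phi> differentiable (at x)" "\<psi> differentiable (at x)"
  shows "pderiv_at i (\<lambda>x. \<phi> x * \<psi> x) x = \<phi> x * pderiv_at i \<psi> x + pderiv_at i \<phi> x * \<psi> x"
  using pderiv_atI[OF has_derivative_mult[OF assms[unfolded frechet_derivative_works]], of i]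
  by (simp add: pderiv_at_def)

lemma smooth_algebra_deriv:
  "\<phi> \<in> smooth_algebra \<Longrightarrow> (\<forall>x. \<phi> differentiable (at x)) \<and> (\<forall>j. pderiv_at j \<phi> \<in> smooth_algebra)"
proof (induction rule: smooth_algebra.induct)
  case (base \<phi>)
  then show ?case by (auto intro: smooth_algebra.base C_infinity_differentiable C_infinity_pderiv)
next
  case (const c)
  have "pderiv_at j (\<lambda>x. c) = (\<lambda>x. 0)" for j
    by (rule ext, rule pderiv_atI) (auto intro!: derivative_eq_intros)
  then show ?case by (simp add: smooth_algebra.const)
next
  case (coord i)
  have d: "((\<lambda>x. x $ i) has_derivative (\<lambda>h. h $ i)) (at x)" for x :: pt
    by (auto intro!: bounded_linear_imp_has_derivative bounded_linear_vec_nth)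
  have "pderiv_at j (\<lambda>x. x $ i) = (\<lambda>x. axis j 1 $ i)" for j
    by (rule ext, rule pderiv_atI[OF d])
  then show ?case using d by (auto simp: smooth_algebra.const differentiable_def)
next
  case (recip n c i d)
  have d: "((\<lambda>x. exp_recip n (c * (x $ i) + d)) has_derivative
      (\<lambda>h. (exp_recip (n + 2) (c * (x $ i) + d) - real n * exp_recip (n + 1) (c * (x $ i) + d)) * (c * h $ i))) (at x)" for x :: pt
    by (rule has_derivative_compose[OF _ exp_recip_has_derivative[unfolded has_field_derivative_def],
            where f="\<lambda>x. c * (x $ i) + d" and f'="\<lambda>h. c * h $ i"])
       (auto intro!: derivative_eq_intros bounded_linear_imp_has_derivative[OF bounded_linear_vec_nth])
  \<comment> \<open>The difference is written as a sum with the factor \<open>- real n\<close>,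
    because the algebra is generated by sums and products.\<close>
  have "pderiv_at j (\<lambda>x. exp_recip n (c * (x $ i) + d)) = (\<lambda>x. (exp_recip (n + 2) (c * (x $ i) + d)
      + (- real n) * exp_recip (n + 1) (c * (x $ i) + d)) * (c * axis j 1 $ i))" for j
    by (rule ext) (simp add: pderiv_atI[OF d])
  moreover have "(\<lambda>x. (exp_recip (n + 2) (c * (x $ i) + d)
      + (- real n) * exp_recip (n + 1) (c * (x $ i) + d)) * (c * axis j 1 $ i)) \<in> smooth_algebra" for j :: 2
    by (intro smooth_algebra.intros)
  ultimately show ?case using d by (auto simp: differentiable_def)
next
  case (add \<phi> \<psi>)
  then have "pderiv_at j (\<lambda>x. \<phi> x + \<psi> x) = (\<lambda>x. pderiv_at j \<phi> x + pderiv_at j \<psi> x)" for j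
    by (auto simp: pderiv_at_add)
  then show ?case using add by (auto intro: smooth_algebra.add)
next
  case (mult \<phi> \<psi>)
  then have "pderiv_at j (\<lambda>x. \<phi> x * \<psi> x) = (\<lambda>x. \<phi> x * pderiv_at j \<psi> x + pderiv_at j \<phi> x * \<psi> x)" for j
    by (auto simp: pderiv_at_mult)
  then show ?case using mult by (auto intro!: smooth_algebra.add intro: smooth_algebra.mult)
qed

text \<open>Coinduction gives one inclusion and the generator \<open>base\<close> the other. Hence
  the introduction rules of the algebra turn into closure rules for
  \<open>C_infinity\<close>.\<close>

lemma smooth_algebra_C_infinity: "smooth_algebra = C_infinity"
  using C_infinity_coinduct[of smooth_algebra] smooth_algebra_deriv smooth_algebra.base by blast

lemmas C_infinity_intros = smooth_algebra.intros(2-6)[unfolded smooth_algebra_C_infinity]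

lemma C_infinity_lincomb:
  "\<phi> \<in> C_infinity \<Longrightarrow> \<psi> \<in> C_infinity \<Longrightarrow> (\<lambda>x. \<phi> x + c * \<psi> x) \<in> C_infinity"
  by (intro C_infinity_intros)

lemma grad_lincomb:
  assumes "\<phi> \<in> C_infinity" "\<psi> \<in> C_infinity"
  shows "grad (\<lambda>x. \<phi> x + c * \<psi> x) x = grad \<phi> x + c *\<^sub>R grad \<psi> x"
proof -
  have "pderiv_at i (\<lambda>x. c * \<psi> x) x = c * pderiv_at i \<psi> x" for i
    using pderiv_at_mult[of "\<lambda>x. c" x \<psi> i] C_infinity_differentiable[OF assms(2)]
    by (simp add: pderiv_atI[OF has_derivative_const])
  then show ?thesis
    using assms by (simp add: grad_def vec_eq_iff pderiv_at_add C_infinity_differentiable C_infinity_intros)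
qed

section \<open>From smooth bumps on boxes to the fundamental lemma\<close>

text \<open>One flat factor per side of the box. Scaling its argument by n + 1 leaves the support
  unchanged, while at distance d > 0 from the side the factor exp(-1 / ((n + 1) d)) tends to
  1.\<close>

lemma box_test_functions:
  fixes a b :: pt
  obtains \<phi> :: "nat \<Rightarrow> pt \<Rightarrow> real" where
    "\<And>n. \<phi> n \<in> C_infinity" "\<And>n x. 0 \<le> \<phi> n x" "\<And>n x. \<phi> n x \<le> indicator (box a b) x"
    "\<And>x. (\<lambda>n. \<phi> n x) \<longlonglongrightarrow> indicator (box a b) x"
proof -
  \<comment> \<open>The arguments keep the shape \<open>c * (x $ i) + d\<close> of the rule
    \<open>smooth_algebra.recip\<close>, hence the unsimplified \<open>+ -\<close>.\<close>
  define \<phi> where "\<phi> n x = exp_recip 0 (real (Suc n) * x $ 1 + - real (Suc n) * a $ 1)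
    * exp_recip 0 (- real (Suc n) * x $ 1 + real (Suc n) * b $ 1)
    * (exp_recip 0 (real (Suc n) * x $ 2 + - real (Suc n) * a $ 2)
    * exp_recip 0 (- real (Suc n) * x $ 2 + real (Suc n) * b $ 2))" for n and x :: pt
  have E: "0 \<le> exp_recip 0 x" "exp_recip 0 x \<le> 1" for x by (auto simp: exp_recip_def)
  have sgn: "real (Suc n) * y + - real (Suc n) * z > 0 \<longleftrightarrow> z < y"
    "- real (Suc n) * y + real (Suc n) * z > 0 \<longleftrightarrow> y < z" for n y z
  proof -
    have "real (Suc n) * y + - real (Suc n) * z = real (Suc n) * (y - z)"
      "- real (Suc n) * y + real (Suc n) * z = real (Suc n) * (z - y)"
      by (simp_all add: algebra_simps)
    then show "real (Suc n) * y + - real (Suc n) * z > 0 \<longleftrightarrow> z < y"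
      "- real (Suc n) * y + real (Suc n) * z > 0 \<longleftrightarrow> y < z"
      by (simp_all add: zero_less_mult_iff del: of_nat_Suc)
  qed
  have lim: "(\<lambda>n. exp_recip 0 (real (Suc n) * y + - real (Suc n) * z)) \<longlonglongrightarrow> 1" if "z < y" for y z
  proof -
    have "(\<lambda>n. exp (- (1 / (y - z)) * inverse (real (Suc n)))) \<longlonglongrightarrow> exp (- (1 / (y - z)) * 0)"
      by (intro tendsto_intros LIMSEQ_inverse_real_of_nat)
    moreover have "exp_recip 0 (real (Suc n) * y + - real (Suc n) * z) = exp (- (1 / (y - z)) * inverse (real (Suc n)))" for n
    proof -
      have "real (Suc n) * y + - real (Suc n) * z = real (Suc n) * (y - z)" by (simp add: algebra_simps)
      moreover have "real (Suc n) * (y - z) > 0" using that by simp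
      ultimately show ?thesis by (simp add: exp_recip_def field_simps del: of_nat_Suc)
    qed
    ultimately show ?thesis by simp
  qed
  have lim': "(\<lambda>n. exp_recip 0 (- real (Suc n) * y + real (Suc n) * z)) \<longlonglongrightarrow> 1" if "y < z" for y z
    using lim[OF that] by (simp add: add.commute)
  have zero: "\<phi> n x = 0" if "x \<notin> box a b" for n x
    using that sgn unfolding \<phi>_def exp_recip_def mem_box_cart forall_2 by auto
  show thesis
  proof (rule that)
    show "\<phi> n \<in> C_infinity" for n
      unfolding \<phi>_def by (intro C_infinity_intros)
    show "0 \<le> \<phi> n x" for n x
      unfolding \<phi>_def by (intro mult_nonneg_nonneg E)
    show "\<phi> n x \<le> indicator (box a b) x" for n x
    proof (cases "x \<in> box a b")
      case True
      have "\<phi> n x \<le> 1" unfolding \<phi>_def by (intro mult_le_one mult_nonneg_nonneg E)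
      then show ?thesis using True by simp
    qed (simp add: zero)
    show "(\<lambda>n. \<phi> n x) \<longlonglongrightarrow> indicator (box a b) x" for x
    proof (cases "x \<in> box a b")
      case True
      then have "(\<lambda>n. \<phi> n x) \<longlonglongrightarrow> 1 * 1 * (1 * 1)"
        unfolding \<phi>_def mem_box_cart forall_2 by (intro tendsto_mult lim lim') auto
      then show ?thesis using True by simp
    qed (simp add: zero)
  qed
qed

text \<open>Boxes are an intersection-stable generator of the Borel sets, so a Dynkin argument
  carries vanishing integrals from boxes to Borel sets, and completion carries them to Lebesgue
  sets. A function whose integral vanishes over every measurable set is zero almost
  everywhere.\<close>

lemma AE_zero_if_box_integrals_zero:
  fixes g :: "'a::euclidean_space \<Rightarrow> real"
  assumes g: "integrable lebesgue g"
    and box: "\<And>a b. (\<integral>x. indicator (box a b) x * g x \<partial>lebesgue) = 0"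
  shows "AE x in lebesgue. g x = 0"
proof (rule sigma_finite_measure.density_zero[OF _ g])
  obtain A :: "'a set set" where "countable A" "A \<subseteq> sets lborel" "\<Union>A = space lborel" "\<forall>a\<in>A. emeasure lborel a \<noteq> \<infinity>"
    using lborel.sigma_finite_countable by blast
  then show "sigma_finite_measure (lebesgue :: 'a measure)"
    by (intro sigma_finite_measure.intro exI[of _ A]) (auto simp: emeasure_completion)
  have si: "set_integrable lebesgue A g" if "A \<in> sets lebesgue" for A
    unfolding set_integrable_def by (rule integrable_mult_indicator[OF that g])
  \<comment> \<open>The whole space is needed for complements in the Dynkin induction; it is
    exhausted by growing boxes under the dominating function |g|.\<close>
  have tot: "integral\<^sup>L lebesgue g = 0"
  proof -
    have "(\<lambda>n. \<integral>x. indicator (box (- (real n *\<^sub>R One)) (real n *\<^sub>R One)) x * g x \<partial>lebesgue) \<longlonglongrightarrow> integral\<^sup>L lebesgue g"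
    proof (rule integral_dominated_convergence[where w="\<lambda>x. \<bar>g x\<bar>"])
      show "AE x in lebesgue. (\<lambda>n. indicator (box (- (real n *\<^sub>R One)) (real n *\<^sub>R One)) x * g x) \<longlonglongrightarrow> g x"
      proof (rule AE_I2)
        fix x :: 'a
        obtain N :: nat where N: "norm x < real N" using reals_Archimedean2 by blast
        have "eventually (\<lambda>n. indicator (box (- (real n *\<^sub>R One)) (real n *\<^sub>R One)) x * g x = g x) sequentially"
          using eventually_ge_at_top[of N]
        proof eventually_elim
          case (elim n)
          then have "\<bar>x \<bullet> i\<bar> < real n" if "i \<in> Basis" for i
            using N Basis_le_norm[OF that, of x] by simp
          then have "- real n < x \<bullet> i \<and> x \<bullet> i < real n" if "i \<in> Basis" for i
            using that by (simp add: abs_less_iff minus_less_iff)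
          then have "x \<in> box (- (real n *\<^sub>R One)) (real n *\<^sub>R One)"
            by (simp add: mem_box)
          then show ?case by simp
        qed
        then show "(\<lambda>n. indicator (box (- (real n *\<^sub>R One)) (real n *\<^sub>R One)) x * g x) \<longlonglongrightarrow> g x"
          by (rule tendsto_eventually)
      qed
      show "(\<lambda>x. indicator (box (- (real n *\<^sub>R One)) (real n *\<^sub>R One)) x * g x) \<in> borel_measurable lebesgue" for n
        using g by (intro borel_measurable_times borel_measurable_indicator) auto
    qed (use g in \<open>auto simp: indicator_def\<close>)
    then show ?thesis unfolding box by (simp add: LIMSEQ_const_iff)
  qed
  have borel: "set_lebesgue_integral lebesgue A g = 0" if "A \<in> sets borel" for A
  proof -
    have A: "A \<in> sigma_sets UNIV (range (\<lambda>(a, b). box a b))"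
      using that by (simp add: borel_eq_box)
    have stable: "Int_stable (range (\<lambda>(a, b). box a b :: 'a set))"
      unfolding Int_stable_def by (auto simp: box_Int_box)
    show ?thesis
    proof (rule sigma_sets_induct_disjoint[OF stable _ A, where P="\<lambda>A. set_lebesgue_integral lebesgue A g = 0"])
      show "range (\<lambda>(a, b). box a b :: 'a set) \<subseteq> Pow UNIV" by simp
      show "set_lebesgue_integral lebesgue A g = 0" if "A \<in> range (\<lambda>(a, b). box a b)" for A
        using that box by (auto simp: set_lebesgue_integral_def)
      show "set_lebesgue_integral lebesgue {} g = 0" by (simp add: set_lebesgue_integral_def)
    next
      fix A :: "'a set"
      assume "A \<in> sigma_sets UNIV (range (\<lambda>(a, b). box a b))" and 0: "set_lebesgue_integral lebesgue A g = 0"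
      then have "A \<in> sets borel" by (simp add: borel_eq_box)
      then have A: "A \<in> sets lebesgue" by auto
      have "set_lebesgue_integral lebesgue (UNIV - A) g = integral\<^sup>L lebesgue (\<lambda>x. g x - indicator A x *\<^sub>R g x)"
        unfolding set_lebesgue_integral_def by (intro Bochner_Integration.integral_cong) (auto simp: indicator_def)
      also have "\<dots> = integral\<^sup>L lebesgue g - set_lebesgue_integral lebesgue A g"
        unfolding set_lebesgue_integral_def
        by (rule Bochner_Integration.integral_diff[OF g si[OF A, unfolded set_integrable_def]])
      finally show "set_lebesgue_integral lebesgue (UNIV - A) g = 0" using tot 0 by simp
    next
      fix A :: "nat \<Rightarrow> 'a set"
      assume disj: "disjoint_family A" and rng: "range A \<subseteq> sigma_sets UNIV (range (\<lambda>(a, b). box a b))"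
        and 0: "\<And>i. set_lebesgue_integral lebesgue (A i) g = 0"
      have A: "A i \<in> sets lebesgue" for i
      proof -
        have "A i \<in> sets borel" unfolding borel_eq_box using rng by auto
        then show ?thesis by auto
      qed
      have "set_lebesgue_integral lebesgue (\<Union>i. A i) g = (\<Sum>i. set_lebesgue_integral lebesgue (A i) g)"
        using disj A by (intro lebesgue_integral_countable_add si) (auto simp: disjoint_family_on_def)
      then show "set_lebesgue_integral lebesgue (\<Union>i. A i) g = 0" using 0 by simp
    qed
  qed
  fix A :: "'a set" assume A: "A \<in> sets lebesgue"
  \<comment> \<open>A Lebesgue set differs from a Borel set by a subset of a null set, which the
    integral does not see.\<close>
  then obtain S N N' where SN: "A = S \<union> N" "N \<subseteq> N'" "N' \<in> null_sets lborel" "S \<in> sets lborel"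
    by (rule sets_completionE)
  have "AE x in lebesgue. x \<notin> N'"
    using SN(3) by (intro AE_not_in) (simp add: null_sets_completionI)
  then have "AE x in lebesgue. indicator A x *\<^sub>R g x = indicator S x *\<^sub>R g x"
    by (rule AE_mp) (use SN in \<open>auto simp: indicator_def\<close>)
  then have "set_lebesgue_integral lebesgue A g = set_lebesgue_integral lebesgue S g"
    using A SN(4) g unfolding set_lebesgue_integral_def
    by (intro integral_cong_AE borel_measurable_scaleR borel_measurable_indicator) auto
  then show "set_lebesgue_integral lebesgue A g = 0" using borel SN(4) by simp
qed

text \<open>Bump functions converge boundedly to the indicator of a box, so g integrates to zero
  over every box whose closed box lies in S. As S is a countable union of closed boxes, it suffices
  to treat g on one of them; cutting g off there also makes it integrable, which square
  integrability alone would not give on an unbounded S.\<close>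

lemma fundamental_lemma:
  assumes "open S" and g: "L2 S g"
    and zero: "\<And>\<phi>. \<phi> \<in> test_functions S \<Longrightarrow> (\<integral>x. g x * \<phi> x \<partial>lebesgue_on S) = 0"
  shows "AE x in lebesgue_on S. g x = 0"
proof -
  have S: "S \<in> sets lebesgue" using \<open>open S\<close> by auto
  have L2box: "L2 S (indicator (box e f) :: pt \<Rightarrow> real)" for e f
  proof -
    have "(indicator (box e f) :: pt \<Rightarrow> real) \<in> borel_measurable (lebesgue_on S)"
      by (intro measurable_restrict_space1 borel_measurable_indicator) auto
    moreover have "integrable lebesgue (indicator (S \<inter> box e f) :: pt \<Rightarrow> real)"
      using S by (intro lmeasurable_iff_integrable[THEN iffD1] bounded_set_imp_lmeasurable) (auto simp: bounded_Int)
    then have "integrable lebesgue (\<lambda>x. indicator S x * indicator (box e f) x :: real)"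
      unfolding indicator_inter_arith[symmetric] .
    then have "integrable (lebesgue_on S) (indicator (box e f) :: pt \<Rightarrow> real)"
      using S by (subst integrable_restrict_space) simp_all
    moreover have "(\<lambda>x. (norm (indicator (box e f) x :: real))\<^sup>2) = (indicator (box e f) :: pt \<Rightarrow> real)"
      by (auto simp: indicator_def)
    ultimately show ?thesis by (simp add: L2_def)
  qed
  have box0: "(\<integral>x. g x * indicator (box e f) x \<partial>lebesgue_on S) = 0" if ef: "cbox e f \<subseteq> S" for e f
  proof -
    obtain \<phi> :: "nat \<Rightarrow> pt \<Rightarrow> real" where \<phi>:
      "\<And>n. \<phi> n \<in> C_infinity" "\<And>n x. 0 \<le> \<phi> n x" "\<And>n x. \<phi> n x \<le> indicator (box e f) x"
      "\<And>x. (\<lambda>n. \<phi> n x) \<longlonglongrightarrow> indicator (box e f) x" using box_test_functions[of e f] by blast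
    have "\<phi> n \<in> test_functions S" for n
    proof -
      have "{x. \<phi> n x \<noteq> 0} \<subseteq> cbox e f"
      proof
        fix x assume "x \<in> {x. \<phi> n x \<noteq> 0}"
        then have "indicator (box e f) x \<noteq> (0::real)" using \<phi>(2)[of n x] \<phi>(3)[of n x] by auto
        then show "x \<in> cbox e f" using box_subset_cbox by (auto simp: indicator_def split: if_splits)
      qed
      then have "closure {x. \<phi> n x \<noteq> 0} \<subseteq> cbox e f" by (simp add: closure_minimal closed_cbox)
      then show ?thesis using ef \<phi>(1)
        by (auto simp: test_functions_def compact_eq_bounded_closed intro: bounded_subset[OF bounded_cbox])
    qed
    then have z: "(\<integral>x. g x * \<phi> n x \<partial>lebesgue_on S) = 0" for n by (rule zero)
    have "(\<lambda>n. \<integral>x. g x * \<phi> n x \<partial>lebesgue_on S) \<longlonglongrightarrow> (\<integral>x. g x * indicator (box e f) x \<partial>lebesgue_on S)"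
    proof (rule integral_dominated_convergence[where w="\<lambda>x. \<bar>g x * indicator (box e f) x\<bar>"])
      show "(\<lambda>x. g x * indicator (box e f) x) \<in> borel_measurable (lebesgue_on S)"
        using L2_mult_integrable[OF g L2box] by auto
      show "(\<lambda>x. g x * \<phi> n x) \<in> borel_measurable (lebesgue_on S)" for n
        by (intro borel_measurable_times L2_measurable[OF g] continuous_imp_measurable_on_sets_lebesgue
            C_infinity_continuous[OF \<phi>(1)] S)
      show "integrable (lebesgue_on S) (\<lambda>x. \<bar>g x * indicator (box e f) x\<bar>)"
        using L2_mult_integrable[OF g L2box] by auto
      show "AE x in lebesgue_on S. (\<lambda>n. g x * \<phi> n x) \<longlonglongrightarrow> g x * indicator (box e f) x"
        by (intro AE_I2 tendsto_mult tendsto_const \<phi>)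
      show "AE x in lebesgue_on S. norm (g x * \<phi> n x) \<le> \<bar>g x * indicator (box e f) x\<bar>" for n
        using \<phi>(2,3)[of n] by (intro AE_I2) (auto simp: abs_mult intro!: mult_left_mono)
    qed
    then show ?thesis unfolding z by (simp add: LIMSEQ_const_iff)
  qed
  obtain \<D> where \<D>: "countable \<D>" "\<D> \<subseteq> Pow S" "\<And>X. X \<in> \<D> \<Longrightarrow> \<exists>a b. X = cbox a b" "\<Union>\<D> = S"
    using open_countable_Union_open_cbox[OF \<open>open S\<close>] by metis
  have "AE x in lebesgue. x \<in> X \<longrightarrow> g x = 0" if "X \<in> \<D>" for X
  proof -
    from \<D>(3)[OF that] obtain a b where X: "X = cbox a b" by blast
    then have ab: "cbox a b \<subseteq> S" using \<D>(2) \<open>X \<in> \<D>\<close> by auto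
    have int: "integrable lebesgue (\<lambda>x. indicator S x *\<^sub>R (g x * indicator (box a b) x))"
      by (rule integrable_restrict_space[THEN iffD1, OF _ L2_mult_integrable[OF g L2box]]) (simp add: S)
    have "AE x in lebesgue. indicator S x *\<^sub>R (g x * indicator (box a b) x) = 0"
    proof (rule AE_zero_if_box_integrals_zero[OF int])
      fix c d :: pt
      \<comment> \<open>Testing the cut-off function on a box only sees the intersection of two
        boxes, again a box.\<close>
      obtain e f where ef: "box a b \<inter> box c d = box e f" using box_Int_box by blast
      have "(\<integral>x. indicator (box c d) x * (indicator S x *\<^sub>R (g x * indicator (box a b) x)) \<partial>lebesgue)
        = (\<integral>x. indicator S x *\<^sub>R (g x * indicator (box e f) x) \<partial>lebesgue)"
        unfolding ef[symmetric]
        by (intro Bochner_Integration.integral_cong) (auto simp: indicator_def)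
      also have "\<dots> = (\<integral>x. g x * indicator (box e f) x \<partial>lebesgue_on S)"
        using S by (simp add: integral_restrict_space)
      also have "\<dots> = 0"
      \<comment> \<open>For nonempty boxes the closed box is the closure and stays inside
        \<open>cbox a b\<close>. An empty \<open>box e f\<close> may still have a nonempty
        \<open>cbox e f\<close> outside S, but then the integrand is zero.\<close>
      proof (cases "box e f = {}")
        case False
        then have "cbox e f = closure (box e f)" by simp
        also have "\<dots> \<subseteq> cbox a b"
          using ef box_subset_cbox[of a b] by (intro closure_minimal) auto
        finally show ?thesis using box0 ab by blast
      qed simp
      finally show "(\<integral>x. indicator (box c d) x * (indicator S x *\<^sub>R (g x * indicator (box a b) x)) \<partial>lebesgue) = 0" .
    qed
    moreover have "AE x in lebesgue. x \<notin> cbox a b - box a b"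
      using negligible_frontier_interval[of a b] by (intro AE_not_in) (simp add: negligible_iff_null_sets)
    ultimately show ?thesis
      by eventually_elim (use ab X in \<open>auto simp: indicator_def split: if_splits\<close>)
  qed
  then have "AE x in lebesgue. \<forall>X\<in>\<D>. x \<in> X \<longrightarrow> g x = 0"
    by (subst AE_ball_countable[OF \<D>(1)]) blast
  then have "AE x in lebesgue. x \<in> S \<longrightarrow> g x = 0"
    by (rule AE_mp) (use \<D>(4) in auto)
  then show ?thesis using S by (simp add: AE_restrict_space_iff)
qed

section \<open>Linearity of the Sobolev and virtual element spaces\<close>

lemma L2_integral_lincomb:
  assumes "L2 S v" "L2 S w" "L2 S q"
  shows "(\<integral>x. (v x + c *\<^sub>R w x) \<bullet> q x \<partial>lebesgue_on S)
    = (\<integral>x. v x \<bullet> q x \<partial>lebesgue_on S) + c * (\<integral>x. w x \<bullet> q x \<partial>lebesgue_on S)"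
  using L2_inner_integrable[OF assms(1,3)] L2_inner_integrable[OF assms(2,3)]
  by (simp add: inner_add_left)

lemma L2_integral_lincomb_real:
  fixes v w q :: "'a::euclidean_space \<Rightarrow> real"
  assumes "L2 S v" "L2 S w" "L2 S q"
  shows "(\<integral>x. (v x + c * w x) * q x \<partial>lebesgue_on S)
    = (\<integral>x. v x * q x \<partial>lebesgue_on S) + c * (\<integral>x. w x * q x \<partial>lebesgue_on S)"
  using L2_integral_lincomb[OF assms, of c] by simp

lemma test_functions_C_infinity: "\<phi> \<in> test_functions S \<Longrightarrow> \<phi> \<in> C_infinity"
  by (simp add: test_functions_def)

text \<open>The complement of the support is open, so the function vanishes near x. This allows
  integrals over an element to be extended to all of \<open>\<Omega>\<close>.\<close>

lemma test_function_outside: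
  assumes "\<phi> \<in> test_functions S" "x \<notin> S"
  shows "\<phi> x = 0" "pderiv_at i \<phi> x = 0"
proof -
  have x: "x \<in> - closure {x. \<phi> x \<noteq> 0}" using assms by (auto simp: test_functions_def)
  have 0: "\<phi> y = 0" if "y \<in> - closure {x. \<phi> x \<noteq> 0}" for y
    using that subsetD[OF closure_subset, of y "{x. \<phi> x \<noteq> 0}"] by auto
  show "\<phi> x = 0" using 0[OF x] .
  have "(\<phi> has_derivative (\<lambda>h. 0)) (at x)"
    by (rule has_derivative_transform_within_open[OF has_derivative_const[of 0] _ x 0[symmetric]]) auto
  then show "pderiv_at i \<phi> x = 0" by (rule pderiv_atI)
qed

lemma test_functions_mono: "P \<subseteq> S \<Longrightarrow> \<phi> \<in> test_functions P \<Longrightarrow> \<phi> \<in> test_functions S"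
  by (auto simp: test_functions_def)

lemma AE_vec_eq:
  fixes f g :: "'a \<Rightarrow> 'b ^ 'n"
  assumes "\<And>i. AE x in M. f x $ i = g x $ i"
  shows "AE x in M. f x = g x"
  unfolding vec_eq_iff using AE_finite_allI[where S=UNIV and M=M and Q="\<lambda>i x. f x $ i = g x $ i"] assms by simp

lemma wgrad_works: "v \<in> H1 S \<Longrightarrow> has_weak_grad S v (wgrad S v)"
  using someI_ex[of "has_weak_grad S v"] by (simp add: H1_def wgrad_def)

lemma H1_L2: "v \<in> H1 S \<Longrightarrow> L2 S v"
  by (simp add: H1_def)

lemma L2_wgrad: "v \<in> H1 S \<Longrightarrow> L2 S (wgrad S v)"
  using wgrad_works by (auto simp: has_weak_grad_def)

lemma H1_vec_L2: "v \<in> H1_vec S \<Longrightarrow> L2 S v"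
  by (intro L2_vecI H1_L2) (simp add: H1_vec_def)

lemma L2_jac: "v \<in> H1_vec S \<Longrightarrow> L2 S (jac S v)"
  by (intro L2_vecI[of S "jac S v"]) (simp add: jac_def H1_vec_def L2_wgrad)

section \<open>Integrals along edges\<close>

text \<open>Traces are defined by squared boundary integrals tending to zero, so the pointwise
  estimate (p + c q)^2 \<le> 2 p^2 + 2 c^2 q^2 can stand in for a triangle inequality on the
  boundary.\<close>

lemma line_integral_lincomb_sq_bound:
  assumes "\<And>a b. (a, b) \<in> E \<Longrightarrow> L2 {0..1} (\<lambda>s. p (linepath a b s))"
    and "\<And>a b. (a, b) \<in> E \<Longrightarrow> L2 {0..1} (\<lambda>s. q (linepath a b s))"
  shows "line_integral E (\<lambda>x. (p x + c * q x)\<^sup>2)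
    \<le> 2 * line_integral E (\<lambda>x. (p x)\<^sup>2) + 2 * c\<^sup>2 * line_integral E (\<lambda>x. (q x)\<^sup>2)"
proof -
  have "dist a b * (\<integral>s. (p (linepath a b s) + c * q (linepath a b s))\<^sup>2 \<partial>lebesgue_on {0..1})
    \<le> dist a b * (2 * (\<integral>s. (p (linepath a b s))\<^sup>2 \<partial>lebesgue_on {0..1}) + 2 * c\<^sup>2 * (\<integral>s. (q (linepath a b s))\<^sup>2 \<partial>lebesgue_on {0..1}))"
    if ab: "(a, b) \<in> E" for a b
  proof (rule mult_left_mono)
    have i: "integrable (lebesgue_on {0..1}) (\<lambda>s. (p (linepath a b s))\<^sup>2)"
      "integrable (lebesgue_on {0..1}) (\<lambda>s. (q (linepath a b s))\<^sup>2)"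
      "integrable (lebesgue_on {0..1}) (\<lambda>s. (p (linepath a b s) + c * q (linepath a b s))\<^sup>2)"
      using assms[OF ab] L2_lincomb_real[OF assms[OF ab], of c] by (auto simp: L2_def)
    have "(\<integral>s. (p (linepath a b s) + c * q (linepath a b s))\<^sup>2 \<partial>lebesgue_on {0..1})
      \<le> (\<integral>s. 2 * (p (linepath a b s))\<^sup>2 + 2 * c\<^sup>2 * (q (linepath a b s))\<^sup>2 \<partial>lebesgue_on {0..1})"
    proof (rule integral_mono)
      fix s
      show "(p (linepath a b s) + c * q (linepath a b s))\<^sup>2 \<le> 2 * (p (linepath a b s))\<^sup>2 + 2 * c\<^sup>2 * (q (linepath a b s))\<^sup>2"
        using sum_squares_bound[of "p (linepath a b s)" "c * q (linepath a b s)"]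
        by (simp add: power2_sum power_mult_distrib)
    qed (use i in auto)
    also have "\<dots> = 2 * (\<integral>s. (p (linepath a b s))\<^sup>2 \<partial>lebesgue_on {0..1}) + 2 * c\<^sup>2 * (\<integral>s. (q (linepath a b s))\<^sup>2 \<partial>lebesgue_on {0..1})"
      using i by simp
    finally show "(\<integral>s. (p (linepath a b s) + c * q (linepath a b s))\<^sup>2 \<partial>lebesgue_on {0..1})
      \<le> 2 * (\<integral>s. (p (linepath a b s))\<^sup>2 \<partial>lebesgue_on {0..1}) + 2 * c\<^sup>2 * (\<integral>s. (q (linepath a b s))\<^sup>2 \<partial>lebesgue_on {0..1})" .
  qed simp
  then have "line_integral E (\<lambda>x. (p x + c * q x)\<^sup>2) \<le> (\<Sum>(a, b)\<in>E. dist a b * (2 * (\<integral>s. (p (linepath a b s))\<^sup>2 \<partial>lebesgue_on {0..1}) + 2 * c\<^sup>2 * (\<integral>s. (q (linepath a b s))\<^sup>2 \<partial>lebesgue_on {0..1})))"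
    unfolding line_integral_def by (intro sum_mono) auto
  also have "\<dots> = 2 * line_integral E (\<lambda>x. (p x)\<^sup>2) + 2 * c\<^sup>2 * line_integral E (\<lambda>x. (q x)\<^sup>2)"
    unfolding line_integral_def
    by (simp add: sum_distrib_left sum.distrib[symmetric] case_prod_unfold algebra_simps)
  finally show ?thesis .
qed

lemma has_trace_L2: "has_trace E S v g \<Longrightarrow> (a, b) \<in> E \<Longrightarrow> L2 {0..1} (\<lambda>s. g (linepath a b s))"
  by (auto simp: has_trace_def)

lemma L2_edge_continuous:
  assumes "continuous_on UNIV \<phi>"
  shows "L2 {0..1} (\<lambda>s. (\<phi> (linepath a b s) :: 'b::euclidean_space))"
proof (rule continuous_L2_bounded)
  show "continuous_on UNIV (\<lambda>s. \<phi> (linepath a b s))"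
    by (rule continuous_on_compose2[OF assms continuous_on_linepath]) simp
qed auto

lemma line_integral_lincomb:
  assumes "\<And>a b. (a, b) \<in> E \<Longrightarrow> L2 {0..1} (\<lambda>s. p (linepath a b s))"
    and "\<And>a b. (a, b) \<in> E \<Longrightarrow> L2 {0..1} (\<lambda>s. q (linepath a b s))"
  shows "line_integral E (\<lambda>x. p x + c * q x) = line_integral E p + c * line_integral E q"
proof -
  \<comment> \<open>Pairing with the constant 1 reduces linearity of the plain integral to the
    bilinear rule for square-integrable functions.\<close>
  have one: "L2 {0..1} (\<lambda>s::real. 1 :: real)" by (intro continuous_L2_bounded) auto
  have "dist a b * (\<integral>s. p (linepath a b s) + c * q (linepath a b s) \<partial>lebesgue_on {0..1})
    = dist a b * (\<integral>s. p (linepath a b s) \<partial>lebesgue_on {0..1})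
    + c * (dist a b * (\<integral>s. q (linepath a b s) \<partial>lebesgue_on {0..1}))" if ab: "(a, b) \<in> E" for a b
    using L2_integral_lincomb_real[OF assms[OF ab] one, of c] by (simp add: algebra_simps)
  then show ?thesis unfolding line_integral_def
    by (simp add: sum_distrib_left sum.distrib[symmetric] case_prod_unfold)
qed

section \<open>Polynomials and scaled monomials\<close>

lemma polys_lincomb:
  assumes "p \<in> polys l" "q \<in> polys l"
  shows "(\<lambda>x. p x + c * q x) \<in> polys l"
proof -
  obtain cp cq where
    "\<And>x. p x = (\<Sum>(i, j)\<in>{(i, j). int i + int j \<le> l}. cp i j * (x $ 1) ^ i * (x $ 2) ^ j)"
    "\<And>x. q x = (\<Sum>(i, j)\<in>{(i, j). int i + int j \<le> l}. cq i j * (x $ 1) ^ i * (x $ 2) ^ j)"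
    using assms unfolding polys_def by blast
  then have "p x + c * q x = (\<Sum>(i, j)\<in>{(i, j). int i + int j \<le> l}. (cp i j + c * cq i j) * (x $ 1) ^ i * (x $ 2) ^ j)" for x
    by (simp add: sum_distrib_left sum.distrib[symmetric] case_prod_unfold algebra_simps)
  then show ?thesis unfolding polys_def by (intro CollectI exI[of _ "\<lambda>i j. cp i j + c * cq i j"]) simp
qed

lemma C_infinity_power: "\<phi> \<in> C_infinity \<Longrightarrow> (\<lambda>x. \<phi> x ^ n) \<in> C_infinity"
  by (induction n) (auto intro: C_infinity_intros)

lemma C_infinity_sum: "(\<And>i. i \<in> I \<Longrightarrow> \<phi> i \<in> C_infinity) \<Longrightarrow> (\<lambda>x. \<Sum>i\<in>I. \<phi> i x) \<in> C_infinity"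
  by (induction I rule: infinite_finite_induct) (auto intro: C_infinity_intros)

lemma polys_C_infinity:
  assumes "p \<in> polys l"
  shows "p \<in> C_infinity"
proof -
  obtain c where "\<And>x. p x = (\<Sum>(i, j)\<in>{(i, j). int i + int j \<le> l}. c i j * (x $ 1) ^ i * (x $ 2) ^ j)"
    using assms unfolding polys_def by blast
  then have "p = (\<lambda>x. \<Sum>ij\<in>{(i, j). int i + int j \<le> l}. c (fst ij) (snd ij) * (x $ 1) ^ fst ij * (x $ 2) ^ snd ij)"
    by (simp add: case_prod_unfold fun_eq_iff)
  then show ?thesis by (simp only:) (intro C_infinity_sum C_infinity_intros C_infinity_power)
qed

lemma scaled_monomial_C_infinity: "scaled_monomial S i j \<in> C_infinity"
proof -
  have "scaled_monomial S i j = (\<lambda>x. (inverse (diameter S) * (x $ 1 + - barycenter S $ 1)) ^ i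
      * (inverse (diameter S) * (x $ 2 + - barycenter S $ 2)) ^ j)"
    by (simp add: scaled_monomial_def fun_eq_iff field_simps)
  then show ?thesis by (simp only:) (intro C_infinity_intros C_infinity_power)
qed

section \<open>Weak derivatives and traces on a bounded open set\<close>

context
  fixes S :: "pt set"
  assumes open_S: "open S" and bounded_S: "bounded S"
begin

lemma S_lebesgue: "S \<in> sets lebesgue"
  using open_S by auto

lemma L2_C_infinity: "\<phi> \<in> C_infinity \<Longrightarrow> L2 S \<phi>"
  by (intro continuous_L2_bounded C_infinity_continuous bounded_S S_lebesgue)

lemma L2_grad: "\<phi> \<in> C_infinity \<Longrightarrow> L2 S (grad \<phi>)"
  by (intro continuous_L2_bounded continuous_grad bounded_S S_lebesgue)

lemma has_weak_grad_lincomb: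
  assumes "L2 S v" "L2 S w" "has_weak_grad S v g" "has_weak_grad S w h"
  shows "has_weak_grad S (\<lambda>x. v x + c * w x) (\<lambda>x. g x + c *\<^sub>R h x)"
  unfolding has_weak_grad_def
proof (intro conjI ballI allI)
  show "L2 S (\<lambda>x. g x + c *\<^sub>R h x)" using assms by (intro L2_lincomb) (auto simp: has_weak_grad_def)
  fix \<phi> i assume \<phi>: "\<phi> \<in> test_functions S"
  have L: "L2 S (pderiv_at i \<phi>)" "L2 S \<phi>"
    using \<phi> by (auto intro!: L2_C_infinity C_infinity_pderiv simp: test_functions_def)
  have gh: "L2 S (\<lambda>x. g x $ i)" "L2 S (\<lambda>x. h x $ i)"
    using assms by (auto simp: has_weak_grad_def intro: L2_vec_nth)
  show "(\<integral>x. (v x + c * w x) * pderiv_at i \<phi> x \<partial>lebesgue_on S) = - (\<integral>x. (g x + c *\<^sub>R h x) $ i * \<phi> x \<partial>lebesgue_on S)"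
    using assms(3,4) \<phi> L2_integral_lincomb_real[OF gh L(2), of c] L2_integral_lincomb_real[OF assms(1,2) L(1), of c]
    by (simp add: has_weak_grad_def)
qed

text \<open>Equality almost everywhere makes v and w indistinguishable in the defining identity, so
  each component of g - h is orthogonal to all test functions. The functions v and w are kept apart
  because initial values are prescribed only up to null sets.\<close>

lemma weak_grad_unique:
  assumes "L2 S v" "L2 S w" "AE x in lebesgue_on S. v x = w x" "has_weak_grad S v g" "has_weak_grad S w h"
  shows "AE x in lebesgue_on S. g x = h x"
proof (rule AE_vec_eq)
  fix i
  have gh: "L2 S (\<lambda>x. g x $ i)" "L2 S (\<lambda>x. h x $ i)"
    using assms by (auto simp: has_weak_grad_def intro: L2_vec_nth)
  have "AE x in lebesgue_on S. g x $ i - h x $ i = 0"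
  proof (rule fundamental_lemma[OF open_S])
    show "L2 S (\<lambda>x. g x $ i - h x $ i)" using gh by (rule L2_diff)
    fix \<phi> assume \<phi>: "\<phi> \<in> test_functions S"
    have L: "L2 S (pderiv_at i \<phi>)" "L2 S \<phi>"
      using \<phi> by (auto intro!: L2_C_infinity C_infinity_pderiv simp: test_functions_def)
    have "(\<integral>x. v x * pderiv_at i \<phi> x \<partial>lebesgue_on S) = (\<integral>x. w x * pderiv_at i \<phi> x \<partial>lebesgue_on S)"
      using L2_inner_cong_AE[OF assms(1,2) L(1) L(1) assms(3)] by simp
    then show "(\<integral>x. (g x $ i - h x $ i) * \<phi> x \<partial>lebesgue_on S) = 0"
      using L2_integral_lincomb_real[OF gh L(2), of "-1"] assms(4,5) \<phi> by (simp add: has_weak_grad_def)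
  qed
  then show "AE x in lebesgue_on S. g x $ i = h x $ i" by simp
qed

lemma H1_lincomb:
  assumes "v \<in> H1 S" "w \<in> H1 S"
  shows "(\<lambda>x. v x + c * w x) \<in> H1 S"
  using has_weak_grad_lincomb[OF _ _ wgrad_works wgrad_works] L2_lincomb_real assms
  unfolding H1_def by blast

lemma wgrad_lincomb:
  assumes "v \<in> H1 S" "w \<in> H1 S"
  shows "AE x in lebesgue_on S. wgrad S (\<lambda>x. v x + c * w x) x = wgrad S v x + c *\<^sub>R wgrad S w x"
  using assms
  by (intro weak_grad_unique[OF _ _ _ wgrad_works has_weak_grad_lincomb[OF _ _ wgrad_works wgrad_works]]
      H1_lincomb H1_L2) auto

lemma H1_vec_lincomb:
  assumes "v \<in> H1_vec S" "w \<in> H1_vec S"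
  shows "(\<lambda>x. v x + c *\<^sub>R w x) \<in> H1_vec S"
  using assms by (simp add: H1_vec_def H1_lincomb)

lemma jac_lincomb:
  assumes "v \<in> H1_vec S" "w \<in> H1_vec S"
  shows "AE x in lebesgue_on S. jac S (\<lambda>x. v x + c *\<^sub>R w x) x = jac S v x + c *\<^sub>R jac S w x"
  by (rule AE_vec_eq)
     (use assms in \<open>simp add: jac_def H1_vec_def wgrad_lincomb\<close>)

lemma has_weak_laplacian_lincomb:
  assumes "v \<in> H1 S" "w \<in> H1 S" "p \<in> C_infinity" "q \<in> C_infinity"
    "has_weak_laplacian S v p" "has_weak_laplacian S w q"
  shows "has_weak_laplacian S (\<lambda>x. v x + c * w x) (\<lambda>x. p x + c * q x)"
  unfolding has_weak_laplacian_def
proof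
  fix \<phi> assume \<phi>: "\<phi> \<in> test_functions S"
  then have L: "L2 S \<phi>" "L2 S (grad \<phi>)"
    by (auto intro: L2_C_infinity L2_grad test_functions_C_infinity)
  have "(\<integral>x. wgrad S (\<lambda>x. v x + c * w x) x \<bullet> grad \<phi> x \<partial>lebesgue_on S)
    = (\<integral>x. (wgrad S v x + c *\<^sub>R wgrad S w x) \<bullet> grad \<phi> x \<partial>lebesgue_on S)"
    using assms L by (intro L2_inner_cong_AE L2_lincomb L2_wgrad wgrad_lincomb H1_lincomb) auto
  also have "\<dots> = - (\<integral>x. (p x + c * q x) * \<phi> x \<partial>lebesgue_on S)"
    using assms \<phi> L2_integral_lincomb[OF L2_wgrad L2_wgrad L(2), of v w c]
      L2_integral_lincomb_real[OF L2_C_infinity L2_C_infinity L(1), of p q c]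
    by (simp add: has_weak_laplacian_def)
  finally show "(\<integral>x. wgrad S (\<lambda>x. v x + c * w x) x \<bullet> grad \<phi> x \<partial>lebesgue_on S)
    = - (\<integral>x. (p x + c * q x) * \<phi> x \<partial>lebesgue_on S)" .
qed

text \<open>Combine the two smooth approximating sequences term by term. In the gradient limit,
  \<open>wgrad\<close> of the combination must be replaced almost everywhere by the combination of
  gradients before the triangle inequality applies.\<close>

lemma has_trace_lincomb:
  assumes "v \<in> H1 S" "w \<in> H1 S" "has_trace E S v g" "has_trace E S w h"
  shows "has_trace E S (\<lambda>x. v x + c * w x) (\<lambda>x. g x + c * h x)"
proof -
  have gh: "\<And>a b. (a, b) \<in> E \<Longrightarrow> L2 {0..1} (\<lambda>s. g (linepath a b s))"
    "\<And>a b. (a, b) \<in> E \<Longrightarrow> L2 {0..1} (\<lambda>s. h (linepath a b s))"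
    using has_trace_L2[OF assms(3)] has_trace_L2[OF assms(4)] by blast+
  from assms(3) obtain \<phi> :: "nat \<Rightarrow> pt \<Rightarrow> real" where \<phi>: "\<And>n. \<phi> n \<in> C_infinity"
    "(\<lambda>n. L2_norm S (\<lambda>x. \<phi> n x - v x)) \<longlonglongrightarrow> 0"
    "(\<lambda>n. L2_norm S (\<lambda>x. grad (\<phi> n) x - wgrad S v x)) \<longlonglongrightarrow> 0"
    "(\<lambda>n. line_integral E (\<lambda>x. (\<phi> n x - g x)\<^sup>2)) \<longlonglongrightarrow> 0"
    unfolding has_trace_def by blast
  from assms(4) obtain \<psi> :: "nat \<Rightarrow> pt \<Rightarrow> real" where \<psi>: "\<And>n. \<psi> n \<in> C_infinity"
    "(\<lambda>n. L2_norm S (\<lambda>x. \<psi> n x - w x)) \<longlonglongrightarrow> 0"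
    "(\<lambda>n. L2_norm S (\<lambda>x. grad (\<psi> n) x - wgrad S w x)) \<longlonglongrightarrow> 0"
    "(\<lambda>n. line_integral E (\<lambda>x. (\<psi> n x - h x)\<^sup>2)) \<longlonglongrightarrow> 0"
    unfolding has_trace_def by blast
  define \<theta> where "\<theta> n x = \<phi> n x + c * \<psi> n x" for n x
  have \<theta>: "\<theta> n = (\<lambda>x. \<phi> n x + c * \<psi> n x)" for n by (simp add: \<theta>_def fun_eq_iff)
  have smooth: "\<theta> n \<in> C_infinity" for n
    unfolding \<theta> by (intro C_infinity_lincomb \<phi> \<psi>)
  have "(\<lambda>n. L2_norm S (\<lambda>x. \<theta> n x - (v x + c * w x))) \<longlonglongrightarrow> 0"
  proof (rule tendsto_sandwich[OF _ _ tendsto_const])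
    show "(\<lambda>n. L2_norm S (\<lambda>x. \<phi> n x - v x) + \<bar>c\<bar> * L2_norm S (\<lambda>x. \<psi> n x - w x)) \<longlonglongrightarrow> 0"
      using tendsto_add[OF \<phi>(2) tendsto_mult[OF tendsto_const[of "\<bar>c\<bar>"] \<psi>(2)]] by simp
    have "(\<lambda>x. \<theta> n x - (v x + c * w x)) = (\<lambda>x. (\<phi> n x - v x) + c *\<^sub>R (\<psi> n x - w x))" for n
      by (simp add: \<theta>_def fun_eq_iff algebra_simps)
    then show "\<forall>\<^sub>F n in sequentially. L2_norm S (\<lambda>x. \<theta> n x - (v x + c * w x))
        \<le> L2_norm S (\<lambda>x. \<phi> n x - v x) + \<bar>c\<bar> * L2_norm S (\<lambda>x. \<psi> n x - w x)"
      using L2_norm_lincomb[OF L2_diff L2_diff, OF L2_C_infinity[OF \<phi>(1)] H1_L2[OF assms(1)]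
          L2_C_infinity[OF \<psi>(1)] H1_L2[OF assms(2)]] by auto
  qed auto
  moreover have "(\<lambda>n. L2_norm S (\<lambda>x. grad (\<theta> n) x - wgrad S (\<lambda>x. v x + c * w x) x)) \<longlonglongrightarrow> 0"
  proof (rule tendsto_sandwich[OF _ _ tendsto_const])
    show "(\<lambda>n. L2_norm S (\<lambda>x. grad (\<phi> n) x - wgrad S v x) + \<bar>c\<bar> * L2_norm S (\<lambda>x. grad (\<psi> n) x - wgrad S w x)) \<longlonglongrightarrow> 0"
      using tendsto_add[OF \<phi>(3) tendsto_mult[OF tendsto_const[of "\<bar>c\<bar>"] \<psi>(3)]] by simp
    have "L2_norm S (\<lambda>x. grad (\<theta> n) x - wgrad S (\<lambda>x. v x + c * w x) x)
      = L2_norm S (\<lambda>x. (grad (\<phi> n) x - wgrad S v x) + c *\<^sub>R (grad (\<psi> n) x - wgrad S w x))" for n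
    proof (rule L2_norm_cong_AE)
      show "AE x in lebesgue_on S. grad (\<theta> n) x - wgrad S (\<lambda>x. v x + c * w x) x
        = (grad (\<phi> n) x - wgrad S v x) + c *\<^sub>R (grad (\<psi> n) x - wgrad S w x)"
        using wgrad_lincomb[OF assms(1,2), of c]
        by (rule lebesgue_on_mono) (simp add: \<theta> grad_lincomb[OF \<phi>(1) \<psi>(1)] algebra_simps)
    qed (intro L2_diff L2_lincomb L2_grad L2_wgrad H1_lincomb smooth \<phi> \<psi> assms)+
    then show "\<forall>\<^sub>F n in sequentially. L2_norm S (\<lambda>x. grad (\<theta> n) x - wgrad S (\<lambda>x. v x + c * w x) x)
        \<le> L2_norm S (\<lambda>x. grad (\<phi> n) x - wgrad S v x) + \<bar>c\<bar> * L2_norm S (\<lambda>x. grad (\<psi> n) x - wgrad S w x)"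
      using L2_norm_lincomb[OF L2_diff L2_diff, OF L2_grad[OF \<phi>(1)] L2_wgrad[OF assms(1)]
          L2_grad[OF \<psi>(1)] L2_wgrad[OF assms(2)]] by simp
  qed auto
  moreover have "(\<lambda>n. line_integral E (\<lambda>x. (\<theta> n x - (g x + c * h x))\<^sup>2)) \<longlonglongrightarrow> 0"
  proof (rule tendsto_sandwich[OF _ _ tendsto_const])
    show "(\<lambda>n. 2 * line_integral E (\<lambda>x. (\<phi> n x - g x)\<^sup>2) + 2 * c\<^sup>2 * line_integral E (\<lambda>x. (\<psi> n x - h x)\<^sup>2)) \<longlonglongrightarrow> 0"
      using tendsto_add[OF tendsto_mult[OF tendsto_const[of 2] \<phi>(4)] tendsto_mult[OF tendsto_const[of "2 * c\<^sup>2"] \<psi>(4)]] by simp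
    have "line_integral E (\<lambda>x. (\<theta> n x - (g x + c * h x))\<^sup>2)
        \<le> 2 * line_integral E (\<lambda>x. (\<phi> n x - g x)\<^sup>2) + 2 * c\<^sup>2 * line_integral E (\<lambda>x. (\<psi> n x - h x)\<^sup>2)" for n
    proof -
      have "(\<lambda>x. (\<theta> n x - (g x + c * h x))\<^sup>2) = (\<lambda>x. ((\<phi> n x - g x) + c * (\<psi> n x - h x))\<^sup>2)"
        by (simp add: \<theta>_def fun_eq_iff algebra_simps)
      moreover have "line_integral E (\<lambda>x. ((\<phi> n x - g x) + c * (\<psi> n x - h x))\<^sup>2)
        \<le> 2 * line_integral E (\<lambda>x. (\<phi> n x - g x)\<^sup>2) + 2 * c\<^sup>2 * line_integral E (\<lambda>x. (\<psi> n x - h x)\<^sup>2)"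
        by (rule line_integral_lincomb_sq_bound)
           (simp_all add: L2_diff L2_edge_continuous C_infinity_continuous \<phi> \<psi> gh)
      ultimately show ?thesis by simp
    qed
    then show "\<forall>\<^sub>F n in sequentially. line_integral E (\<lambda>x. (\<theta> n x - (g x + c * h x))\<^sup>2)
        \<le> 2 * line_integral E (\<lambda>x. (\<phi> n x - g x)\<^sup>2) + 2 * c\<^sup>2 * line_integral E (\<lambda>x. (\<psi> n x - h x)\<^sup>2)"
      by simp
    show "\<forall>\<^sub>F n in sequentially. 0 \<le> line_integral E (\<lambda>x. (\<theta> n x - (g x + c * h x))\<^sup>2)"
      unfolding line_integral_def by (intro always_eventually allI sum_nonneg) (auto intro: mult_nonneg_nonneg Bochner_Integration.integral_nonneg)
  qed
  moreover have "\<forall>(a, b)\<in>E. L2 {0..1} (\<lambda>s. g (linepath a b s) + c * h (linepath a b s))"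
    using gh by (auto intro!: L2_lincomb_real)
  ultimately show ?thesis unfolding has_trace_def using smooth by blast
qed

end

section \<open>Linearity of the local virtual element space\<close>

context
  fixes P :: "pt list" and k :: nat
  assumes open_P: "open (region P)" and bounded_P: "bounded (region P)"
begin

text \<open>The elliptic projection enters as a relation, so its linearity says that witnesses may
  be combined. For k = 1 the normalising condition contains a trace, which is combined along with
  them; for other k it is an integral over the element.\<close>

lemma is_Pi_nabla_lincomb:
  assumes "v \<in> H1 (region P)" "w \<in> H1 (region P)" "is_Pi_nabla k P v p" "is_Pi_nabla k P w q"
  shows "is_Pi_nabla k P (\<lambda>x. v x + c * w x) (\<lambda>x. p x + c * q x)"
  unfolding is_Pi_nabla_def
proof (intro conjI ballI)
  note S = open_P bounded_P
  have pq: "p \<in> polys (int k)" "q \<in> polys (int k)" using assms unfolding is_Pi_nabla_def by blast+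
  note sm = polys_C_infinity[OF pq(1)] polys_C_infinity[OF pq(2)]
  show "(\<lambda>x. p x + c * q x) \<in> polys (int k)" using pq by (rule polys_lincomb)
  note L = L2_diff[OF L2_grad[OF S sm(1)] L2_wgrad[OF assms(1)]] L2_diff[OF L2_grad[OF S sm(2)] L2_wgrad[OF assms(2)]]
  fix r assume r: "r \<in> polys (int k)"
  note Lr = L2_grad[OF S polys_C_infinity[OF r]]
  have "(\<integral>x. (grad (\<lambda>x. p x + c * q x) x - wgrad (region P) (\<lambda>x. v x + c * w x) x) \<bullet> grad r x \<partial>lebesgue_on (region P))
    = (\<integral>x. ((grad p x - wgrad (region P) v x) + c *\<^sub>R (grad q x - wgrad (region P) w x)) \<bullet> grad r x \<partial>lebesgue_on (region P))"
  proof (rule L2_inner_cong_AE[OF _ _ Lr Lr])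
    show "AE x in lebesgue_on (region P). grad (\<lambda>x. p x + c * q x) x - wgrad (region P) (\<lambda>x. v x + c * w x) x
      = (grad p x - wgrad (region P) v x) + c *\<^sub>R (grad q x - wgrad (region P) w x)"
      using wgrad_lincomb[OF S assms(1,2), of c]
      by (rule lebesgue_on_mono) (simp add: grad_lincomb[OF sm] algebra_simps)
  qed (auto intro!: L2_diff L2_lincomb L L2_grad[OF S] L2_wgrad H1_lincomb[OF S] C_infinity_lincomb sm assms)
  also have "\<dots> = 0" using assms(3,4) r by (simp add: L2_integral_lincomb[OF L Lr] is_Pi_nabla_def)
  finally show "(\<integral>x. (grad (\<lambda>x. p x + c * q x) x - wgrad (region P) (\<lambda>x. v x + c * w x) x) \<bullet> grad r x \<partial>lebesgue_on (region P)) = 0" .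
next
  note S = open_P bounded_P
  have pq: "p \<in> polys (int k)" "q \<in> polys (int k)" using assms unfolding is_Pi_nabla_def by blast+
  note sm = polys_C_infinity[OF pq(1)] polys_C_infinity[OF pq(2)]
  show "if k = 1
    then \<exists>g. has_trace (edges P) (region P) (\<lambda>x. v x + c * w x) g \<and> line_integral (edges P) (\<lambda>x. p x + c * q x - g x) = 0
    else (\<integral>x. p x + c * q x - (v x + c * w x) \<partial>lebesgue_on (region P)) = 0"
  proof (cases "k = 1")
    case True
    with assms obtain g h where gh: "has_trace (edges P) (region P) v g" "line_integral (edges P) (\<lambda>x. p x - g x) = 0"
      "has_trace (edges P) (region P) w h" "line_integral (edges P) (\<lambda>x. q x - h x) = 0"
      by (auto simp: is_Pi_nabla_def)
    have eq: "(\<lambda>x. p x + c * q x - (g x + c * h x)) = (\<lambda>x. (p x - g x) + c * (q x - h x))"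
      by (simp add: fun_eq_iff algebra_simps)
    have "line_integral (edges P) (\<lambda>x. p x + c * q x - (g x + c * h x)) = 0"
      unfolding eq using gh(2,4)
      by (subst line_integral_lincomb)
         (simp_all add: L2_diff L2_edge_continuous C_infinity_continuous sm has_trace_L2[OF gh(1)] has_trace_L2[OF gh(3)])
    then show ?thesis using True has_trace_lincomb[OF S assms(1,2) gh(1,3)] by auto
  next
    case False
    have one: "L2 (region P) (\<lambda>x. 1::real)" by (intro L2_C_infinity[OF S] C_infinity_intros)
    have "(\<lambda>x. p x + c * q x - (v x + c * w x)) = (\<lambda>x. ((p x - v x) + c * (q x - w x)) * 1)"
      by (simp add: fun_eq_iff algebra_simps)
    moreover have "(\<integral>x. ((p x - v x) + c * (q x - w x)) * 1 \<partial>lebesgue_on (region P)) = 0"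
      using assms(3,4) False
        L2_integral_lincomb_real[OF L2_diff[OF L2_C_infinity[OF S sm(1)] H1_L2[OF assms(1)]]
          L2_diff[OF L2_C_infinity[OF S sm(2)] H1_L2[OF assms(2)]] one, of c]
      by (simp add: is_Pi_nabla_def)
    ultimately show ?thesis using False by (simp only: if_False)
  qed
qed

text \<open>Each existential clause (boundary polynomial, Laplacian, elliptic projection) is met by
  the same combination of the two given witnesses.\<close>

lemma VEM_local_lincomb:
  assumes v: "v \<in> VEM_local k P" and w: "w \<in> VEM_local k P"
  shows "(\<lambda>x. v x + c * w x) \<in> VEM_local k P"
proof -
  note S = open_P bounded_P
  have H: "v \<in> H1 (region P)" "w \<in> H1 (region P)" using v w unfolding VEM_local_def by blast+
  obtain g where g: "has_trace (edges P) (region P) v g" "continuous_on (polygon_boundary P) g"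
    "\<And>a b. (a, b) \<in> edges P \<Longrightarrow> \<exists>q\<in>polys (int k). \<forall>x\<in>closed_segment a b. g x = q x"
    using v by (fastforce simp: VEM_local_def)
  obtain h where h: "has_trace (edges P) (region P) w h" "continuous_on (polygon_boundary P) h"
    "\<And>a b. (a, b) \<in> edges P \<Longrightarrow> \<exists>q\<in>polys (int k). \<forall>x\<in>closed_segment a b. h x = q x"
    using w by (fastforce simp: VEM_local_def)
  have tr: "\<exists>g. has_trace (edges P) (region P) (\<lambda>x. v x + c * w x) g \<and> continuous_on (polygon_boundary P) g \<and>
        (\<forall>(a, b)\<in>edges P. \<exists>q\<in>polys (int k). \<forall>x\<in>closed_segment a b. g x = q x)"
  proof (intro exI[of _ "\<lambda>x. g x + c * h x"] conjI ballI, goal_cases)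
    case 1
    show ?case by (rule has_trace_lincomb[OF S H g(1) h(1)])
  next
    case 2
    show ?case by (intro continuous_intros g h)
  next
    case (3 e)
    obtain a b where e: "e = (a, b)" by (cases e)
    obtain p q where "p \<in> polys (int k)" "\<forall>x\<in>closed_segment a b. g x = p x"
      "q \<in> polys (int k)" "\<forall>x\<in>closed_segment a b. h x = q x"
      using g(3) h(3) 3 unfolding e by meson
    then show ?case unfolding e
      by (auto intro!: bexI[OF _ polys_lincomb[of p "int k" q c]])
  qed
  obtain p q where pq: "p \<in> polys (int k)" "has_weak_laplacian (region P) v p"
    "q \<in> polys (int k)" "has_weak_laplacian (region P) w q"
    using v w unfolding VEM_local_def by blast
  have lap: "\<exists>q\<in>polys (int k). has_weak_laplacian (region P) (\<lambda>x. v x + c * w x) q"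
    using has_weak_laplacian_lincomb[OF S H polys_C_infinity[OF pq(1)] polys_C_infinity[OF pq(3)] pq(2,4)]
      polys_lincomb[OF pq(1,3)] by blast
  obtain r where r: "is_Pi_nabla k P v r" "\<And>i j. i + j \<in> {k - 1, k} \<Longrightarrow>
           (\<integral>x. (v x - r x) * scaled_monomial (region P) i j x \<partial>lebesgue_on (region P)) = 0"
    using v unfolding VEM_local_def by blast
  obtain s where s: "is_Pi_nabla k P w s" "\<And>i j. i + j \<in> {k - 1, k} \<Longrightarrow>
           (\<integral>x. (w x - s x) * scaled_monomial (region P) i j x \<partial>lebesgue_on (region P)) = 0"
    using w unfolding VEM_local_def by blast
  have rs: "r \<in> C_infinity" "s \<in> C_infinity"
    using r(1) s(1) unfolding is_Pi_nabla_def by (blast intro: polys_C_infinity)+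
  have pi: "\<exists>p. is_Pi_nabla k P (\<lambda>x. v x + c * w x) p \<and> (\<forall>i j. i + j \<in> {k - 1, k} \<longrightarrow>
           (\<integral>x. (v x + c * w x - p x) * scaled_monomial (region P) i j x \<partial>lebesgue_on (region P)) = 0)"
  proof (intro exI[of _ "\<lambda>x. r x + c * s x"] conjI allI impI)
    show "is_Pi_nabla k P (\<lambda>x. v x + c * w x) (\<lambda>x. r x + c * s x)"
      by (rule is_Pi_nabla_lincomb[OF H r(1) s(1)])
    fix i j assume ij: "i + j \<in> {k - 1, k}"
    have "v x + c * w x - (r x + c * s x) = (v x - r x) + c * (w x - s x)" for x
      by (simp add: algebra_simps)
    then have eq: "(\<lambda>x. v x + c * w x - (r x + c * s x)) = (\<lambda>x. (v x - r x) + c * (w x - s x))"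
      by blast
    show "(\<integral>x. (v x + c * w x - (r x + c * s x)) * scaled_monomial (region P) i j x \<partial>lebesgue_on (region P)) = 0"
      unfolding fun_cong[OF eq] using r(2)[OF ij] s(2)[OF ij]
        L2_integral_lincomb_real[OF L2_diff[OF H1_L2[OF H(1)] L2_C_infinity[OF S rs(1)]]
          L2_diff[OF H1_L2[OF H(2)] L2_C_infinity[OF S rs(2)]] L2_C_infinity[OF S scaled_monomial_C_infinity], of c]
      by simp
  qed
  show ?thesis unfolding VEM_local_def using H1_lincomb[OF S H] tr lap pi by blast
qed

lemma VEM_local_vec_lincomb:
  "v \<in> VEM_local_vec k P \<Longrightarrow> w \<in> VEM_local_vec k P \<Longrightarrow> (\<lambda>x. v x + c *\<^sub>R w x) \<in> VEM_local_vec k P"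
  by (simp add: VEM_local_vec_def VEM_local_lincomb)

end

lemma VEM_local_vec_H1_vec: "v \<in> VEM_local_vec k P \<Longrightarrow> v \<in> H1_vec (region P)"
  by (simp add: VEM_local_vec_def VEM_local_def H1_vec_def)

lemma V_space_lincomb:
  assumes "open \<Omega>" "bounded \<Omega>" "v \<in> V_space \<Omega> B \<Gamma>D" "w \<in> V_space \<Omega> B \<Gamma>D"
  shows "(\<lambda>x. v x + c *\<^sub>R w x) \<in> V_space \<Omega> B \<Gamma>D"
  unfolding V_space_def mem_Collect_eq
proof (intro conjI allI)
  have H: "v \<in> H1_vec \<Omega>" "w \<in> H1_vec \<Omega>" using assms by (auto simp: V_space_def)
  then show "(\<lambda>x. v x + c *\<^sub>R w x) \<in> H1_vec \<Omega>" by (rule H1_vec_lincomb[OF assms(1,2)])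
  fix i
  obtain g h where "has_trace (domain_edges B) \<Omega> (\<lambda>x. v x $ i) g" "\<forall>x\<in>\<Gamma>D. g x = 0"
    "has_trace (domain_edges B) \<Omega> (\<lambda>x. w x $ i) h" "\<forall>x\<in>\<Gamma>D. h x = 0"
    using assms unfolding V_space_def by blast
  moreover have "(\<lambda>x. v x $ i) \<in> H1 \<Omega>" "(\<lambda>x. w x $ i) \<in> H1 \<Omega>" using H by (auto simp: H1_vec_def)
  ultimately show "\<exists>g. has_trace (domain_edges B) \<Omega> (\<lambda>x. (v x + c *\<^sub>R w x) $ i) g \<and> (\<forall>x\<in>\<Gamma>D. g x = 0)"
    using has_trace_lincomb[OF assms(1,2), of "\<lambda>x. v x $ i" "\<lambda>x. w x $ i" _ g h c]
    by (intro exI[of _ "\<lambda>x. g x + c * h x"]) simp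
qed

section \<open>Polynomial projections\<close>

text \<open>One Gram-Schmidt step: \<open>e\<close>, the part of b orthogonal to W, spans the new
  direction, and the residual of v is corrected by the right multiple of it. The function b may
  already agree with an element of W almost everywhere.\<close>

lemma projection_extend:
  fixes b :: "'a::euclidean_space \<Rightarrow> real"
  assumes W: "\<And>q. q \<in> W \<Longrightarrow> L2 S q"
    and lin: "\<And>p q c. p \<in> W \<Longrightarrow> q \<in> W \<Longrightarrow> (\<lambda>x. p x + c * q x) \<in> W"
    and proj: "\<And>v. L2 S v \<Longrightarrow> \<exists>p\<in>W. \<forall>q\<in>W. (\<integral>x. (v x - p x) * q x \<partial>lebesgue_on S) = 0"
    and b: "L2 S b" and v: "L2 S v"
  shows "\<exists>p\<in>W. \<exists>a. (\<forall>q\<in>W. (\<integral>x. (v x - (p x + a * b x)) * q x \<partial>lebesgue_on S) = 0)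
    \<and> (\<integral>x. (v x - (p x + a * b x)) * b x \<partial>lebesgue_on S) = 0"
proof -
  obtain p where p: "p \<in> W" "\<And>q. q \<in> W \<Longrightarrow> (\<integral>x. (v x - p x) * q x \<partial>lebesgue_on S) = 0"
    using proj[OF v] by blast
  obtain d where d: "d \<in> W" "\<And>q. q \<in> W \<Longrightarrow> (\<integral>x. (b x - d x) * q x \<partial>lebesgue_on S) = 0"
    using proj[OF b] by blast
  define r where "r x = v x - p x" for x
  define e where "e x = b x - d x" for x
  have Lr: "L2 S r" unfolding r_def[abs_def] by (rule L2_diff[OF v W[OF p(1)]])
  have Le: "L2 S e" unfolding e_def[abs_def] by (rule L2_diff[OF b W[OF d(1)]])
  define a where "a = (\<integral>x. r x * e x \<partial>lebesgue_on S) / (\<integral>x. e x * e x \<partial>lebesgue_on S)"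
  \<comment> \<open>If e has norm zero, Cauchy-Schwarz makes the left side vanish too, so the
    equation survives the division by zero in \<open>a\<close>.\<close>
  have ae: "(\<integral>x. r x * e x \<partial>lebesgue_on S) = a * (\<integral>x. e x * e x \<partial>lebesgue_on S)"
  proof (cases "(\<integral>x. e x * e x \<partial>lebesgue_on S) = 0")
    case True
    then have "L2_norm S e = 0" by (simp add: L2_norm_def power2_eq_square)
    then show ?thesis using L2_Cauchy_Schwarz[OF Lr Le] True by simp
  qed (simp add: a_def)
  have re: "(\<integral>x. (r x + (- a) * e x) * q x \<partial>lebesgue_on S)
      = (\<integral>x. r x * q x \<partial>lebesgue_on S) + (- a) * (\<integral>x. e x * q x \<partial>lebesgue_on S)" if "L2 S q" for q
    by (rule L2_integral_lincomb_real[OF Lr Le that])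
  have W0: "(\<integral>x. (r x + (- a) * e x) * q x \<partial>lebesgue_on S) = 0" if "q \<in> W" for q
    using re[OF W[OF that]] p(2)[OF that] d(2)[OF that] by (simp add: r_def e_def)
  \<comment> \<open>Since a e = a b - a d, the witness in W is p - a d and the coefficient of b is
    a.\<close>
  have res: "(\<lambda>x. v x - ((p x + (- a) * d x) + a * b x)) = (\<lambda>x. r x + (- a) * e x)"
    by (simp add: r_def e_def fun_eq_iff algebra_simps)
  \<comment> \<open>As b = e + d, orthogonality to b splits into orthogonality to e, by the choice
    of a, and to d, which lies in W.\<close>
  have "(\<integral>x. (r x + (- a) * e x) * b x \<partial>lebesgue_on S)
      = (\<integral>x. (e x + 1 * d x) * (r x + (- a) * e x) \<partial>lebesgue_on S)"
    by (simp add: e_def mult.commute)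
  also have "\<dots> = (\<integral>x. e x * (r x + (- a) * e x) \<partial>lebesgue_on S) + 1 * (\<integral>x. d x * (r x + (- a) * e x) \<partial>lebesgue_on S)"
    by (intro L2_integral_lincomb_real Le W d L2_lincomb_real Lr)
  also have "\<dots> = 0"
    using re[OF Le] W0[OF d(1)] ae by (simp add: mult.commute)
  finally have b0: "(\<integral>x. (r x + (- a) * e x) * b x \<partial>lebesgue_on S) = 0" .
  show ?thesis
  proof (intro bexI exI conjI ballI)
    show "(\<lambda>x. p x + (- a) * d x) \<in> W" by (rule lin[OF p(1) d(1)])
    show "(\<integral>x. (v x - ((p x + (- a) * d x) + a * b x)) * b x \<partial>lebesgue_on S) = 0"
      unfolding fun_cong[OF res] by (rule b0)
    fix q assume "q \<in> W"
    then show "(\<integral>x. (v x - ((p x + (- a) * d x) + a * b x)) * q x \<partial>lebesgue_on S) = 0"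
      unfolding fun_cong[OF res] by (rule W0)
  qed
qed

text \<open>Functions are not identified up to null sets here, so the projection is built by adding
  one spanning function at a time. The family b may be linearly dependent.\<close>

lemma projection_onto_span:
  fixes b :: "'i \<Rightarrow> 'a::euclidean_space \<Rightarrow> real"
  assumes "finite I" "\<And>i. i \<in> I \<Longrightarrow> L2 S (b i)" "L2 S v"
  shows "\<exists>p\<in>range (\<lambda>c x. \<Sum>i\<in>I. c i * b i x). \<forall>q\<in>range (\<lambda>c x. \<Sum>i\<in>I. c i * b i x).
    (\<integral>x. (v x - p x) * q x \<partial>lebesgue_on S) = 0"
  using assms
proof (induction I arbitrary: v rule: finite_induct)
  case empty
  then show ?case by auto
next
  case (insert k I)
  let ?W = "\<lambda>I. range (\<lambda>c x. \<Sum>i\<in>I. c i * b i x)"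
  have L: "L2 S q" if "q \<in> ?W J" "J \<subseteq> insert k I" for q J
  proof -
    have "finite J" using that insert.hyps by (meson finite_insert finite_subset)
    then have "L2 S (\<lambda>x. \<Sum>i\<in>J. c i * b i x)" if "J \<subseteq> insert k I" for c
      using that
    proof (induction J rule: finite_induct)
      case empty
      then show ?case by (simp add: L2_zero)
    next
      case (insert j J)
      then have "L2 S (\<lambda>x. (\<Sum>i\<in>J. c i * b i x) + c j * b j x)"
        by (intro L2_lincomb_real \<open>\<And>i. i \<in> insert k I \<Longrightarrow> L2 S (b i)\<close>) auto
      then show ?case using insert by (simp add: add.commute)
    qed
    then show ?thesis using that by auto
  qed
  have lin: "(\<lambda>x. p x + c * q x) \<in> ?W I" if pq: "p \<in> ?W I" "q \<in> ?W I" for p q c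
  proof -
    obtain cp cq where "p = (\<lambda>x. \<Sum>i\<in>I. cp i * b i x)" "q = (\<lambda>x. \<Sum>i\<in>I. cq i * b i x)"
      using pq by blast
    then have "(\<lambda>x. p x + c * q x) = (\<lambda>x. \<Sum>i\<in>I. (cp i + c * cq i) * b i x)"
      by (simp add: sum_distrib_left sum.distrib[symmetric] algebra_simps)
    then show ?thesis by (rule image_eqI[where x="\<lambda>i. cp i + c * cq i"]) simp
  qed
  have "\<exists>p\<in>?W I. \<exists>a. (\<forall>q\<in>?W I. (\<integral>x. (v x - (p x + a * b k x)) * q x \<partial>lebesgue_on S) = 0)
    \<and> (\<integral>x. (v x - (p x + a * b k x)) * b k x \<partial>lebesgue_on S) = 0"
  proof (rule projection_extend)
    show "\<exists>p\<in>?W I. \<forall>q\<in>?W I. (\<integral>x. (v x - p x) * q x \<partial>lebesgue_on S) = 0" if "L2 S v" for v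
      using insert.IH[OF _ that] insert.prems(1) by blast
  qed (use insert.prems L lin in auto)
  then obtain p0 a where p0: "p0 \<in> ?W I"
    and p0b: "(\<forall>q\<in>?W I. (\<integral>x. (v x - (p0 x + a * b k x)) * q x \<partial>lebesgue_on S) = 0)
      \<and> (\<integral>x. (v x - (p0 x + a * b k x)) * b k x \<partial>lebesgue_on S) = 0"
    by (elim bexE exE)
  obtain c where c: "p0 = (\<lambda>x. \<Sum>i\<in>I. c i * b i x)" using p0 by (rule rangeE)
  note ca = bspec[OF conjunct1[OF p0b[unfolded c]]] conjunct2[OF p0b[unfolded c]]
  define p where "p x = (\<Sum>i\<in>I. c i * b i x) + a * b k x" for x
  have p: "p = (\<lambda>x. \<Sum>i\<in>insert k I. (c(k := a)) i * b i x)"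
  proof
    fix x
    have "(\<Sum>i\<in>I. (c(k := a)) i * b i x) = (\<Sum>i\<in>I. c i * b i x)"
      using insert.hyps by (intro sum.cong) auto
    then show "p x = (\<Sum>i\<in>insert k I. (c(k := a)) i * b i x)"
      using insert.hyps by (simp add: p_def)
  qed
  have pW: "p \<in> ?W (insert k I)" using p by (rule image_eqI[where x="c(k := a)"]) simp
  show ?case
  proof (intro bexI[OF _ pW] ballI)
    fix q assume "q \<in> ?W (insert k I)"
    then obtain d where "q = (\<lambda>x. \<Sum>i\<in>insert k I. d i * b i x)" by blast
    then have q: "q = (\<lambda>x. (\<Sum>i\<in>I. d i * b i x) + d k * b k x)"
      using insert.hyps by (simp add: add.commute)
    have Lvp: "L2 S (\<lambda>x. v x - p x)" by (rule L2_diff[OF insert.prems(2) L[OF pW order_refl]])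
    have qI: "(\<lambda>x. \<Sum>i\<in>I. d i * b i x) \<in> ?W I" by (rule rangeI)
    have "(\<integral>x. (v x - p x) * q x \<partial>lebesgue_on S)
      = (\<integral>x. ((\<Sum>i\<in>I. d i * b i x) + d k * b k x) * (v x - p x) \<partial>lebesgue_on S)"
      unfolding q by (simp add: mult.commute)
    also have "\<dots> = (\<integral>x. (\<Sum>i\<in>I. d i * b i x) * (v x - p x) \<partial>lebesgue_on S)
        + d k * (\<integral>x. b k x * (v x - p x) \<partial>lebesgue_on S)"
      by (rule L2_integral_lincomb_real[OF L[OF qI subset_insertI] insert.prems(1)[OF insertI1] Lvp])
    also have "\<dots> = 0" using ca(1)[OF qI] ca(2) by (simp add: p_def mult.commute)
    finally show "(\<integral>x. (v x - p x) * q x \<partial>lebesgue_on S) = 0" .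
  qed
qed

text \<open>Doubly indexed coefficients become one family over pairs, the form required by
  \<open>projection_onto_span\<close>.\<close>

lemma polys_eq_span:
  "polys l = range (\<lambda>c x. \<Sum>ij\<in>{(i, j). int i + int j \<le> l}. c ij * ((x $ 1) ^ fst ij * (x $ 2) ^ snd ij))"
proof (intro set_eqI iffI)
  fix p assume "p \<in> polys l"
  then obtain c where "\<And>x. p x = (\<Sum>(i, j)\<in>{(i, j). int i + int j \<le> l}. c i j * (x $ 1) ^ i * (x $ 2) ^ j)"
    unfolding polys_def by blast
  then have "p = (\<lambda>x. \<Sum>ij\<in>{(i, j). int i + int j \<le> l}. (case_prod c) ij * ((x $ 1) ^ fst ij * (x $ 2) ^ snd ij))"
    by (simp add: fun_eq_iff case_prod_unfold mult.assoc)
  then show "p \<in> range (\<lambda>c x. \<Sum>ij\<in>{(i, j). int i + int j \<le> l}. c ij * ((x $ 1) ^ fst ij * (x $ 2) ^ snd ij))"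
    by (rule image_eqI[where x="case_prod c"]) simp
next
  fix p :: "pt \<Rightarrow> real"
  assume "p \<in> range (\<lambda>c x. \<Sum>ij\<in>{(i, j). int i + int j \<le> l}. c ij * ((x $ 1) ^ fst ij * (x $ 2) ^ snd ij))"
  then obtain c where "p = (\<lambda>x. \<Sum>ij\<in>{(i, j). int i + int j \<le> l}. c ij * ((x $ 1) ^ fst ij * (x $ 2) ^ snd ij))"
    by blast
  then have "p x = (\<Sum>(i, j)\<in>{(i, j). int i + int j \<le> l}. c (i, j) * (x $ 1) ^ i * (x $ 2) ^ j)" for x
    by (simp add: case_prod_unfold mult.assoc)
  then show "p \<in> polys l" unfolding polys_def by (intro CollectI exI[of _ "\<lambda>i j. c (i, j)"] allI)
qed

lemma L2_norm_vec_sq: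
  assumes "\<And>i. L2 S (\<lambda>x. v x $ i)"
  shows "(L2_norm S v)\<^sup>2 = (\<Sum>i\<in>UNIV. (L2_norm S (\<lambda>x. v x $ i))\<^sup>2)"
  unfolding L2_norm_sq norm_vec_sq using assms by (subst Bochner_Integration.integral_sum) (auto simp: L2_def)

context
  fixes S :: "pt set"
  assumes open_S: "open S" and bounded_S: "bounded S"
begin

lemma L2_polys: "p \<in> polys l \<Longrightarrow> L2 S p"
  by (rule L2_C_infinity[OF open_S bounded_S polys_C_infinity])

text \<open>Nothing can be said about the chosen \<open>Pi0\<close> before a projection is known to
  exist. There are finitely many monomials; for l = -1, which occurs in the load when k = 1, there
  are none.\<close>

lemma Pi0_works:
  assumes "L2 S v"
  shows "Pi0 l S v \<in> polys l" "q \<in> polys l \<Longrightarrow> (\<integral>x. (v x - Pi0 l S v x) * q x \<partial>lebesgue_on S) = 0"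
proof -
  have "{(i, j). int i + int j \<le> l} \<subseteq> {..nat l} \<times> {..nat l}" by auto
  then have "finite {(i, j). int i + int j \<le> l}" by (rule finite_subset) simp
  then have "\<exists>p\<in>polys l. \<forall>q\<in>polys l. (\<integral>x. (v x - p x) * q x \<partial>lebesgue_on S) = 0"
    unfolding polys_eq_span
  proof (rule projection_onto_span[OF _ _ assms])
    fix ij
    show "L2 S (\<lambda>x. (x $ 1) ^ fst ij * (x $ 2) ^ snd ij)"
      by (intro L2_C_infinity[OF open_S bounded_S] C_infinity_intros C_infinity_power)
  qed
  then have "Pi0 l S v \<in> polys l \<and> (\<forall>q\<in>polys l. (\<integral>x. (v x - Pi0 l S v x) * q x \<partial>lebesgue_on S) = 0)"
    unfolding Pi0_def Bex_def by (rule someI_ex)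
  then show "Pi0 l S v \<in> polys l" "q \<in> polys l \<Longrightarrow> (\<integral>x. (v x - Pi0 l S v x) * q x \<partial>lebesgue_on S) = 0"
    by auto
qed

lemma L2_Pi0: "L2 S v \<Longrightarrow> L2 S (Pi0 l S v)"
  using Pi0_works(1) by (rule L2_polys)

lemma Pi0_integral:
  assumes "L2 S v" "q \<in> polys l"
  shows "(\<integral>x. Pi0 l S v x * q x \<partial>lebesgue_on S) = (\<integral>x. v x * q x \<partial>lebesgue_on S)"
  using L2_integral_lincomb_real[OF assms(1) L2_Pi0[OF assms(1)] L2_polys[OF assms(2)], of "-1" l]
    Pi0_works(2)[OF assms] by simp

text \<open>Orthogonality turns the squared norm of the projection into its inner product with v,
  and Cauchy-Schwarz cancels one factor.\<close>

lemma Pi0_norm_le: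
  assumes "L2 S v"
  shows "L2_norm S (Pi0 l S v) \<le> L2_norm S v"
proof -
  have "(L2_norm S (Pi0 l S v))\<^sup>2 = (\<integral>x. v x * Pi0 l S v x \<partial>lebesgue_on S)"
    unfolding L2_norm_sq using Pi0_integral[OF assms Pi0_works(1)[OF assms, of l]]
    by (simp add: power2_eq_square)
  also have "\<dots> \<le> L2_norm S v * L2_norm S (Pi0 l S v)"
    using L2_Cauchy_Schwarz[OF assms L2_Pi0[OF assms]] by (simp add: abs_le_iff)
  finally have "L2_norm S (Pi0 l S v) * L2_norm S (Pi0 l S v) \<le> L2_norm S v * L2_norm S (Pi0 l S v)"
    by (simp add: power2_eq_square)
  then show ?thesis
    by (cases "L2_norm S (Pi0 l S v) = 0") (auto simp: mult_le_cancel_right less_le)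
qed

lemma Pi0_lincomb:
  assumes "L2 S u" "L2 S v" "L2 S w" "AE x in lebesgue_on S. u x = v x + c * w x"
  shows "AE x in lebesgue_on S. Pi0 l S u x = Pi0 l S v x + c * Pi0 l S w x"
proof -
  define d where "d x = Pi0 l S u x + (- 1) * (Pi0 l S v x + c * Pi0 l S w x)" for x
  have d: "d \<in> polys l"
    unfolding d_def[abs_def] by (intro polys_lincomb Pi0_works assms)
  have P: "L2 S (Pi0 l S u)" "L2 S (Pi0 l S v)" "L2 S (Pi0 l S w)"
    using assms by (auto intro: L2_Pi0)
  have "(\<integral>x. d x * d x \<partial>lebesgue_on S) = (\<integral>x. Pi0 l S u x * d x \<partial>lebesgue_on S)
      + (- 1) * ((\<integral>x. Pi0 l S v x * d x \<partial>lebesgue_on S) + c * (\<integral>x. Pi0 l S w x * d x \<partial>lebesgue_on S))"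
    unfolding L2_integral_lincomb_real[OF P(2,3) L2_polys[OF d], symmetric]
      L2_integral_lincomb_real[OF P(1) L2_lincomb_real[OF P(2,3)] L2_polys[OF d], symmetric]
    by (simp add: d_def)
  also have "\<dots> = (\<integral>x. u x * d x \<partial>lebesgue_on S)
      + (- 1) * (\<integral>x. (v x + c * w x) * d x \<partial>lebesgue_on S)"
    by (simp add: Pi0_integral[OF _ d] assms L2_integral_lincomb_real[OF assms(2,3) L2_polys[OF d]])
  also have "(\<integral>x. u x * d x \<partial>lebesgue_on S) = (\<integral>x. (v x + c * w x) * d x \<partial>lebesgue_on S)"
    using L2_inner_cong_AE[OF assms(1) L2_lincomb_real[OF assms(2,3)] L2_polys[OF d] L2_polys[OF d] assms(4)] by simp
  finally have "(\<integral>x. d x * d x \<partial>lebesgue_on S) = 0" by simp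
  then have "AE x in lebesgue_on S. d x * d x = 0"
    using L2_mult_integrable[OF L2_polys[OF d] L2_polys[OF d]]
    by (subst (asm) integral_nonneg_eq_0_iff_AE) auto
  then show ?thesis by (rule lebesgue_on_mono) (simp add: d_def)
qed

lemma L2_Pi0_vec: "L2 S v \<Longrightarrow> L2 S (Pi0_vec l S v)"
  by (intro L2_vecI[of S "Pi0_vec l S v"]) (simp add: Pi0_vec_def L2_Pi0 L2_vec_nth)

lemma L2_Pi0_mat: "L2 S \<tau> \<Longrightarrow> L2 S (Pi0_mat l S \<tau>)"
  by (intro L2_vecI[of S "Pi0_mat l S \<tau>"] L2_vecI[of S "\<lambda>x. Pi0_mat l S \<tau> x $ _"])
     (simp add: Pi0_mat_def L2_Pi0 L2_vec_nth)

lemma Pi0_vec_norm_le: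
  assumes "L2 S v"
  shows "L2_norm S (Pi0_vec l S v) \<le> L2_norm S v"
proof (rule power2_le_imp_le)
  have "(L2_norm S (Pi0_vec l S v))\<^sup>2 = (\<Sum>i\<in>UNIV. (L2_norm S (Pi0 l S (\<lambda>x. v x $ i)))\<^sup>2)"
    using assms by (subst L2_norm_vec_sq) (simp_all add: L2_vec_nth L2_Pi0_vec, simp add: Pi0_vec_def)
  also have "\<dots> \<le> (\<Sum>i\<in>UNIV. (L2_norm S (\<lambda>x. v x $ i))\<^sup>2)"
    using assms by (intro sum_mono power_mono Pi0_norm_le L2_vec_nth) auto
  also have "\<dots> = (L2_norm S v)\<^sup>2"
    using assms by (subst L2_norm_vec_sq[symmetric]) (simp_all add: L2_vec_nth)
  finally show "(L2_norm S (Pi0_vec l S v))\<^sup>2 \<le> (L2_norm S v)\<^sup>2" .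
qed simp

lemma Pi0_vec_lincomb:
  assumes "L2 S v" "L2 S w"
  shows "AE x in lebesgue_on S. Pi0_vec l S (\<lambda>x. v x + c *\<^sub>R w x) x = Pi0_vec l S v x + c *\<^sub>R Pi0_vec l S w x"
proof (rule AE_vec_eq)
  fix i
  have "AE x in lebesgue_on S. Pi0 l S (\<lambda>x. (v x + c *\<^sub>R w x) $ i) x = Pi0 l S (\<lambda>x. v x $ i) x + c * Pi0 l S (\<lambda>x. w x $ i) x"
    using assms by (intro Pi0_lincomb L2_vec_nth L2_lincomb) auto
  then show "AE x in lebesgue_on S. Pi0_vec l S (\<lambda>x. v x + c *\<^sub>R w x) x $ i = (Pi0_vec l S v x + c *\<^sub>R Pi0_vec l S w x) $ i"
    by (simp add: Pi0_vec_def)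
qed

lemma Pi0_mat_lincomb:
  assumes "L2 S \<rho>" "L2 S \<sigma>" "L2 S \<tau>" "AE x in lebesgue_on S. \<rho> x = \<sigma> x + c *\<^sub>R \<tau> x"
  shows "AE x in lebesgue_on S. Pi0_mat l S \<rho> x = Pi0_mat l S \<sigma> x + c *\<^sub>R Pi0_mat l S \<tau> x"
proof (intro AE_vec_eq)
  fix i j
  have "AE x in lebesgue_on S. Pi0 l S (\<lambda>x. \<rho> x $ i $ j) x = Pi0 l S (\<lambda>x. \<sigma> x $ i $ j) x + c * Pi0 l S (\<lambda>x. \<tau> x $ i $ j) x"
    by (intro Pi0_lincomb L2_vec_nth assms, rule lebesgue_on_mono[OF assms(4)]) simp
  then show "AE x in lebesgue_on S. Pi0_mat l S \<rho> x $ i $ j = (Pi0_mat l S \<sigma> x + c *\<^sub>R Pi0_mat l S \<tau> x) $ i $ j"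
    by (simp add: Pi0_mat_def)
qed

end

section \<open>Bilinear forms\<close>

text \<open>Additivity and homogeneity are merged to match the closure operation v + c w. The notion
  passes to sums of forms and to smaller spaces, hence from local to global forms.\<close>

definition sym_linear_on :: "(pt \<Rightarrow> pt) set \<Rightarrow> ((pt \<Rightarrow> pt) \<Rightarrow> (pt \<Rightarrow> pt) \<Rightarrow> real) \<Rightarrow> bool" where
  "sym_linear_on W b \<longleftrightarrow> (\<forall>v\<in>W. \<forall>w\<in>W. b v w = b w v) \<and>
    (\<forall>v\<in>W. \<forall>w\<in>W. \<forall>z\<in>W. \<forall>c. b (\<lambda>x. v x + c *\<^sub>R w x) z = b v z + c * b w z)"

lemma symmetric_bilinear_on_imp_sym_linear_on:
  assumes "symmetric_bilinear_on W b"
    and "\<And>v w c. v \<in> W \<Longrightarrow> w \<in> W \<Longrightarrow> (\<lambda>x. v x + c *\<^sub>R w x) \<in> W"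
  shows "sym_linear_on W b"
  unfolding sym_linear_on_def
proof (intro conjI ballI allI)
  fix v w z c assume W: "v \<in> W" "w \<in> W" "z \<in> W"
  have cw: "(\<lambda>x. c *\<^sub>R w x) \<in> W" using assms(2) W(2) by (rule lincomb_closed_scale)
  have "b (\<lambda>x. v x + c *\<^sub>R w x) z = b v z + b (\<lambda>x. c *\<^sub>R w x) z"
    using assms(1) W(1,3) cw unfolding symmetric_bilinear_on_def by metis
  also have "b (\<lambda>x. c *\<^sub>R w x) z = c * b w z"
    using assms(1) W(2,3) unfolding symmetric_bilinear_on_def by metis
  finally show "b (\<lambda>x. v x + c *\<^sub>R w x) z = b v z + c * b w z" .
qed (use assms(1) in \<open>auto simp: symmetric_bilinear_on_def\<close>)

lemma sym_linear_on_add: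
  "sym_linear_on W b \<Longrightarrow> sym_linear_on W b' \<Longrightarrow> sym_linear_on W (\<lambda>v w. b v w + b' v w)"
  by (simp add: sym_linear_on_def algebra_simps)

lemma sym_linear_on_sum:
  "(\<And>P. P \<in> M \<Longrightarrow> sym_linear_on W (b P)) \<Longrightarrow> sym_linear_on W (\<lambda>v w. \<Sum>P\<in>M. b P v w)"
  by (simp add: sym_linear_on_def sum.distrib sum_distrib_left)

lemma sym_linear_on_subset: "sym_linear_on W b \<Longrightarrow> V \<subseteq> W \<Longrightarrow> sym_linear_on V b"
  unfolding sym_linear_on_def by blast

section \<open>Hooke's law and strains\<close>

lemma hooke_inner: "hooke lam mu x \<sigma> \<bullet> \<tau> = 2 * mu x * (\<sigma> \<bullet> \<tau>) + lam x * trace \<sigma> * trace \<tau>"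
  by (simp add: hooke_def inner_add_left inner_vec_def trace_def mat_def sum_2 algebra_simps)

lemma hooke_lincomb: "hooke lam mu x (\<sigma> + c *\<^sub>R \<tau>) = hooke lam mu x \<sigma> + c *\<^sub>R hooke lam mu x \<tau>"
  by (simp add: hooke_def trace_def sum_2 algebra_simps)

lemma abs_trace_le: "\<bar>trace (\<tau> :: real^2^2)\<bar> \<le> 2 * norm \<tau>"
proof -
  have "\<bar>\<tau> $ i $ i\<bar> \<le> norm \<tau>" for i
    using Finite_Cartesian_Product.norm_nth_le[of "\<tau> $ i" i] Finite_Cartesian_Product.norm_nth_le[of \<tau> i] by simp
  from this[of 1] this[of 2] show ?thesis by (simp add: trace_def sum_2)
qed

text \<open>The source of K in the final constant, using that the trace is at most twice the norm.
  The quantifier over \<open>\<tau>\<close> stands inside the almost-everywhere statement, so that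
  tensors depending on x can be inserted.\<close>

lemma hooke_bounded:
  assumes "Linfty S lam" "Linfty S mu"
  obtains K where "K > 0" "AE x in lebesgue_on S. \<forall>\<tau>. norm (hooke lam mu x \<tau>) \<le> K * norm \<tau>"
proof -
  obtain A B where "AE x in lebesgue_on S. \<bar>lam x\<bar> \<le> A" "AE x in lebesgue_on S. \<bar>mu x\<bar> \<le> B"
    using assms by (auto simp: Linfty_def)
  \<comment> \<open>The absolute values guard against negative essential bounds A and B; the summand
    1 keeps K positive for vanishing coefficients.\<close>
  then have "AE x in lebesgue_on S. \<forall>\<tau>. norm (hooke lam mu x \<tau>) \<le> (2 * \<bar>B\<bar> + 2 * \<bar>A\<bar> * norm (mat 1 :: real^2^2) + 1) * norm \<tau>"
  proof eventually_elim
    case (elim x)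
    show ?case
    proof
      fix \<tau> :: "real^2^2"
      have "norm (hooke lam mu x \<tau>) \<le> 2 * \<bar>mu x\<bar> * norm \<tau> + \<bar>lam x\<bar> * \<bar>trace \<tau>\<bar> * norm (mat 1 :: real^2^2)"
        unfolding hooke_def by (rule norm_triangle_le) (simp add: abs_mult)
      also have "\<dots> \<le> 2 * \<bar>B\<bar> * norm \<tau> + \<bar>A\<bar> * (2 * norm \<tau>) * norm (mat 1 :: real^2^2)"
        using elim abs_trace_le[of \<tau>] by (intro add_mono mult_mono) auto
      also have "\<dots> \<le> (2 * \<bar>B\<bar> + 2 * \<bar>A\<bar> * norm (mat 1 :: real^2^2) + 1) * norm \<tau>"
        by (simp add: algebra_simps)
      finally show "norm (hooke lam mu x \<tau>) \<le> (2 * \<bar>B\<bar> + 2 * \<bar>A\<bar> * norm (mat 1 :: real^2^2) + 1) * norm \<tau>" .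
    qed
  qed
  then show thesis by (rule that[rotated]) (simp add: add_nonneg_pos)
qed

lemma L2_hooke:
  assumes "Linfty S lam" "Linfty S mu" and \<tau>: "L2 S \<tau>"
  shows "L2 S (\<lambda>x. hooke lam mu x (\<tau> x))"
  unfolding L2_def
proof
  have "(\<lambda>x. trace (\<tau> x)) \<in> borel_measurable (lebesgue_on S)"
    unfolding trace_def by (intro borel_measurable_sum L2_measurable L2_vec_nth \<tau>)
  then show m: "(\<lambda>x. hooke lam mu x (\<tau> x)) \<in> borel_measurable (lebesgue_on S)"
    unfolding hooke_def using assms L2_measurable[OF \<tau>]
    by (intro borel_measurable_add borel_measurable_scaleR borel_measurable_times borel_measurable_const)
       (auto simp: Linfty_def)
  obtain K where K: "K > 0" "AE x in lebesgue_on S. \<forall>\<tau>. norm (hooke lam mu x \<tau>) \<le> K * norm \<tau>"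
    using hooke_bounded[OF assms(1,2)] by blast
  show "integrable (lebesgue_on S) (\<lambda>x. (norm (hooke lam mu x (\<tau> x)))\<^sup>2)"
  proof (rule Bochner_Integration.integrable_bound)
    show "integrable (lebesgue_on S) (\<lambda>x. K\<^sup>2 * (norm (\<tau> x))\<^sup>2)" using \<tau> by (simp add: L2_def)
    show "AE x in lebesgue_on S. norm ((norm (hooke lam mu x (\<tau> x)))\<^sup>2) \<le> norm (K\<^sup>2 * (norm (\<tau> x))\<^sup>2)"
      using K(2)
    proof eventually_elim
      case (elim x)
      then have "(norm (hooke lam mu x (\<tau> x)))\<^sup>2 \<le> (K * norm (\<tau> x))\<^sup>2" by (intro power_mono) auto
      then show ?case by (simp add: power_mult_distrib)
    qed
  qed (use m in measurable)
qed

lemma Linfty_subset: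
  "Linfty S c \<Longrightarrow> T \<subseteq> S \<Longrightarrow> S \<in> sets lebesgue \<Longrightarrow> T \<in> sets lebesgue \<Longrightarrow> Linfty T c"
  unfolding Linfty_def by (meson AE_lebesgue_on_subset measurable_restrict_mono)

text \<open>The elastic integral on tensor fields: unlike \<open>a_form\<close> it also accepts
  projected strains, which need not be strains of a displacement.\<close>

definition hooke_form :: "(pt \<Rightarrow> real) \<Rightarrow> (pt \<Rightarrow> real) \<Rightarrow> pt set \<Rightarrow> (pt \<Rightarrow> real^2^2) \<Rightarrow> (pt \<Rightarrow> real^2^2) \<Rightarrow> real" where
  "hooke_form lam mu S \<sigma> \<tau> = (\<integral>x. hooke lam mu x (\<sigma> x) \<bullet> \<tau> x \<partial>lebesgue_on S)"

lemma hooke_form_sym: "hooke_form lam mu S \<sigma> \<tau> = hooke_form lam mu S \<tau> \<sigma>"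
  unfolding hooke_form_def hooke_inner by (simp add: inner_commute mult_ac)

lemma hooke_form_lincomb:
  assumes "Linfty S lam" "Linfty S mu" "L2 S \<rho>" "L2 S \<sigma>" "L2 S \<tau>" "L2 S \<eta>"
    "AE x in lebesgue_on S. \<rho> x = \<sigma> x + c *\<^sub>R \<tau> x"
  shows "hooke_form lam mu S \<rho> \<eta> = hooke_form lam mu S \<sigma> \<eta> + c * hooke_form lam mu S \<tau> \<eta>"
proof -
  note H = L2_hooke[OF assms(1,2)]
  have "hooke_form lam mu S \<rho> \<eta> = (\<integral>x. (hooke lam mu x (\<sigma> x) + c *\<^sub>R hooke lam mu x (\<tau> x)) \<bullet> \<eta> x \<partial>lebesgue_on S)"
    unfolding hooke_form_def
  proof (rule L2_inner_cong_AE)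
    show "AE x in lebesgue_on S. hooke lam mu x (\<rho> x) = hooke lam mu x (\<sigma> x) + c *\<^sub>R hooke lam mu x (\<tau> x)"
      using assms(7) by (rule lebesgue_on_mono) (simp add: hooke_lincomb)
  qed (auto intro!: H L2_lincomb assms)
  also have "\<dots> = hooke_form lam mu S \<sigma> \<eta> + c * hooke_form lam mu S \<tau> \<eta>"
    unfolding hooke_form_def by (intro L2_integral_lincomb H assms)
  finally show ?thesis .
qed

lemma L2_strain_jac:
  assumes J: "L2 S (jac S v)"
  shows "L2 S (strain S v)"
proof -
  have "L2 S (\<lambda>x. transpose (jac S v x))"
    by (intro L2_vecI[of S "\<lambda>x. transpose (jac S v x)"] L2_vecI[of S "\<lambda>x. transpose (jac S v x) $ _"])
       (simp add: transpose_def L2_vec_nth J)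
  from L2_lincomb[OF L2_zero L2_lincomb[OF J this, of 1], of "1/2"]
  show ?thesis by (simp add: strain_def[abs_def])
qed

lemma norm_transpose: "norm (transpose (A :: real^'n^'m)) = norm A"
proof -
  have "(norm (transpose A))\<^sup>2 = (norm A)\<^sup>2"
    unfolding norm_vec_sq transpose_def by (simp, rule sum.swap)
  then show ?thesis by simp
qed

text \<open>Transposition preserves the Frobenius norm. This is the elementary comparison of strain
  and gradient; the converse direction, of Korn type, is contained in the coercivity
  assumption.\<close>

lemma norm_strain_le: "norm (strain S v x) \<le> norm (jac S v x)"
  unfolding strain_def
  using norm_triangle_ineq[of "jac S v x" "transpose (jac S v x)"] by (simp add: norm_transpose)

lemma transpose_lincomb: "transpose (A + c *\<^sub>R B) = transpose A + c *\<^sub>R transpose (B :: real^'n^'m)"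
  by (simp add: transpose_def vec_eq_iff)

section \<open>Meshes\<close>

text \<open>A finite union of segments, each convex with empty interior in the plane.\<close>

lemma negligible_polypath: "negligible (path_image (polypath vs))"
proof (induction vs rule: polypath.induct)
  case (4 a b c vs)
  have "negligible (path_image (linepath a b) \<union> path_image (polypath (b # c # vs)))"
    using 4 by (simp add: negligible_convex_interior interior_closed_segment_ge2)
  then show ?case by (rule negligible_subset) (simp add: path_image_join_subset del: path_image_linepath)
qed (simp_all add: negligible_convex_interior interior_closed_segment_ge2)

lemma compact_polygon_boundary: "simple_polygon P \<Longrightarrow> compact (polygon_boundary P)"
  by (simp add: simple_polygon_def polygon_boundary_def compact_path_image simple_path_imp_path)

context
  fixes \<Omega> :: "pt set" and M :: "pt list set"
  assumes open_\<Omega>: "open \<Omega>" and bounded_\<Omega>: "bounded \<Omega>" and mesh: "is_mesh \<Omega> M"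
begin

lemma region_subset: "P \<in> M \<Longrightarrow> region P \<subseteq> \<Omega>"
  using mesh by (simp add: is_mesh_def)

lemma open_region: "P \<in> M \<Longrightarrow> open (region P)"
  using mesh compact_polygon_boundary
  by (auto simp: is_mesh_def region_def intro!: open_inside compact_imp_closed)

lemma bounded_region: "P \<in> M \<Longrightarrow> bounded (region P)"
  using bounded_subset[OF bounded_\<Omega> region_subset] .

text \<open>A point of \<open>\<Omega>\<close> in no element still lies in the closure of one.
  Elements are open, so it is a frontier point and lies on a polygon boundary.\<close>

lemma negligible_skeleton: "negligible (\<Omega> - (\<Union>P\<in>M. region P))"
proof (rule negligible_subset)
  show "negligible (\<Union>P\<in>M. polygon_boundary P)"
    using mesh unfolding is_mesh_def polygon_boundary_def
    by (auto intro!: negligible_Union simp: negligible_polypath)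
  show "\<Omega> - (\<Union>P\<in>M. region P) \<subseteq> (\<Union>P\<in>M. polygon_boundary P)"
  proof
    fix x assume x: "x \<in> \<Omega> - (\<Union>P\<in>M. region P)"
    then have "x \<in> closure \<Omega>" using closure_subset by auto
    then obtain P where P: "P \<in> M" "x \<in> closure (region P)" using mesh unfolding is_mesh_def by auto
    then have "x \<in> frontier (region P)"
      using x open_region[OF P(1)] by (simp add: frontier_def interior_open)
    also have "\<dots> \<subseteq> polygon_boundary P"
      unfolding region_def using mesh P(1) compact_polygon_boundary
      by (intro frontier_inside_subset compact_imp_closed) (auto simp: is_mesh_def)
    finally show "x \<in> (\<Union>P\<in>M. polygon_boundary P)" using P(1) by blast
  qed
qed

lemma region_unique: "P \<in> M \<Longrightarrow> Q \<in> M \<Longrightarrow> x \<in> region P \<Longrightarrow> x \<in> region Q \<Longrightarrow> P = Q"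
proof -
  have "\<forall>P\<in>M. \<forall>Q\<in>M. P \<noteq> Q \<longrightarrow> region P \<inter> region Q = {}" using mesh by (simp add: is_mesh_def)
  then show "P \<in> M \<Longrightarrow> Q \<in> M \<Longrightarrow> x \<in> region P \<Longrightarrow> x \<in> region Q \<Longrightarrow> P = Q" by auto
qed

lemma finite_mesh: "finite M"
  using mesh by (simp add: is_mesh_def)

lemma sum_indicator_region:
  fixes f :: "pt list \<Rightarrow> 'b::real_vector"
  assumes "P \<in> M" "x \<in> region P"
  shows "(\<Sum>Q\<in>M. indicator (region Q) x *\<^sub>R f Q) = f P"
proof -
  have "indicator (region Q) x *\<^sub>R f Q = (if Q = P then f P else 0)" if "Q \<in> M" for Q
  proof (cases "Q = P")
    case False
    then have "x \<notin> region Q" using region_unique[OF assms(1) that assms(2)] by blast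
    then show ?thesis using False by simp
  qed (simp add: assms)
  then have "(\<Sum>Q\<in>M. indicator (region Q) x *\<^sub>R f Q) = (\<Sum>Q\<in>M. if Q = P then f P else 0)"
    by (intro sum.cong) auto
  then show ?thesis using assms finite_mesh by simp
qed

text \<open>Off the skeleton, the indicators of the disjoint elements add up to the indicator of
  \<open>\<Omega>\<close>.\<close>

lemma mesh_integral:
  fixes f :: "pt \<Rightarrow> real"
  assumes f: "integrable (lebesgue_on \<Omega>) f"
  shows "(\<integral>x. f x \<partial>lebesgue_on \<Omega>) = (\<Sum>P\<in>M. \<integral>x. f x \<partial>lebesgue_on (region P))"
proof -
  have \<Omega>: "\<Omega> \<in> sets lebesgue" using open_\<Omega> by auto
  have R: "region P \<in> sets lebesgue" if "P \<in> M" for P using open_region[OF that] by auto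
  have fP: "integrable lebesgue (\<lambda>x. indicator (region P) x *\<^sub>R f x)" if "P \<in> M" for P
  proof -
    have "integrable lebesgue (\<lambda>x. indicator \<Omega> x *\<^sub>R f x)"
      by (rule integrable_restrict_space[THEN iffD1, OF _ f]) (simp add: \<Omega>)
    then have "integrable lebesgue (\<lambda>x. indicator (region P) x *\<^sub>R (indicator \<Omega> x *\<^sub>R f x))"
      by (rule integrable_mult_indicator[OF R[OF that]])
    also have "(\<lambda>x. indicator (region P) x *\<^sub>R (indicator \<Omega> x *\<^sub>R f x)) = (\<lambda>x. indicator (region P) x *\<^sub>R f x)"
      using region_subset[OF that] by (auto simp: indicator_def fun_eq_iff)
    finally show ?thesis .
  qed
  have "(\<integral>x. f x \<partial>lebesgue_on \<Omega>) = (\<integral>x. indicator \<Omega> x *\<^sub>R f x \<partial>lebesgue)"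
    by (rule integral_restrict_space) (simp add: \<Omega>)
  also have "\<dots> = (\<integral>x. (\<Sum>P\<in>M. indicator (region P) x *\<^sub>R f x) \<partial>lebesgue)"
  proof (rule integral_cong_AE)
    show "(\<lambda>x. indicator \<Omega> x *\<^sub>R f x) \<in> borel_measurable lebesgue"
      by (rule borel_measurable_integrable, rule integrable_restrict_space[THEN iffD1, OF _ f]) (simp add: \<Omega>)
    show "(\<lambda>x. \<Sum>P\<in>M. indicator (region P) x *\<^sub>R f x) \<in> borel_measurable lebesgue"
      using fP by (intro borel_measurable_sum borel_measurable_integrable)
    have "AE x in lebesgue. x \<notin> \<Omega> - (\<Union>P\<in>M. region P)"
      using negligible_skeleton by (intro AE_not_in) (simp add: negligible_iff_null_sets)
    then show "AE x in lebesgue. indicator \<Omega> x *\<^sub>R f x = (\<Sum>P\<in>M. indicator (region P) x *\<^sub>R f x)"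
    proof (rule AE_mp, intro AE_I2 impI)
      fix x assume x: "x \<notin> \<Omega> - (\<Union>P\<in>M. region P)"
      show "indicator \<Omega> x *\<^sub>R f x = (\<Sum>P\<in>M. indicator (region P) x *\<^sub>R f x)"
      proof (cases "x \<in> \<Omega>")
        case True
        then obtain P where P: "P \<in> M" "x \<in> region P" using x by auto
        show ?thesis unfolding sum_indicator_region[OF P, of "\<lambda>_. f x"] using True by simp
      next
        case False
        then have "x \<notin> region P" if "P \<in> M" for P using region_subset[OF that] by auto
        then show ?thesis using False by simp
      qed
    qed
  qed
  also have "\<dots> = (\<Sum>P\<in>M. \<integral>x. indicator (region P) x *\<^sub>R f x \<partial>lebesgue)"
    using fP by (rule Bochner_Integration.integral_sum)
  also have "\<dots> = (\<Sum>P\<in>M. \<integral>x. f x \<partial>lebesgue_on (region P))"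
    using R by (intro sum.cong) (auto simp: integral_restrict_space)
  finally show ?thesis .
qed

lemma L2_region: "L2 \<Omega> v \<Longrightarrow> P \<in> M \<Longrightarrow> L2 (region P) v"
  using open_\<Omega> open_region by (intro L2_subset[OF _ region_subset]) auto

lemma mesh_L2_norm_sq:
  assumes "L2 \<Omega> v"
  shows "(L2_norm \<Omega> v)\<^sup>2 = (\<Sum>P\<in>M. (L2_norm (region P) v)\<^sup>2)"
  unfolding L2_norm_sq using assms by (intro mesh_integral) (simp add: L2_def)

text \<open>A test function on an element is one on \<open>\<Omega>\<close>, and since it and its
  derivatives vanish off the element, both integrals may be taken over either set.\<close>

lemma has_weak_grad_region:
  assumes "L2 \<Omega> v" "has_weak_grad \<Omega> v g" "P \<in> M"
  shows "has_weak_grad (region P) v g"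
  unfolding has_weak_grad_def
proof (intro conjI ballI allI)
  show "L2 (region P) g" using assms by (auto simp: has_weak_grad_def intro: L2_region)
  fix \<phi> i assume \<phi>: "\<phi> \<in> test_functions (region P)"
  have sub: "(\<integral>x. f x \<partial>lebesgue_on (region P)) = (\<integral>x. f x \<partial>lebesgue_on \<Omega>)"
    if "\<And>x. x \<notin> region P \<Longrightarrow> f x = 0" for f :: "pt \<Rightarrow> real"
  proof -
    have "(\<lambda>x. indicator (region P) x *\<^sub>R f x) = (\<lambda>x. indicator \<Omega> x *\<^sub>R f x)"
      using that region_subset[OF assms(3)] by (auto simp: indicator_def fun_eq_iff)
    moreover have "region P \<in> sets lebesgue" "\<Omega> \<in> sets lebesgue"
      using open_region[OF assms(3)] open_\<Omega> by auto
    ultimately show ?thesis by (simp add: integral_restrict_space)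
  qed
  have "(\<integral>x. v x * pderiv_at i \<phi> x \<partial>lebesgue_on (region P)) = (\<integral>x. v x * pderiv_at i \<phi> x \<partial>lebesgue_on \<Omega>)"
    by (rule sub) (simp add: test_function_outside[OF \<phi>])
  also have "\<dots> = - (\<integral>x. g x $ i * \<phi> x \<partial>lebesgue_on \<Omega>)"
    using assms(2) test_functions_mono[OF region_subset[OF assms(3)] \<phi>] by (simp add: has_weak_grad_def)
  also have "(\<integral>x. g x $ i * \<phi> x \<partial>lebesgue_on \<Omega>) = (\<integral>x. g x $ i * \<phi> x \<partial>lebesgue_on (region P))"
    by (rule sub[symmetric]) (simp add: test_function_outside[OF \<phi>])
  finally show "(\<integral>x. v x * pderiv_at i \<phi> x \<partial>lebesgue_on (region P)) = - (\<integral>x. g x $ i * \<phi> x \<partial>lebesgue_on (region P))" .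
qed

lemma H1_region: "v \<in> H1 \<Omega> \<Longrightarrow> P \<in> M \<Longrightarrow> v \<in> H1 (region P)"
  unfolding H1_def using L2_region has_weak_grad_region by blast

text \<open>Links the local forms, written with element gradients, to the energy norm, written with
  the gradient on \<open>\<Omega>\<close>: both choices are weak gradients on the element.\<close>

lemma jac_region:
  assumes "v \<in> H1_vec \<Omega>" "P \<in> M"
  shows "AE x in lebesgue_on (region P). jac (region P) v x = jac \<Omega> v x"
proof (rule AE_vec_eq)
  fix i
  have v: "(\<lambda>x. v x $ i) \<in> H1 \<Omega>" using assms by (simp add: H1_vec_def)
  have "AE x in lebesgue_on (region P). wgrad (region P) (\<lambda>x. v x $ i) x = wgrad \<Omega> (\<lambda>x. v x $ i) x"
    using v H1_region[OF v assms(2)]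
    by (intro weak_grad_unique[OF open_region[OF assms(2)] bounded_region[OF assms(2)] _ _ _ wgrad_works has_weak_grad_region[OF _ wgrad_works assms(2)]])
       (auto intro: H1_L2)
  then show "AE x in lebesgue_on (region P). jac (region P) v x $ i = jac \<Omega> v x $ i"
    by (simp add: jac_def)
qed

end

section \<open>Discrete forms\<close>

lemma L2_strain: "v \<in> H1_vec S \<Longrightarrow> L2 S (strain S v)"
  by (intro L2_strain_jac L2_jac)

lemma strain_lincomb:
  assumes "open S" "bounded S" "v \<in> H1_vec S" "w \<in> H1_vec S"
  shows "AE x in lebesgue_on S. strain S (\<lambda>x. v x + c *\<^sub>R w x) x = strain S v x + c *\<^sub>R strain S w x"
  using jac_lincomb[OF assms, of c]
  by (rule lebesgue_on_mono) (simp add: strain_def transpose_lincomb algebra_simps)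

lemma a_form_le:
  assumes "AE x in lebesgue_on S. \<forall>\<tau>. norm (hooke lam mu x \<tau>) \<le> K * norm \<tau>" "K \<ge> 0"
    and "Linfty S lam" "Linfty S mu" "v \<in> H1_vec S"
  shows "a_form lam mu S v v \<le> K * (H1_seminorm S v)\<^sup>2"
proof -
  have "a_form lam mu S v v \<le> (\<integral>x. K * (norm (jac S v x))\<^sup>2 \<partial>lebesgue_on S)"
    unfolding a_form_def
  proof (rule integral_mono_AE)
    show "integrable (lebesgue_on S) (\<lambda>x. hooke lam mu x (strain S v x) \<bullet> strain S v x)"
      using assms by (intro L2_inner_integrable L2_hooke L2_strain)
    show "integrable (lebesgue_on S) (\<lambda>x. K * (norm (jac S v x))\<^sup>2)"
      using L2_jac[OF assms(5)] by (simp add: L2_def)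
    show "AE x in lebesgue_on S. hooke lam mu x (strain S v x) \<bullet> strain S v x \<le> K * (norm (jac S v x))\<^sup>2"
      using assms(1)
    proof eventually_elim
      case (elim x)
      have "hooke lam mu x (strain S v x) \<bullet> strain S v x \<le> norm (hooke lam mu x (strain S v x)) * norm (strain S v x)"
        by (rule norm_cauchy_schwarz)
      also have "\<dots> \<le> (K * norm (strain S v x)) * norm (strain S v x)"
        using elim by (intro mult_right_mono) auto
      also have "\<dots> = K * (norm (strain S v x) * norm (strain S v x))" by simp
      also have "\<dots> \<le> K * (norm (jac S v x) * norm (jac S v x))"
        using \<open>K \<ge> 0\<close> by (intro mult_left_mono mult_mono norm_strain_le) auto
      finally show ?case by (simp add: power2_eq_square)
    qed
  qed
  then show ?thesis by (simp add: H1_seminorm_def L2_norm_sq)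
qed

lemma VEM_subset_local: "P \<in> M \<Longrightarrow> VEM \<Omega> B \<Gamma>D k M \<subseteq> VEM_local_vec k P"
  by (auto simp: VEM_def)

lemma VEM_H1_vec: "v \<in> VEM \<Omega> B \<Gamma>D k M \<Longrightarrow> v \<in> H1_vec \<Omega>"
  by (auto simp: VEM_def V_space_def)

lemma sym_linear_on_mh_local:
  assumes S: "open (region P)" "bounded (region P)"
    and Sm: "symmetric_bilinear_on (VEM_local_vec k P) (Sm P)"
  shows "sym_linear_on (VEM_local_vec k P) (mh_local k Sm P)"
proof -
  let ?W = "VEM_local_vec k P"
  have L: "L2 (region P) v" if "v \<in> ?W" for v
    using VEM_local_vec_H1_vec[OF that] by (rule H1_vec_L2)
  note LP = L2_Pi0_vec[OF S L]
  have "sym_linear_on ?W (\<lambda>v w. \<integral>x. Pi0_vec (int k) (region P) v x \<bullet> Pi0_vec (int k) (region P) w x \<partial>lebesgue_on (region P))"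
    unfolding sym_linear_on_def
  proof (intro conjI ballI allI)
    fix v w z c assume W: "v \<in> ?W" "w \<in> ?W" "z \<in> ?W"
    have "(\<integral>x. Pi0_vec (int k) (region P) (\<lambda>x. v x + c *\<^sub>R w x) x \<bullet> Pi0_vec (int k) (region P) z x \<partial>lebesgue_on (region P))
      = (\<integral>x. (Pi0_vec (int k) (region P) v x + c *\<^sub>R Pi0_vec (int k) (region P) w x) \<bullet> Pi0_vec (int k) (region P) z x \<partial>lebesgue_on (region P))"
      using W by (intro L2_inner_cong_AE L2_lincomb LP Pi0_vec_lincomb S L VEM_local_vec_lincomb) auto
    also have "\<dots> = (\<integral>x. Pi0_vec (int k) (region P) v x \<bullet> Pi0_vec (int k) (region P) z x \<partial>lebesgue_on (region P))
      + c * (\<integral>x. Pi0_vec (int k) (region P) w x \<bullet> Pi0_vec (int k) (region P) z x \<partial>lebesgue_on (region P))"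
      using W by (intro L2_integral_lincomb LP)
    finally show "(\<integral>x. Pi0_vec (int k) (region P) (\<lambda>x. v x + c *\<^sub>R w x) x \<bullet> Pi0_vec (int k) (region P) z x \<partial>lebesgue_on (region P))
      = (\<integral>x. Pi0_vec (int k) (region P) v x \<bullet> Pi0_vec (int k) (region P) z x \<partial>lebesgue_on (region P))
      + c * (\<integral>x. Pi0_vec (int k) (region P) w x \<bullet> Pi0_vec (int k) (region P) z x \<partial>lebesgue_on (region P))" .
  qed (simp add: inner_commute)
  from sym_linear_on_add[OF this symmetric_bilinear_on_imp_sym_linear_on[OF Sm VEM_local_vec_lincomb[OF S]]]
  show ?thesis unfolding mh_local_def[abs_def] .
qed

lemma sym_linear_on_ah_local:
  assumes S: "open (region P)" "bounded (region P)" and lm: "Linfty (region P) lam" "Linfty (region P) mu"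
    and Sa: "symmetric_bilinear_on (VEM_local_vec k P) (Sa P)"
  shows "sym_linear_on (VEM_local_vec k P) (ah_local lam mu k Sa P)"
proof -
  let ?W = "VEM_local_vec k P"
  let ?\<pi> = "\<lambda>v. Pi0_mat (int k - 1) (region P) (strain (region P) v)"
  have L: "L2 (region P) (strain (region P) v)" if "v \<in> ?W" for v
    using VEM_local_vec_H1_vec[OF that] by (rule L2_strain)
  note LP = L2_Pi0_mat[OF S L]
  have "sym_linear_on ?W (\<lambda>v w. hooke_form lam mu (region P) (?\<pi> v) (?\<pi> w))"
    unfolding sym_linear_on_def
  proof (intro conjI ballI allI)
    fix v w z c assume W: "v \<in> ?W" "w \<in> ?W" "z \<in> ?W"
    show "hooke_form lam mu (region P) (?\<pi> (\<lambda>x. v x + c *\<^sub>R w x)) (?\<pi> z)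
      = hooke_form lam mu (region P) (?\<pi> v) (?\<pi> z) + c * hooke_form lam mu (region P) (?\<pi> w) (?\<pi> z)"
      using W by (intro hooke_form_lincomb lm LP Pi0_mat_lincomb S L strain_lincomb VEM_local_vec_lincomb VEM_local_vec_H1_vec)
  qed (rule hooke_form_sym)
  from sym_linear_on_add[OF this symmetric_bilinear_on_imp_sym_linear_on[OF Sa VEM_local_vec_lincomb[OF S]]]
  show ?thesis unfolding ah_local_def[abs_def] hooke_form_def .
qed

section \<open>Global forms and load on the virtual element space\<close>

context
  fixes \<Omega> \<Gamma>D :: "pt set" and M B :: "pt list set" and k :: nat
  assumes open_\<Omega>: "open \<Omega>" and bounded_\<Omega>: "bounded \<Omega>" and mesh: "is_mesh \<Omega> M"
begin

private abbreviation "W \<equiv> VEM \<Omega> B \<Gamma>D k M"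

lemma VEM_lincomb: "v \<in> W \<Longrightarrow> w \<in> W \<Longrightarrow> (\<lambda>x. v x + c *\<^sub>R w x) \<in> W"
  unfolding VEM_def
  using V_space_lincomb[OF open_\<Omega> bounded_\<Omega>]
    VEM_local_vec_lincomb[OF open_region[OF open_\<Omega> bounded_\<Omega> mesh] bounded_region[OF open_\<Omega> bounded_\<Omega> mesh]]
  by simp

lemma sym_linear_on_mh:
  assumes "admissible_Sm k lo up M Sm"
  shows "sym_linear_on W (mh k Sm M)"
proof -
  have "sym_linear_on W (mh_local k Sm P)" if "P \<in> M" for P
    using assms that open_region[OF open_\<Omega> bounded_\<Omega> mesh that] bounded_region[OF open_\<Omega> bounded_\<Omega> mesh that]
    by (intro sym_linear_on_subset[OF sym_linear_on_mh_local VEM_subset_local]) (auto simp: admissible_Sm_def)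
  then show ?thesis unfolding mh_def[abs_def] by (rule sym_linear_on_sum)
qed

lemma sym_linear_on_ah:
  assumes "Linfty \<Omega> lam" "Linfty \<Omega> mu" "admissible_Sa lam mu k lo up M Sa"
  shows "sym_linear_on W (ah lam mu k Sa M)"
proof -
  have "sym_linear_on W (ah_local lam mu k Sa P)" if P: "P \<in> M" for P
  proof -
    note R = open_region[OF open_\<Omega> bounded_\<Omega> mesh P] bounded_region[OF open_\<Omega> bounded_\<Omega> mesh P]
    have "Linfty (region P) lam" "Linfty (region P) mu"
      using assms(1,2) R(1) open_\<Omega> region_subset[OF open_\<Omega> bounded_\<Omega> mesh P] by (auto intro: Linfty_subset)
    then show ?thesis using assms(3) P R
      by (intro sym_linear_on_subset[OF sym_linear_on_ah_local VEM_subset_local]) (auto simp: admissible_Sa_def)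
  qed
  then show ?thesis unfolding ah_def[abs_def] by (rule sym_linear_on_sum)
qed

text \<open>The stability constants are the same on all elements, so they survive summation, and the
  local mass forms add up to the squared norm on \<open>\<Omega>\<close>.\<close>

lemma mh_bounds:
  assumes "admissible_Sm k lo up M Sm" "v \<in> W"
  shows "lo * (L2_norm \<Omega> v)\<^sup>2 \<le> mh k Sm M v v" "mh k Sm M v v \<le> up * (L2_norm \<Omega> v)\<^sup>2"
proof -
  have eq: "(L2_norm \<Omega> v)\<^sup>2 = (\<Sum>P\<in>M. m_form (region P) v v)"
    using mesh_L2_norm_sq[OF open_\<Omega> bounded_\<Omega> mesh H1_vec_L2[OF VEM_H1_vec[OF assms(2)]]]
    by (simp add: L2_norm_sq m_form_def power2_norm_eq_inner)
  have "lo * m_form (region P) v v \<le> mh_local k Sm P v v \<and> mh_local k Sm P v v \<le> up * m_form (region P) v v" if "P \<in> M" for P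
    using assms that VEM_subset_local[OF that, of \<Omega> B \<Gamma>D k] by (auto simp: admissible_Sm_def stable_on_def)
  then show "lo * (L2_norm \<Omega> v)\<^sup>2 \<le> mh k Sm M v v" "mh k Sm M v v \<le> up * (L2_norm \<Omega> v)\<^sup>2"
    unfolding eq mh_def sum_distrib_left by (auto intro: sum_mono)
qed

lemma mesh_a_form:
  assumes "Linfty \<Omega> lam" "Linfty \<Omega> mu" "v \<in> H1_vec \<Omega>"
  shows "a_form lam mu \<Omega> v v = (\<Sum>P\<in>M. a_form lam mu (region P) v v)"
proof -
  have "integrable (lebesgue_on \<Omega>) (\<lambda>x. hooke lam mu x (strain \<Omega> v x) \<bullet> strain \<Omega> v x)"
    using assms by (intro L2_inner_integrable L2_hooke L2_strain)
  then have "a_form lam mu \<Omega> v v = (\<Sum>P\<in>M. \<integral>x. hooke lam mu x (strain \<Omega> v x) \<bullet> strain \<Omega> v x \<partial>lebesgue_on (region P))"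
    unfolding a_form_def by (rule mesh_integral[OF open_\<Omega> bounded_\<Omega> mesh])
  also have "\<dots> = (\<Sum>P\<in>M. a_form lam mu (region P) v v)"
    unfolding a_form_def
  proof (rule sum.cong[OF refl], rule L2_inner_cong_AE)
    fix P assume P: "P \<in> M"
    have lm: "Linfty (region P) lam" "Linfty (region P) mu"
      using assms(1,2) open_region[OF open_\<Omega> bounded_\<Omega> mesh P] open_\<Omega> region_subset[OF open_\<Omega> bounded_\<Omega> mesh P]
      by (auto intro: Linfty_subset)
    have H: "v \<in> H1_vec (region P)"
      using assms(3) H1_region[OF open_\<Omega> bounded_\<Omega> mesh _ P] by (simp add: H1_vec_def)
    show L: "L2 (region P) (strain \<Omega> v)" "L2 (region P) (strain (region P) v)"
      using L2_region[OF open_\<Omega> bounded_\<Omega> mesh L2_strain[OF assms(3)] P] L2_strain[OF H] by auto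
    show "L2 (region P) (\<lambda>x. hooke lam mu x (strain \<Omega> v x))" "L2 (region P) (\<lambda>x. hooke lam mu x (strain (region P) v x))"
      using L by (auto intro: L2_hooke[OF lm])
    show ae: "AE x in lebesgue_on (region P). strain \<Omega> v x = strain (region P) v x"
      using jac_region[OF open_\<Omega> bounded_\<Omega> mesh assms(3) P] by (rule lebesgue_on_mono) (simp add: strain_def)
    show "AE x in lebesgue_on (region P). hooke lam mu x (strain \<Omega> v x) = hooke lam mu x (strain (region P) v x)"
      using ae by (rule lebesgue_on_mono) simp
  qed
  finally show ?thesis .
qed

lemma ah_bounds:
  assumes "Linfty \<Omega> lam" "Linfty \<Omega> mu" "admissible_Sa lam mu k lo up M Sa" "v \<in> W"
  shows "lo * a_form lam mu \<Omega> v v \<le> ah lam mu k Sa M v v" "ah lam mu k Sa M v v \<le> up * a_form lam mu \<Omega> v v"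
proof -
  note eq = mesh_a_form[OF assms(1,2) VEM_H1_vec[OF assms(4)]]
  have "lo * a_form lam mu (region P) v v \<le> ah_local lam mu k Sa P v v \<and> ah_local lam mu k Sa P v v \<le> up * a_form lam mu (region P) v v" if "P \<in> M" for P
    using assms(3,4) that VEM_subset_local[OF that, of \<Omega> B \<Gamma>D k] by (auto simp: admissible_Sa_def stable_on_def)
  then show "lo * a_form lam mu \<Omega> v v \<le> ah lam mu k Sa M v v" "ah lam mu k Sa M v v \<le> up * a_form lam mu \<Omega> v v"
    unfolding eq ah_def sum_distrib_left by (auto intro: sum_mono)
qed

text \<open>The projection contracts the norm on each element; squared norms are additive over the
  mesh, so the elementwise projection contracts the norm on \<open>\<Omega>\<close> as well. Its
  square integrability holds because it is a finite sum of polynomials cut off by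
  indicators.\<close>

lemma Fh_bound:
  assumes f: "L2 \<Omega> f" and v: "L2 \<Omega> v"
  shows "\<bar>Fh \<Omega> k M f v\<bar> \<le> L2_norm \<Omega> f * L2_norm \<Omega> v"
proof -
  let ?\<pi> = "Pi0_mesh (int k - 2) M v"
  note R = open_region[OF open_\<Omega> bounded_\<Omega> mesh] bounded_region[OF open_\<Omega> bounded_\<Omega> mesh]
  have vP: "L2 (region P) v" if "P \<in> M" for P using L2_region[OF open_\<Omega> bounded_\<Omega> mesh v that] .
  have LP: "L2 \<Omega> (\<lambda>x. indicator (region P) x *\<^sub>R Pi0_vec (int k - 2) (region P) v x)" if P: "P \<in> M" for P
  proof -
    let ?p = "Pi0_vec (int k - 2) (region P) v"
    have "Pi0 (int k - 2) (region P) (\<lambda>y. v y $ i) \<in> C_infinity" for i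
      by (rule polys_C_infinity[OF Pi0_works(1)[OF R[OF P] L2_vec_nth[OF vP[OF P]]]])
    then have "continuous_on UNIV ?p"
      unfolding Pi0_vec_def by (intro continuous_on_vec_lambda C_infinity_continuous)
    then have p: "L2 \<Omega> ?p" using open_\<Omega> bounded_\<Omega> by (intro continuous_L2_bounded) auto
    have m: "(\<lambda>x. indicator (region P) x *\<^sub>R ?p x) \<in> borel_measurable (lebesgue_on \<Omega>)"
      using R(1)[OF P] L2_measurable[OF p]
      by (intro borel_measurable_scaleR measurable_restrict_space1[OF borel_measurable_indicator]) auto
    moreover have "integrable (lebesgue_on \<Omega>) (\<lambda>x. (norm (indicator (region P) x *\<^sub>R ?p x))\<^sup>2)"
    proof (rule Bochner_Integration.integrable_bound)
      show "integrable (lebesgue_on \<Omega>) (\<lambda>x. (norm (?p x))\<^sup>2)" using p by (simp add: L2_def)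
      show "AE x in lebesgue_on \<Omega>. norm ((norm (indicator (region P) x *\<^sub>R ?p x))\<^sup>2) \<le> norm ((norm (?p x))\<^sup>2)"
        by (intro AE_I2) (simp add: indicator_def)
    qed (use m in measurable)
    ultimately show ?thesis by (simp add: L2_def)
  qed
  have "finite M" using finite_mesh[OF open_\<Omega> bounded_\<Omega> mesh] .
  have "L2 \<Omega> (\<lambda>x. \<Sum>P\<in>N. indicator (region P) x *\<^sub>R Pi0_vec (int k - 2) (region P) v x)" if "N \<subseteq> M" for N
    using finite_subset[OF that \<open>finite M\<close>] that
  proof (induction N rule: finite_induct)
    case empty
    then show ?case by (simp add: L2_zero)
  next
    case (insert P N)
    then have "P \<in> M" "N \<subseteq> M" by auto
    from L2_lincomb[OF LP[OF this(1)] insert.IH[OF this(2)], of 1]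
    show ?case unfolding sum.insert[OF insert.hyps] scaleR_one .
  qed
  from this[OF order_refl] have L: "L2 \<Omega> ?\<pi>" unfolding Pi0_mesh_def[abs_def] .
  have "L2_norm (region P) ?\<pi> \<le> L2_norm (region P) v" if P: "P \<in> M" for P
  proof -
    have "L2_norm (region P) ?\<pi> = L2_norm (region P) (Pi0_vec (int k - 2) (region P) v)"
    proof (rule L2_norm_cong_AE)
      show "AE x in lebesgue_on (region P). ?\<pi> x = Pi0_vec (int k - 2) (region P) v x"
        by (rule AE_I2) (simp add: Pi0_mesh_def sum_indicator_region[OF open_\<Omega> bounded_\<Omega> mesh P])
      show "L2 (region P) ?\<pi>" using L2_region[OF open_\<Omega> bounded_\<Omega> mesh L P] .
      show "L2 (region P) (Pi0_vec (int k - 2) (region P) v)" by (rule L2_Pi0_vec[OF R[OF P] vP[OF P]])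
    qed
    also have "\<dots> \<le> L2_norm (region P) v" by (rule Pi0_vec_norm_le[OF R[OF P] vP[OF P]])
    finally show ?thesis .
  qed
  then have "(L2_norm \<Omega> ?\<pi>)\<^sup>2 \<le> (L2_norm \<Omega> v)\<^sup>2"
    unfolding mesh_L2_norm_sq[OF open_\<Omega> bounded_\<Omega> mesh L] mesh_L2_norm_sq[OF open_\<Omega> bounded_\<Omega> mesh v]
    by (intro sum_mono power_mono) auto
  then have "L2_norm \<Omega> ?\<pi> \<le> L2_norm \<Omega> v" by (rule power2_le_imp_le) simp
  then have "L2_norm \<Omega> f * L2_norm \<Omega> ?\<pi> \<le> L2_norm \<Omega> f * L2_norm \<Omega> v" by (intro mult_left_mono) auto
  then show ?thesis using L2_Cauchy_Schwarz[OF f L] by (simp add: Fh_def)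
qed

end

section \<open>Energy estimates\<close>

context
  fixes W :: "(pt \<Rightarrow> pt) set" and b :: "(pt \<Rightarrow> pt) \<Rightarrow> (pt \<Rightarrow> pt) \<Rightarrow> real"
    and N :: "(pt \<Rightarrow> pt) \<Rightarrow> real" and K :: real
  assumes closed_W: "\<And>v w c. v \<in> W \<Longrightarrow> w \<in> W \<Longrightarrow> (\<lambda>x. v x + c *\<^sub>R w x) \<in> W"
    and form_b: "sym_linear_on W b"
    and nonneg_b: "\<And>v. v \<in> W \<Longrightarrow> 0 \<le> b v v"
    and bound_b: "\<And>v. v \<in> W \<Longrightarrow> b v v \<le> K * (N v)\<^sup>2"
begin

lemma form_sym: "v \<in> W \<Longrightarrow> w \<in> W \<Longrightarrow> b v w = b w v"
  using form_b unfolding sym_linear_on_def by blast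

lemma form_lincomb: "v \<in> W \<Longrightarrow> w \<in> W \<Longrightarrow> z \<in> W \<Longrightarrow> b (\<lambda>x. v x + c *\<^sub>R w x) z = b v z + c * b w z"
  using form_b by (simp add: sym_linear_on_def)

lemma form_square:
  assumes "v \<in> W" "w \<in> W"
  shows "b (\<lambda>x. v x + c *\<^sub>R w x) (\<lambda>x. v x + c *\<^sub>R w x) = b v v + 2 * c * b v w + c\<^sup>2 * b w w"
proof -
  note z = closed_W[OF assms, of c]
  have "b (\<lambda>x. v x + c *\<^sub>R w x) (\<lambda>x. v x + c *\<^sub>R w x)
      = b v (\<lambda>x. v x + c *\<^sub>R w x) + c * b w (\<lambda>x. v x + c *\<^sub>R w x)"
    by (rule form_lincomb[OF assms z])
  also have "b v (\<lambda>x. v x + c *\<^sub>R w x) = b v v + c * b w v"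
    unfolding form_sym[OF assms(1) z] by (rule form_lincomb[OF assms assms(1)])
  also have "b w (\<lambda>x. v x + c *\<^sub>R w x) = b v w + c * b w w"
    unfolding form_sym[OF assms(2) z] by (rule form_lincomb[OF assms assms(2)])
  also have "b w v = b v w" by (rule form_sym[OF assms(2,1)])
  finally show ?thesis by (simp add: power2_eq_square algebra_simps)
qed

lemma form_Cauchy_Schwarz:
  assumes "v \<in> W" "w \<in> W"
  shows "(b v w)\<^sup>2 \<le> b v v * b w w"
proof (rule discriminant_bound)
  fix t
  show "b v v + 2 * t * b v w + t\<^sup>2 * b w w \<ge> 0"
    unfolding form_square[OF assms, symmetric] by (rule nonneg_b[OF closed_W[OF assms]])
qed

lemma form_square_tendsto_0:
  assumes "eventually (\<lambda>s. d s \<in> W) F" "((\<lambda>s. N (d s)) \<longlongrightarrow> 0) F"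
  shows "((\<lambda>s. b (d s) (d s)) \<longlongrightarrow> 0) F"
proof (rule tendsto_sandwich[OF _ _ tendsto_const])
  show "((\<lambda>s. K * (N (d s))\<^sup>2) \<longlongrightarrow> 0) F"
    using tendsto_mult[OF tendsto_const[of K] tendsto_power[OF assms(2), of 2]] by simp
  show "\<forall>\<^sub>F s in F. 0 \<le> b (d s) (d s)" "\<forall>\<^sub>F s in F. b (d s) (d s) \<le> K * (N (d s))\<^sup>2"
    using assms(1) by (auto elim!: eventually_mono intro: nonneg_b bound_b)
qed

text \<open>Stability controls a form on the diagonal only; Cauchy-Schwarz for \<open>b\<close>
  itself extends the control to both arguments.\<close>

lemma form_tendsto_0:
  assumes "eventually (\<lambda>s. d s \<in> W) F" "((\<lambda>s. N (d s)) \<longlongrightarrow> 0) F" "z \<in> W"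
  shows "((\<lambda>s. b z (d s)) \<longlongrightarrow> 0) F"
proof -
  have "((\<lambda>s. sqrt (b z z * b (d s) (d s))) \<longlongrightarrow> 0) F"
    using tendsto_real_sqrt[OF tendsto_mult[OF tendsto_const form_square_tendsto_0[OF assms(1,2)]], of "b z z"] by simp
  moreover have "\<forall>\<^sub>F s in F. norm (b z (d s)) \<le> sqrt (b z z * b (d s) (d s))"
    using assms(1)
  proof eventually_elim
    case (elim s)
    then show ?case using form_Cauchy_Schwarz[OF assms(3) elim] by (simp add: real_le_rsqrt)
  qed
  ultimately show ?thesis by (rule Lim_null_comparison[rotated])
qed

lemma form_continuous:
  assumes "\<And>s. s \<in> I \<Longrightarrow> u s \<in> W" "t \<in> I"
    and "((\<lambda>s. N (\<lambda>x. u s x - u t x)) \<longlongrightarrow> 0) (at t within I)"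
  shows "((\<lambda>s. b (u s) (u s)) \<longlongrightarrow> b (u t) (u t)) (at t within I)"
proof -
  have d: "(\<lambda>x. u s x - u t x) \<in> W" if "s \<in> I" for s
    using closed_W[OF assms(1)[OF that] assms(1)[OF assms(2)], of "-1"] by simp
  have ev: "\<forall>\<^sub>F s in at t within I. s \<in> I" by (simp add: eventually_at_filter)
  have evd: "\<forall>\<^sub>F s in at t within I. (\<lambda>x. u s x - u t x) \<in> W" using ev by eventually_elim (rule d)
  have "((\<lambda>s. b (u t) (u t) + 2 * b (u t) (\<lambda>x. u s x - u t x) + b (\<lambda>x. u s x - u t x) (\<lambda>x. u s x - u t x))
      \<longlongrightarrow> b (u t) (u t) + 2 * 0 + 0) (at t within I)"
    by (intro tendsto_intros form_tendsto_0 form_square_tendsto_0 evd assms)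
  moreover have "\<forall>\<^sub>F s in at t within I. b (u t) (u t) + 2 * b (u t) (\<lambda>x. u s x - u t x)
      + b (\<lambda>x. u s x - u t x) (\<lambda>x. u s x - u t x) = b (u s) (u s)"
    using ev
  proof eventually_elim
    case (elim s)
    then show ?case using form_square[OF assms(1)[OF assms(2)] d[OF elim], of 1] by simp
  qed
  ultimately show ?thesis using Lim_transform_eventually by fastforce
qed

text \<open>Let d be the error of the difference quotient, so that u s = u t + (s - t) (u' + d s)
  exactly. Expanding the square, the quotient becomes 2 b(u t, u' + d) + (s - t) b(u' + d, u' + d),
  where all terms in d tend to zero.\<close>

lemma form_derivative:
  assumes "\<And>s. s \<in> I \<Longrightarrow> u s \<in> W" "t \<in> I" "u' \<in> W"
    and "((\<lambda>s. N (\<lambda>x. (1 / (s - t)) *\<^sub>R (u s x - u t x) - u' x)) \<longlongrightarrow> 0) (at t within I)"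
  shows "((\<lambda>s. b (u s) (u s)) has_real_derivative 2 * b (u t) u') (at t within I)"
proof -
  define d where "d s x = (1 / (s - t)) *\<^sub>R (u s x - u t x) - u' x" for s x
  have N: "((\<lambda>s. N (d s)) \<longlongrightarrow> 0) (at t within I)" using assms(4) by (simp add: d_def[abs_def])
  note ut = assms(1)[OF assms(2)]
  have d: "d s \<in> W" if "s \<in> I" for s
  proof -
    have "(\<lambda>x. (1 / (s - t)) *\<^sub>R (u s x + (- 1) *\<^sub>R u t x)) \<in> W"
      by (rule lincomb_closed_scale[OF closed_W closed_W[OF assms(1)[OF that] ut]])
    from closed_W[OF this assms(3), of "-1"] show ?thesis by (simp add: d_def[abs_def])
  qed
  have ev: "\<forall>\<^sub>F s in at t within I. s \<in> I \<and> s \<noteq> t" by (simp add: eventually_at_filter)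
  have evd: "\<forall>\<^sub>F s in at t within I. d s \<in> W" using ev by eventually_elim (simp add: d)
  have "((\<lambda>s. 2 * (b (u t) u' + b (u t) (d s)) + (s - t) * (b u' u' + 2 * b u' (d s) + b (d s) (d s)))
      \<longlongrightarrow> 2 * (b (u t) u' + 0) + (t - t) * (b u' u' + 2 * 0 + 0)) (at t within I)"
    by (intro tendsto_intros form_tendsto_0 form_square_tendsto_0 evd N ut assms(3))
  then have "((\<lambda>s. 2 * (b (u t) u' + b (u t) (d s)) + (s - t) * (b u' u' + 2 * b u' (d s) + b (d s) (d s)))
      \<longlongrightarrow> 2 * b (u t) u') (at t within I)" by simp
  moreover have "\<forall>\<^sub>F s in at t within I. 2 * (b (u t) u' + b (u t) (d s)) + (s - t) * (b u' u' + 2 * b u' (d s) + b (d s) (d s))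
      = (b (u s) (u s) - b (u t) (u t)) / (s - t)"
    using ev
  proof eventually_elim
    case (elim s)
    then have ds: "d s \<in> W" and st: "s - t \<noteq> 0" using d by auto
    \<comment> \<open>\<open>e\<close> is the difference quotient itself; the factor 1 keeps it in
      the shape v + c w.\<close>
    define e where "e x = u' x + 1 *\<^sub>R d s x" for x
    have eW: "e \<in> W" using closed_W[OF assms(3) ds, of 1] by (simp add: e_def[abs_def])
    have us: "u s = (\<lambda>x. u t x + (s - t) *\<^sub>R e x)"
      using st by (simp add: fun_eq_iff e_def d_def)
    have bee: "b e e = b u' u' + 2 * b u' (d s) + b (d s) (d s)"
      using form_square[OF assms(3) ds, of 1] by (simp add: e_def[abs_def])
    have bue: "b (u t) e = b (u t) u' + b (u t) (d s)"
    proof -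
      have "b (u t) e = b e (u t)" by (rule form_sym[OF ut eW])
      also have "\<dots> = b u' (u t) + 1 * b (d s) (u t)"
        unfolding e_def[abs_def] by (rule form_lincomb[OF assms(3) ds ut])
      finally show ?thesis by (simp add: form_sym[OF ut assms(3)] form_sym[OF ut ds])
    qed
    have "b (u s) (u s) = b (u t) (u t) + 2 * (s - t) * b (u t) e + (s - t)\<^sup>2 * b e e"
      unfolding us by (rule form_square[OF ut eW])
    then have "(b (u s) (u s) - b (u t) (u t)) / (s - t) = 2 * b (u t) e + (s - t) * b e e"
      using st by (simp add: divide_simps power2_eq_square) (simp add: algebra_simps)
    then show ?case by (simp add: bee bue)
  qed
  ultimately show ?thesis unfolding has_field_derivative_iff by (rule Lim_transform_eventually)
qed

end

text \<open>Formally $(\sqrt E)' = E' / (2 \sqrt E) \le c g$; shifting \<open>E\<close> by a positive constant avoids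
  the zeros of \<open>E\<close>.\<close>

lemma sqrt_energy_estimate:
  fixes E D g :: "real \<Rightarrow> real"
  assumes cont: "(E \<longlongrightarrow> E 0) (at 0 within {0..T})"
    and nonneg: "\<And>s. s \<in> {0..T} \<Longrightarrow> 0 \<le> E s"
    and deriv: "\<And>s. s \<in> {0<..T} \<Longrightarrow> (E has_real_derivative D s) (at s within {0<..T})"
    and bound: "\<And>s. s \<in> {0<..T} \<Longrightarrow> D s \<le> 2 * (c * g s * sqrt (E s))"
    and g: "integrable (lebesgue_on {0..T}) g" "\<And>s. 0 \<le> g s" "0 \<le> c"
    and t: "t \<in> {0<..T}"
  shows "sqrt (E t) \<le> sqrt (E 0) + c * (\<integral>s. g s \<partial>lebesgue_on {0..t})"
proof -
  have gt: "integrable (lebesgue_on {s..t}) g" if "s \<ge> 0" for s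
  proof -
    have "integrable lebesgue (\<lambda>x. indicator {s..t} x *\<^sub>R (indicator {0..T} x *\<^sub>R g x))"
      by (rule integrable_mult_indicator, simp, rule integrable_restrict_space[THEN iffD1, OF _ g(1)]) simp
    also have "(\<lambda>x. indicator {s..t} x *\<^sub>R (indicator {0..T} x *\<^sub>R g x)) = (\<lambda>x. indicator {s..t} x *\<^sub>R g x)"
      using t that by (auto simp: indicator_def fun_eq_iff)
    finally show ?thesis by (subst integrable_restrict_space) simp_all
  qed
  let ?G = "\<integral>s. g s \<partial>lebesgue_on {0..t}"
  have step: "sqrt (E t + \<delta>) \<le> sqrt (E 0 + \<delta>) + c * ?G" if \<delta>: "\<delta> > 0" for \<delta>
  proof -
    let ?f = "\<lambda>s. sqrt (E s + \<delta>)"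
    \<comment> \<open>The derivative is available on (0, T] only, so the fundamental theorem is
      applied on [s, t] with s > 0. Continuity of E at 0 then permits the limit s to 0.\<close>
    have le: "?f t - c * ?G \<le> ?f s" if s: "0 < s" "s < t" for s
    proof -
      have "((\<lambda>x. D x / (2 * ?f x)) has_integral ?f t - ?f s) {s..t}"
      proof (rule fundamental_theorem_of_calculus)
        show "s \<le> t" using s by simp
        fix x assume x: "x \<in> {s..t}"
        then have x': "x \<in> {0<..T}" using s t by auto
        have pos: "E x + \<delta> > 0" using nonneg[of x] x' \<delta> by auto
        have "(E has_real_derivative D x) (at x within {s..t})"
          by (rule has_field_derivative_subset[OF deriv[OF x']]) (use s t in auto)
        then have "(?f has_real_derivative D x / (2 * ?f x)) (at x within {s..t})"
          using pos by (auto intro!: derivative_eq_intros simp: divide_simps)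
        then show "(?f has_vector_derivative D x / (2 * ?f x)) (at x within {s..t})"
          by (simp add: has_real_derivative_iff_has_vector_derivative)
      qed
      moreover have "((\<lambda>x. c * g x) has_integral c * (\<integral>x. g x \<partial>lebesgue_on {s..t})) {s..t}"
        using has_integral_integral_lebesgue_on[OF gt[of s]] s by (intro has_integral_mult_right) auto
      moreover have "D x / (2 * ?f x) \<le> c * g x" if x: "x \<in> {s..t}" for x
      proof -
        have x': "x \<in> {0<..T}" using s t x by auto
        have pos: "?f x > 0" using nonneg[of x] x' \<delta> by auto
        have "D x \<le> 2 * (c * g x * sqrt (E x))" by (rule bound[OF x'])
        also have "\<dots> \<le> 2 * (c * g x * ?f x)"
          using g \<delta> by (intro mult_left_mono) auto
        finally show ?thesis using pos by (simp add: divide_simps mult_ac)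
      qed
      ultimately have "?f t - ?f s \<le> c * (\<integral>x. g x \<partial>lebesgue_on {s..t})" by (rule has_integral_le)
      also have "\<dots> \<le> c * ?G"
        using s g(2) gt[of 0] by (intro mult_left_mono integral_mono_lebesgue_on_AE g) auto
      finally show ?thesis by simp
    qed
    have "(?f \<longlongrightarrow> ?f 0) (at_right 0)"
      using cont t unfolding at_within_Icc_at_right[of 0 T] by (intro tendsto_intros) (simp add: at_within_Icc_at_right)
    moreover have "\<forall>\<^sub>F s in at_right 0. ?f t - c * ?G \<le> ?f s"
      using eventually_at_right_real[of 0 t] t by (auto elim!: eventually_mono intro: le)
    ultimately have "?f t - c * ?G \<le> ?f 0" by (rule tendsto_lowerbound) simp
    then show ?thesis by simp
  qed
  show ?thesis
  proof (rule field_le_epsilon)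
    fix e :: real assume e: "e > 0"
    have E: "E t \<ge> 0" "E 0 \<ge> 0" using nonneg t by auto
    \<comment> \<open>The shift is e^2, so that subadditivity of the square root leaves an error of
      exactly e.\<close>
    have "sqrt (E t) \<le> sqrt (E t + e\<^sup>2)" by simp
    also have "\<dots> \<le> sqrt (E 0 + e\<^sup>2) + c * ?G" using step e by simp
    also have "sqrt (E 0 + e\<^sup>2) \<le> sqrt (E 0) + sqrt (e\<^sup>2)" using E by (intro sqrt_add_le_add_sqrt) auto
    finally show "sqrt (E t) \<le> sqrt (E 0) + c * ?G + e" using e by simp
  qed
qed

section \<open>Initial data, load and the energy estimate\<close>

text \<open>Initial conditions hold almost everywhere, while the seminorm depends on the function
  through the choice \<open>wgrad\<close>; uniqueness of weak gradients bridges this.\<close>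

lemma H1_seminorm_cong_AE:
  assumes "open \<Omega>" "bounded \<Omega>" "v \<in> H1_vec \<Omega>" "w \<in> H1_vec \<Omega>" "AE x in lebesgue_on \<Omega>. v x = w x"
  shows "H1_seminorm \<Omega> v = H1_seminorm \<Omega> w"
  unfolding H1_seminorm_def
proof (rule L2_norm_cong_AE)
  show "AE x in lebesgue_on \<Omega>. jac \<Omega> v x = jac \<Omega> w x"
  proof (rule AE_vec_eq)
    fix i
    have H: "(\<lambda>x. v x $ i) \<in> H1 \<Omega>" "(\<lambda>x. w x $ i) \<in> H1 \<Omega>" using assms by (auto simp: H1_vec_def)
    have "AE x in lebesgue_on \<Omega>. v x $ i = w x $ i" using assms(5) by (rule lebesgue_on_mono) simp
    then have "AE x in lebesgue_on \<Omega>. wgrad \<Omega> (\<lambda>x. v x $ i) x = wgrad \<Omega> (\<lambda>x. w x $ i) x"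
      by (rule weak_grad_unique[OF assms(1,2) H1_L2[OF H(1)] H1_L2[OF H(2)] _ wgrad_works[OF H(1)] wgrad_works[OF H(2)]])
    then show "AE x in lebesgue_on \<Omega>. jac \<Omega> v x $ i = jac \<Omega> w x $ i" by (simp add: jac_def)
  qed
qed (use assms in \<open>auto intro: L2_jac\<close>)

text \<open>On a bounded interval g \<le> 1 + g^2 reduces integrability to square integrability. The
  load is given on (0, T], whereas the estimate integrates from 0; the endpoint contributes a null
  set whatever the value there.\<close>

lemma integrable_load_norm:
  assumes "bochner_L2 \<Omega> T f" "T > 0"
  shows "integrable (lebesgue_on {0..T}) (\<lambda>t. L2_norm \<Omega> (f t))"
proof -
  let ?g = "\<lambda>t. L2_norm \<Omega> (f t)"
  have sq: "integrable (lebesgue_on {0<..T}) (\<lambda>t. (?g t)\<^sup>2)" using assms by (simp add: bochner_L2_def)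
  \<comment> \<open>Measurability of g is recovered from that of its square, g being
    nonnegative.\<close>
  then have "(\<lambda>t. sqrt ((?g t)\<^sup>2)) \<in> borel_measurable (lebesgue_on {0<..T})" by measurable
  then have m: "?g \<in> borel_measurable (lebesgue_on {0<..T})" by simp
  have "integrable (lebesgue_on {0<..T}) ?g"
  proof (rule Bochner_Integration.integrable_bound[OF _ m])
    have "integrable (lebesgue_on {0<..T}) (\<lambda>t. 1 :: real)"
      by (intro continuous_integrable_bounded) auto
    then show "integrable (lebesgue_on {0<..T}) (\<lambda>t. 1 + (?g t)\<^sup>2)" using sq by simp
    show "AE t in lebesgue_on {0<..T}. norm (?g t) \<le> norm (1 + (?g t)\<^sup>2)"
    proof (rule AE_I2)
      fix t
      have "2 * ?g t \<le> 1 + (?g t)\<^sup>2" using sum_squares_bound[of 1 "?g t"] by simp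
      moreover have "0 \<le> ?g t" by simp
      ultimately have "?g t \<le> 1 + (?g t)\<^sup>2" by linarith
      then show "norm (?g t) \<le> norm (1 + (?g t)\<^sup>2)" by simp
    qed
  qed
  then have "integrable lebesgue (\<lambda>t. indicator {0<..T} t *\<^sub>R ?g t)"
    by (intro integrable_restrict_space[THEN iffD1]) simp_all
  moreover have "integrable lebesgue (\<lambda>t::real. indicator {0} t *\<^sub>R ?g 0)"
    by (intro integrable_scaleR_left) simp
  ultimately have "integrable lebesgue (\<lambda>t. indicator {0<..T} t *\<^sub>R ?g t + indicator {0} t *\<^sub>R ?g 0)"
    by (rule Bochner_Integration.integrable_add)
  also have "(\<lambda>t. indicator {0<..T} t *\<^sub>R ?g t + indicator {0} t *\<^sub>R ?g 0) = (\<lambda>t. indicator {0..T} t *\<^sub>R ?g t)"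
    using assms(2) by (auto simp: indicator_def fun_eq_iff)
  finally show ?thesis by (subst integrable_restrict_space) simp_all
qed

text \<open>In the constant, the first summand turns the initial norm into sqrt (E 0), the second
  bounds the norm of u' in the load by sqrt E, and the denominator turns sqrt (E t) back into the
  energy norm.\<close>

lemma energy_estimate:
  assumes \<Omega>: "open \<Omega>" "bounded \<Omega>" and mesh: "is_mesh \<Omega> M"
    and lm: "Linfty \<Omega> lam" "Linfty \<Omega> mu"
    and coercive: "c0 > 0" "\<And>v. v \<in> V_space \<Omega> B \<Gamma>D \<Longrightarrow> c0 * (H1_seminorm \<Omega> v)\<^sup>2 \<le> a_form lam mu \<Omega> v v"
    and bounded_a: "K > 0" "\<And>v. v \<in> H1_vec \<Omega> \<Longrightarrow> a_form lam mu \<Omega> v v \<le> K * (H1_seminorm \<Omega> v)\<^sup>2"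
    and pos: "\<mu>_lo > 0" "\<mu>_up > 0" "\<alpha>_lo > 0" "\<alpha>_up > 0"
    and Sm: "admissible_Sm k \<mu>_lo \<mu>_up M Sm" and Sa: "admissible_Sa lam mu k \<alpha>_lo \<alpha>_up M Sa"
    and T: "T > 0" and f: "bochner_L2 \<Omega> T f"
    and u0I: "u0I \<in> VEM \<Omega> B \<Gamma>D k M" and u1I: "u1I \<in> VEM \<Omega> B \<Gamma>D k M"
    and sol: "semidiscrete_solution \<Omega> B \<Gamma>D lam mu k M Sm Sa T f u0I u1I u u' u''"
    and t: "t \<in> {0<..T}"
  shows "energy_norm \<Omega> (u t) (u' t)
    \<le> (sqrt (max \<mu>_up (\<alpha>_up * K)) + 1 / sqrt \<mu>_lo) / sqrt (min \<mu>_lo (\<alpha>_lo * c0))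
      * (energy_norm \<Omega> u0I u1I + (\<integral>\<tau>. L2_norm \<Omega> (f \<tau>) \<partial>lebesgue_on {0..t}))"
proof -
  let ?W = "VEM \<Omega> B \<Gamma>D k M"
  let ?m = "mh k Sm M" and ?a = "ah lam mu k Sa M"
  let ?g = "\<lambda>\<tau>. L2_norm \<Omega> (f \<tau>)"
  define lo where "lo = min \<mu>_lo (\<alpha>_lo * c0)"
  define up where "up = max \<mu>_up (\<alpha>_up * K)"
  have lo: "lo > 0" "lo \<le> \<mu>_lo" "lo \<le> \<alpha>_lo * c0" using pos coercive by (auto simp: lo_def)
  have up: "up > 0" "\<mu>_up \<le> up" "\<alpha>_up * K \<le> up" using pos by (auto simp: up_def)
  have curve: "\<And>s. s \<in> {0..T} \<Longrightarrow> u s \<in> ?W" "\<And>s. s \<in> {0..T} \<Longrightarrow> u' s \<in> ?W"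
    "\<And>s. s \<in> {0<..T} \<Longrightarrow> u'' s \<in> ?W"
    "H1_deriv_on \<Omega> {0..T} u u'" "H1_continuous_on \<Omega> {0..T} u'" "H1_deriv_on \<Omega> {0<..T} u' u''"
    using sol by (auto simp: semidiscrete_solution_def C2_curve_def)
  have eq: "?m (u'' s) v + ?a (u s) v = Fh \<Omega> k M (f s) v" if "s \<in> {0<..T}" "v \<in> ?W" for s v
    using sol that by (simp add: semidiscrete_solution_def)
  note closed_W = VEM_lincomb[OF \<Omega> mesh, of _ B \<Gamma>D k]
  note m_lin = sym_linear_on_mh[OF \<Omega> mesh Sm, of B \<Gamma>D]
  note a_lin = sym_linear_on_ah[OF \<Omega> mesh lm Sa, of B \<Gamma>D]
  have N: "(H1_norm \<Omega> v)\<^sup>2 = (L2_norm \<Omega> v)\<^sup>2 + (H1_seminorm \<Omega> v)\<^sup>2" for v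
    by (simp add: H1_norm_def)
  have m_lo: "\<mu>_lo * (L2_norm \<Omega> v)\<^sup>2 \<le> ?m v v" and m_up: "?m v v \<le> \<mu>_up * (L2_norm \<Omega> v)\<^sup>2" if "v \<in> ?W" for v
    using mh_bounds[OF \<Omega> mesh Sm that] by auto
  have a_lo: "\<alpha>_lo * (c0 * (H1_seminorm \<Omega> v)\<^sup>2) \<le> ?a v v" if "v \<in> ?W" for v
  proof -
    have "v \<in> V_space \<Omega> B \<Gamma>D" using that by (simp add: VEM_def)
    then have "\<alpha>_lo * (c0 * (H1_seminorm \<Omega> v)\<^sup>2) \<le> \<alpha>_lo * a_form lam mu \<Omega> v v"
      using pos by (intro mult_left_mono coercive) auto
    also have "\<dots> \<le> ?a v v" by (rule ah_bounds[OF \<Omega> mesh lm Sa that])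
    finally show ?thesis .
  qed
  have a_up: "?a v v \<le> \<alpha>_up * (K * (H1_seminorm \<Omega> v)\<^sup>2)" if "v \<in> ?W" for v
  proof -
    have "?a v v \<le> \<alpha>_up * a_form lam mu \<Omega> v v" by (rule ah_bounds[OF \<Omega> mesh lm Sa that])
    also have "\<dots> \<le> \<alpha>_up * (K * (H1_seminorm \<Omega> v)\<^sup>2)"
      using pos by (intro mult_left_mono bounded_a VEM_H1_vec[OF that]) auto
    finally show ?thesis .
  qed
  have m_nonneg: "0 \<le> ?m v v" and a_nonneg: "0 \<le> ?a v v" if "v \<in> ?W" for v
    using order_trans[OF _ m_lo[OF that]] order_trans[OF _ a_lo[OF that]] pos coercive(1) by auto
  \<comment> \<open>Both forms are bounded in the full norm \<open>H1_norm\<close>, since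
    differentiability in time is understood in it.\<close>
  have m_bound: "?m v v \<le> \<mu>_up * (H1_norm \<Omega> v)\<^sup>2" if "v \<in> ?W" for v
  proof -
    have "0 \<le> \<mu>_up * (H1_seminorm \<Omega> v)\<^sup>2" using pos by simp
    then show ?thesis using m_up[OF that] unfolding N by (simp add: algebra_simps)
  qed
  have a_bound: "?a v v \<le> (\<alpha>_up * K) * (H1_norm \<Omega> v)\<^sup>2" if "v \<in> ?W" for v
  proof -
    have "0 \<le> (\<alpha>_up * K) * (L2_norm \<Omega> v)\<^sup>2" using pos bounded_a(1) by simp
    then show ?thesis using a_up[OF that] unfolding N by (simp add: algebra_simps)
  qed
  define E where "E s = ?m (u' s) (u' s) + ?a (u s) (u s)" for s
  have E_lo: "lo * (energy_norm \<Omega> (u s) (u' s))\<^sup>2 \<le> E s" if "s \<in> {0..T}" for s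
  proof -
    have "lo * (L2_norm \<Omega> (u' s))\<^sup>2 \<le> \<mu>_lo * (L2_norm \<Omega> (u' s))\<^sup>2"
      "lo * (H1_seminorm \<Omega> (u s))\<^sup>2 \<le> (\<alpha>_lo * c0) * (H1_seminorm \<Omega> (u s))\<^sup>2"
      using lo by (auto intro: mult_right_mono)
    then show ?thesis using m_lo[OF curve(2)[OF that]] a_lo[OF curve(1)[OF that]]
      by (simp add: energy_norm_def E_def algebra_simps)
  qed
  have E_up: "E s \<le> up * (energy_norm \<Omega> (u s) (u' s))\<^sup>2" if "s \<in> {0..T}" for s
  proof -
    have "\<mu>_up * (L2_norm \<Omega> (u' s))\<^sup>2 \<le> up * (L2_norm \<Omega> (u' s))\<^sup>2"
      "(\<alpha>_up * K) * (H1_seminorm \<Omega> (u s))\<^sup>2 \<le> up * (H1_seminorm \<Omega> (u s))\<^sup>2"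
      using up by (auto intro: mult_right_mono)
    then show ?thesis using m_up[OF curve(2)[OF that]] a_up[OF curve(1)[OF that]]
      by (simp add: energy_norm_def E_def algebra_simps)
  qed
  have E_nonneg: "0 \<le> E s" if "s \<in> {0..T}" for s
    using m_nonneg[OF curve(2)[OF that]] a_nonneg[OF curve(1)[OF that]] by (simp add: E_def)
  have a_deriv: "((\<lambda>s. ?a (u s) (u s)) has_real_derivative 2 * ?a (u s) (u' s)) (at s within {0..T})"
    if s: "s \<in> {0..T}" for s
  proof (rule form_derivative[OF closed_W a_lin a_nonneg a_bound curve(1) s curve(2)[OF s]])
    show "((\<lambda>r. H1_norm \<Omega> (\<lambda>x. (1 / (r - s)) *\<^sub>R (u r x - u s x) - u' s x)) \<longlongrightarrow> 0) (at s within {0..T})"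
      using curve(4) s by (simp add: H1_deriv_on_def)
  qed
  have m_deriv: "((\<lambda>s. ?m (u' s) (u' s)) has_real_derivative 2 * ?m (u' s) (u'' s)) (at s within {0<..T})"
    if s: "s \<in> {0<..T}" for s
  proof (rule form_derivative[OF closed_W m_lin m_nonneg m_bound _ s curve(3)[OF s]])
    show "((\<lambda>r. H1_norm \<Omega> (\<lambda>x. (1 / (r - s)) *\<^sub>R (u' r x - u' s x) - u'' s x)) \<longlongrightarrow> 0) (at s within {0<..T})"
      using curve(6) s by (simp add: H1_deriv_on_def)
  qed (auto intro: curve)
  \<comment> \<open>Differentiability of u' is given on (0, T] only, so the mass part needs its own
    continuity argument at 0; for the elastic part it follows from differentiability of u on
    [0, T].\<close>
  have m_cont: "((\<lambda>s. ?m (u' s) (u' s)) \<longlongrightarrow> ?m (u' 0) (u' 0)) (at 0 within {0..T})"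
  proof (rule form_continuous[OF closed_W m_lin m_nonneg m_bound curve(2)])
    show "((\<lambda>s. H1_norm \<Omega> (\<lambda>x. u' s x - u' 0 x)) \<longlongrightarrow> 0) (at 0 within {0..T})"
      using curve(5) T by (simp add: H1_continuous_on_def)
  qed (use T in auto)
  have a_cont: "((\<lambda>s. ?a (u s) (u s)) \<longlongrightarrow> ?a (u 0) (u 0)) (at 0 within {0..T})"
    using DERIV_continuous[OF a_deriv[of 0]] T by (simp add: continuous_within)
  have main: "sqrt (E t) \<le> sqrt (E 0) + 1 / sqrt \<mu>_lo * (\<integral>s. ?g s \<partial>lebesgue_on {0..t})"
  proof (rule sqrt_energy_estimate[where D="\<lambda>s. 2 * Fh \<Omega> k M (f s) (u' s)"])
    show "(E \<longlongrightarrow> E 0) (at 0 within {0..T})"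
      unfolding E_def[abs_def] by (intro tendsto_add m_cont a_cont)
    show "(E has_real_derivative 2 * Fh \<Omega> k M (f s) (u' s)) (at s within {0<..T})" if s: "s \<in> {0<..T}" for s
    proof -
      have s': "s \<in> {0..T}" using s by auto
      have "((\<lambda>s. ?a (u s) (u s)) has_real_derivative 2 * ?a (u s) (u' s)) (at s within {0<..T})"
        by (rule has_field_derivative_subset[OF a_deriv[OF s']]) auto
      from DERIV_add[OF m_deriv[OF s] this]
      have "(E has_real_derivative 2 * ?m (u' s) (u'' s) + 2 * ?a (u s) (u' s)) (at s within {0<..T})"
        by (simp add: E_def[abs_def])
      moreover have "?m (u' s) (u'' s) = ?m (u'' s) (u' s)"
        using m_lin curve(2)[OF s'] curve(3)[OF s] unfolding sym_linear_on_def by blast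
      ultimately show ?thesis using eq[OF s curve(2)[OF s']] by (simp flip: distrib_left)
    qed
    show "2 * Fh \<Omega> k M (f s) (u' s) \<le> 2 * (1 / sqrt \<mu>_lo * ?g s * sqrt (E s))" if s: "s \<in> {0<..T}" for s
    proof -
      have s': "s \<in> {0..T}" using s by auto
      have fs: "L2 \<Omega> (f s)" using f s by (auto simp: bochner_L2_def)
      have "\<mu>_lo * (L2_norm \<Omega> (u' s))\<^sup>2 \<le> E s"
        using m_lo[OF curve(2)[OF s']] a_nonneg[OF curve(1)[OF s']] by (simp add: E_def)
      then have "sqrt (\<mu>_lo * (L2_norm \<Omega> (u' s))\<^sup>2) \<le> sqrt (E s)" by simp
      then have v: "L2_norm \<Omega> (u' s) \<le> 1 / sqrt \<mu>_lo * sqrt (E s)"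
        using pos by (simp add: real_sqrt_mult field_simps)
      have "Fh \<Omega> k M (f s) (u' s) \<le> ?g s * L2_norm \<Omega> (u' s)"
        using Fh_bound[OF \<Omega> mesh fs H1_vec_L2[OF VEM_H1_vec[OF curve(2)[OF s']]], of k] by simp
      also have "\<dots> \<le> ?g s * (1 / sqrt \<mu>_lo * sqrt (E s))" using v by (intro mult_left_mono) auto
      also have "\<dots> = 1 / sqrt \<mu>_lo * ?g s * sqrt (E s)" by simp
      finally show ?thesis by linarith
    qed
  qed (use E_nonneg integrable_load_norm[OF f T] pos t in auto)
  have "u 0 \<in> ?W" "u' 0 \<in> ?W" using curve(1,2) T by auto
  then have e0: "energy_norm \<Omega> (u 0) (u' 0) = energy_norm \<Omega> u0I u1I"
    using sol H1_seminorm_cong_AE[OF \<Omega> VEM_H1_vec VEM_H1_vec, of "u 0" B \<Gamma>D k M u0I B \<Gamma>D k M]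
      L2_norm_cong_AE[OF H1_vec_L2 H1_vec_L2, OF VEM_H1_vec VEM_H1_vec, of "u' 0" \<Omega> B \<Gamma>D k M u1I B \<Gamma>D k M] u0I u1I
    by (simp add: energy_norm_def semidiscrete_solution_def)
  let ?G = "\<integral>s. ?g s \<partial>lebesgue_on {0..t}"
  have e_nonneg: "energy_norm \<Omega> v w \<ge> 0" for v w by (simp add: energy_norm_def)
  have G: "?G \<ge> 0" by (rule Bochner_Integration.integral_nonneg) simp
  have "sqrt (E 0) \<le> sqrt (up * (energy_norm \<Omega> u0I u1I)\<^sup>2)"
    using E_up[of 0] T e0 by simp
  then have E0: "sqrt (E 0) \<le> sqrt up * energy_norm \<Omega> u0I u1I"
    using e_nonneg by (simp add: real_sqrt_mult)
  have "sqrt (lo * (energy_norm \<Omega> (u t) (u' t))\<^sup>2) \<le> sqrt (E t)"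
    using E_lo[of t] t by simp
  then have "sqrt lo * energy_norm \<Omega> (u t) (u' t) \<le> sqrt (E t)"
    using e_nonneg by (simp add: real_sqrt_mult)
  also have "\<dots> \<le> sqrt up * energy_norm \<Omega> u0I u1I + 1 / sqrt \<mu>_lo * ?G" using main E0 by simp
  \<comment> \<open>Both coefficients are enlarged to their sum, so that a single factor multiplies
    initial norm and load.\<close>
  also have "\<dots> \<le> (sqrt up + 1 / sqrt \<mu>_lo) * energy_norm \<Omega> u0I u1I + (sqrt up + 1 / sqrt \<mu>_lo) * ?G"
    using pos up e_nonneg G by (intro add_mono mult_right_mono) auto
  finally show ?thesis unfolding lo_def[symmetric] up_def[symmetric]
    using lo(1) by (simp add: field_simps)
qed

theorem theorem4p7:
  fixes \<Omega> \<Gamma>D \<Gamma>N :: "pt set" and B :: "pt list set"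
    and lam mu :: "pt \<Rightarrow> real" and k :: nat
    and c0 \<rho> \<mu>_lo \<mu>_up \<alpha>_lo \<alpha>_up :: real
  assumes "polygonal_domain \<Omega> B"
    and "boundary_partition \<Omega> B \<Gamma>D \<Gamma>N"
    and "Linfty \<Omega> lam" and "AE x in lebesgue_on \<Omega>. lam x \<ge> 0"
    and "Linfty \<Omega> mu" and "AE x in lebesgue_on \<Omega>. mu x \<ge> 0"
    and "c0 > 0" and "\<forall>v\<in>V_space \<Omega> B \<Gamma>D. a_form lam mu \<Omega> v v \<ge> c0 * (H1_seminorm \<Omega> v)\<^sup>2"
    and "k \<ge> 1"
    and "\<rho> > 0" and "\<mu>_lo > 0" and "\<mu>_up > 0" and "\<alpha>_lo > 0" and "\<alpha>_up > 0"
  shows "\<exists>C>0. \<forall>M Sm Sa T f u0 u1 u0I u1I u u' u''.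
      is_mesh \<Omega> M \<longrightarrow> mesh_regular \<rho> M \<longrightarrow>
      admissible_Sm k \<mu>_lo \<mu>_up M Sm \<longrightarrow>
      admissible_Sa lam mu k \<alpha>_lo \<alpha>_up M Sa \<longrightarrow>
      T > 0 \<longrightarrow> bochner_L2 \<Omega> T f \<longrightarrow>
      is_interpolant \<Omega> B \<Gamma>D k M u0 u0I \<longrightarrow>
      is_interpolant \<Omega> B \<Gamma>D k M u1 u1I \<longrightarrow>
      semidiscrete_solution \<Omega> B \<Gamma>D lam mu k M Sm Sa T f u0I u1I u u' u'' \<longrightarrow>
      (\<forall>t\<in>{0<..T}. energy_norm \<Omega> (u t) (u' t)
         \<le> C * (energy_norm \<Omega> u0I u1I + (\<integral>\<tau>. L2_norm \<Omega> (f \<tau>) \<partial>lebesgue_on {0..t})))"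
proof -
  have \<Omega>: "open \<Omega>" "bounded \<Omega>" using assms(1) by (auto simp: polygonal_domain_def)
  \<comment> \<open>K depends on lam and mu only, hence is available before any mesh is
    fixed.\<close>
  obtain K where K: "K > 0" "AE x in lebesgue_on \<Omega>. \<forall>\<tau>. norm (hooke lam mu x \<tau>) \<le> K * norm \<tau>"
    using hooke_bounded[OF assms(3,5)] by blast
  have aK: "a_form lam mu \<Omega> v v \<le> K * (H1_seminorm \<Omega> v)\<^sup>2" if "v \<in> H1_vec \<Omega>" for v
    using K by (intro a_form_le assms that) auto
  have coercive: "c0 * (H1_seminorm \<Omega> v)\<^sup>2 \<le> a_form lam mu \<Omega> v v" if "v \<in> V_space \<Omega> B \<Gamma>D" for v
    using assms(8) that by blast
  have "(sqrt (max \<mu>_up (\<alpha>_up * K)) + 1 / sqrt \<mu>_lo) / sqrt (min \<mu>_lo (\<alpha>_lo * c0)) > 0"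
    using assms by (intro divide_pos_pos add_pos_pos) (auto simp: less_max_iff_disj)
  moreover have interp: "wI \<in> VEM \<Omega> B \<Gamma>D k M" if "is_interpolant \<Omega> B \<Gamma>D k M w wI" for M w wI
    using that by (simp add: is_interpolant_def)
  \<comment> \<open>\<open>assumption\<close> instantiates C by the number just shown positive,
    which is the constant of \<open>energy_estimate\<close>.\<close>
  ultimately show ?thesis
    by (intro exI conjI allI impI ballI)
       (assumption, rule energy_estimate[OF \<Omega> _ assms(3,5,7) coercive K(1) aK assms(11-14) _ _ _ _ interp interp])
qed

end
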